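(* Let the torus bundle $N$ over $B=S^1$ be determined by the gluing matrix $\overline A\in GL(2,\mathbb{Z})$. Given a fiberwise map $f:N\to N$, let $f|_*$ denote the (linear) endomorphism of $\mathbb{Z}^2$ (and, by extension, of $\mathbb{R}^2$) induced on the fundamental group of a single fiber of $N$. Let $W_{+1}\subset\mathbb{R}^2$ be the (real) eigenspace of $f|_*$ with eigenvalue $+1$. Case 0: $\dim W_{+1}=0$. Here $\mathrm{MC}_B(f,\mathrm{id})=\infty$. In contrast, $\mathrm{MCC}_B(f,\mathrm{id})$ is the (finite) number of all orbits of the affine selfmap $\beta_{\overline v}$ on $\mathbb{Z}^2/(f|_*-\mathrm{id})\mathbb{Z}^2$. Case 1: $\dim W_{+1}=1$. Here $\mathrm{MC}_B(f,\mathrm{id})=0$ if $\mathrm{MCC}_B(f,\mathrm{id})=0$, and $\mathrm{MC}_B(f,\mathrm{id})=\infty$ else. Moreover, with $q,\overline v_1,\overline v_2$ as defined in the context: If $\overline A$ restricts to the identity map on the eigenline $W_{+1}$, then $\mathrm{MCC}_B(f,\mathrm{id})=q\cdot|\overline v_2|$. If $\overline A|W_{+1}=-\mathrm{id}$ and $\overline v_2$ is odd, then $\mathrm{MC}_B(f,\mathrm{id})=\mathrm{MCC}_B(f,\mathrm{id})=0$. If $\overline A|W_{+1}=-\mathrm{id}$ and $\overline v_2=0$, then $$\mathrm{MCC}_B(f,\mathrm{id})=\begin{cases}r:=\gcd(q,\overline v_1)&\text{if }\det\overline A=-1\text{ and }\tfrac qr\text{ is odd};\\ 2&\text{if }\det\overline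 A=+1\text{ and }q\equiv\overline v_1\equiv0\ (2);\\ 1&\text{if }\det\overline A=+1\text{ and }q\text{ is odd};\\ 0&\text{else.}\end{cases}$$ Case 2: $\dim W_{+1}=2$ (i.e. $f|_*\equiv\mathrm{id}$). Here $\mathrm{MC}_B(f,\mathrm{id})=\mathrm{MCC}_B(f,\mathrm{id})=0$.
   Context: Let $T^2=\mathbb{R}^2/\mathbb{Z}^2$, $q_2:\mathbb{R}^2\to T^2$ the projection, $I=[0,1]$, $S^1=I/0\sim1$. $N=(T^2\times I)/(u,1)\sim(A(u),0)$ with projection $p$ to $S^1$, where $A$ is the automorphism of $T^2$ induced by $\overline A$. A continuous $f:N\to N$ is fiberwise if $p\circ f=p$; fiberwise homotopies go through fiberwise maps. The fiber is identified with $T^2=T^2\times\{1\}$, so that its fundamental group is $\mathbb{Z}^2$. Minimum numbers. $\mathrm{MC}_B(f,\mathrm{id})$ (resp. $\mathrm{MCC}_B(f,\mathrm{id})$) is the minimum, over all pairs $(f',h')$ of fiberwise maps with $f'$ fiberwise homotopic to $f$ and $h'$ fiberwise homotopic to $\mathrm{id}$, of the number of points (resp. pathcomponents) of $\{x\in N:f'(x)=h'(x)\}$; equivalently, the minimum number of fixed points (resp. of pathcomponents of the fixed point set) among all maps fiberwise homotopic to $f$. Data. Put $\overline L:=f|_*-\mathrm{id}$. For $\overline v\in\mathbb{Z}^2$ let $s_{\overline v}([t])=[q_2(t\overline v),t]$, a section of $p$; this induces a bijection from $\mathbb{Z}^2/(\overline A-\mathrm{id})\mathbb{Z}^2$ onto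 the homotopy classes of sections of $p$. $[\overline v]$ is the class corresponding to $f\circ s_0$, where $s_0([t])=[0,t]$, and $\overline v$ is a representative. $\beta_{\overline v}$ is the bijection of $\mathbb{Z}^2/\overline L(\mathbb{Z}^2)$ with $\beta_{\overline v}[\overline u]=[\overline A(\overline u-\overline v)]$; orbits are those of the $\mathbb{Z}$-action given by its iterates. In Case 1 (where $\overline L(\mathbb{R}^2)$ is a line) choose a basis $\overline y_1,\overline y_2$ of $\mathbb{Z}^2$ such that $\overline y_1$ generates $\mathbb{Z}^2\cap\overline L(\mathbb{R}^2)$ and $\overline y_2$ realizes the minimal strictly positive distance of elements of $\mathbb{Z}^2$ from the line $\overline L(\mathbb{R}^2)$. Write $\overline v=\overline v_1\overline y_1+\overline v_2\overline y_2$ with integers $\overline v_1,\overline v_2$. Let $q\ge1$ be the order of the torsion subgroup $(\mathbb{Z}^2\cap\overline L(\mathbb{R}^2))/\overline L(\mathbb{Z}^2)$ of $\mathbb{Z}^2/\overline L(\mathbb{Z}^2)$. The map $\overline A$ preserves $W_{+1}$ and acts on it as $a\cdot\mathrm{id}$ with $a=\pm1$. If $a=-1$ and $\overline v_2$ is even, the representative $\overline v$ of $[\overline v]$ can be, and is, chosen such that $\overline v_2=0$. *)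

theory Defs
  imports "HOL-Analysis.Analysis"
begin

definition quotient_topology :: "'a topology \<Rightarrow> ('a \<Rightarrow> 'b) \<Rightarrow> 'b topology" where
  "quotient_topology X q =
     topology (\<lambda>U. U \<subseteq> q ` topspace X \<and> openin X {x \<in> topspace X. q x \<in> U})"

lemma openin_quotient_topology:
  "openin (quotient_topology X q) U \<longleftrightarrow>
     U \<subseteq> q ` topspace X \<and> openin X {x \<in> topspace X. q x \<in> U}"
proof -
  have "istopology (\<lambda>U. U \<subseteq> q ` topspace X \<and> openin X {x \<in> topspace X. q x \<in> U})"
    unfolding istopology_def
  proof (intro conjI allI impI, goal_cases)
    case (2 S T)
    have "{x \<in> topspace X. q x \<in> S \<inter> T} =
            {x \<in> topspace X. q x \<in> S} \<inter> {x \<in> topspace X. q x \<in> T}" by blast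
    with 2 show ?case by auto
  next
    case (4 K)
    have "{x \<in> topspace X. q x \<in> \<Union>K} = (\<Union>S\<in>K. {x \<in> topspace X. q x \<in> S})" by blast
    with 4 show ?case by auto
  qed auto
  then show ?thesis
    by (simp add: quotient_topology_def)
qed

lemma quotient_map_quotient_topology: "quotient_map X (quotient_topology X q) q"
proof -
  have "openin (quotient_topology X q) (q ` topspace X)"
    by (simp add: openin_quotient_topology cong: conj_cong)
  then have "topspace (quotient_topology X q) = q ` topspace X"
    by (metis openin_quotient_topology openin_subset openin_topspace subset_antisym)
  then show ?thesis
    by (auto simp: quotient_map_def openin_quotient_topology)
qed

text \<open>The class of a point under the equivalence relation generated by a set of identifications.\<close>

definition glue :: "('a \<times> 'a) set \<Rightarrow> 'a \<Rightarrow> 'a set" where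
  "glue R x = (R \<union> R\<inverse>)\<^sup>* `` {x}"

definition ivec :: "int ^ 2 \<Rightarrow> real ^ 2" where
  "ivec m = (\<chi> i. of_int (m $ i))"

definition torus_proj :: "real ^ 2 \<Rightarrow> (real ^ 2) set" where
  "torus_proj x = {x + ivec m | m. True}"

definition torus :: "(real ^ 2) set topology" where
  "torus = quotient_topology euclidean torus_proj"

definition torus_aut :: "int ^ 2 ^ 2 \<Rightarrow> (real ^ 2) set \<Rightarrow> (real ^ 2) set" where
  "torus_aut A u = (\<lambda>x. map_matrix of_int A *v x) ` u"

definition circle_class :: "real \<Rightarrow> real set" where
  "circle_class = glue {(0, 1)}"

definition circle :: "real set topology" where
  "circle = quotient_topology (top_of_set {0..1}) circle_class"

type_synonym bundle_point = "((real ^ 2) set \<times> real) set"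

definition bundle_class :: "int ^ 2 ^ 2 \<Rightarrow> (real ^ 2) set \<times> real \<Rightarrow> bundle_point" where
  "bundle_class A = glue {((u, 1), (torus_aut A u, 0)) | u. u \<in> topspace torus}"

definition torus_bundle :: "int ^ 2 ^ 2 \<Rightarrow> bundle_point topology" where
  "torus_bundle A = quotient_topology (prod_topology torus (top_of_set {0..1})) (bundle_class A)"

text \<open>All representatives of a point of the bundle have the same image in the circle.\<close>

definition bundle_proj :: "bundle_point \<Rightarrow> real set" where
  "bundle_proj x = the_elem ((\<lambda>(u, t). circle_class t) ` x)"

definition fiberwise :: "int ^ 2 ^ 2 \<Rightarrow> (bundle_point \<Rightarrow> bundle_point) \<Rightarrow> bool" where
  "fiberwise A f \<longleftrightarrow> continuous_map (torus_bundle A) (torus_bundle A) f \<and>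
     (\<forall>x \<in> topspace (torus_bundle A). bundle_proj (f x) = bundle_proj x)"

definition fiberwise_homotopic ::
    "int ^ 2 ^ 2 \<Rightarrow> (bundle_point \<Rightarrow> bundle_point) \<Rightarrow> (bundle_point \<Rightarrow> bundle_point) \<Rightarrow> bool" where
  "fiberwise_homotopic A = homotopic_with (fiberwise A) (torus_bundle A) (torus_bundle A)"

definition coincidences ::
    "int ^ 2 ^ 2 \<Rightarrow> (bundle_point \<Rightarrow> bundle_point) \<Rightarrow> (bundle_point \<Rightarrow> bundle_point) \<Rightarrow>
       bundle_point set" where
  "coincidences A f h = {x \<in> topspace (torus_bundle A). f x = h x}"

definition ecount :: "'a set \<Rightarrow> enat" where
  "ecount S = (if finite S then enat (card S) else \<infinity>)"

text \<open>An infimum of a nonempty set of extended natural numbers is attained, hence a minimum.\<close>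

definition MC ::
    "int ^ 2 ^ 2 \<Rightarrow> (bundle_point \<Rightarrow> bundle_point) \<Rightarrow> (bundle_point \<Rightarrow> bundle_point) \<Rightarrow> enat" where
  "MC A f h = Inf {ecount (coincidences A f' h') | f' h'.
     fiberwise_homotopic A f f' \<and> fiberwise_homotopic A h h'}"

definition MCC ::
    "int ^ 2 ^ 2 \<Rightarrow> (bundle_point \<Rightarrow> bundle_point) \<Rightarrow> (bundle_point \<Rightarrow> bundle_point) \<Rightarrow> enat" where
  "MCC A f h =
     Inf {ecount (path_components_of (subtopology (torus_bundle A) (coincidences A f' h'))) | f' h'.
       fiberwise_homotopic A f f' \<and> fiberwise_homotopic A h h'}"

text \<open>The elements of the fundamental group are the sets \<open>loop_class X x g\<close>, where
  \<open>g\<close> is a loop at \<open>x\<close>.\<close>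

definition loop_at :: "'a topology \<Rightarrow> 'a \<Rightarrow> (real \<Rightarrow> 'a) \<Rightarrow> bool" where
  "loop_at X x g \<longleftrightarrow> pathin X g \<and> g 0 = x \<and> g 1 = x"

definition loop_class :: "'a topology \<Rightarrow> 'a \<Rightarrow> (real \<Rightarrow> 'a) \<Rightarrow> (real \<Rightarrow> 'a) set" where
  "loop_class X x g = {g'. homotopic_with (loop_at X x) (top_of_set {0..1}) X g g'}"

definition pi1_map ::
    "'b topology \<Rightarrow> 'a \<Rightarrow> ('a \<Rightarrow> 'b) \<Rightarrow> (real \<Rightarrow> 'a) set \<Rightarrow> (real \<Rightarrow> 'b) set" where
  "pi1_map Y x f C = the_elem ((\<lambda>g. loop_class Y (f x) (f \<circ> g)) ` C)"

text \<open>The standard identification of the lattice with the fundamental group of the torus at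
  \<open>u\<close>: the vector \<open>m\<close> goes to the class of the loop of translates of \<open>u\<close> by \<open>s m\<close>.\<close>

definition torus_pi1 :: "(real ^ 2) set \<Rightarrow> int ^ 2 \<Rightarrow> (real \<Rightarrow> (real ^ 2) set) set" where
  "torus_pi1 u m = loop_class torus u (\<lambda>s. (\<lambda>x. x + s *\<^sub>R ivec m) ` u)"

definition fibre_incl :: "int ^ 2 ^ 2 \<Rightarrow> (real ^ 2) set \<Rightarrow> bundle_point" where
  "fibre_incl A u = bundle_class A (u, 1)"

definition fibre_map ::
    "int ^ 2 ^ 2 \<Rightarrow> (bundle_point \<Rightarrow> bundle_point) \<Rightarrow> (real ^ 2) set \<Rightarrow> (real ^ 2) set" where
  "fibre_map A f u = inv_into (topspace torus) (fibre_incl A) (f (fibre_incl A u))"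

text \<open>The map need not preserve the base point; the groups at \<open>u0\<close> and at its image are both
  identified with the lattice by \<open>torus_pi1\<close>.\<close>

definition fibre_hom ::
    "int ^ 2 ^ 2 \<Rightarrow> (bundle_point \<Rightarrow> bundle_point) \<Rightarrow> int ^ 2 \<Rightarrow> int ^ 2" where
  "fibre_hom A f m =
     (let g = fibre_map A f; u0 = torus_proj 0 in
      inv_into UNIV (torus_pi1 (g u0)) (pi1_map torus u0 g (torus_pi1 u0 m)))"

definition fibre_hom_real ::
    "int ^ 2 ^ 2 \<Rightarrow> (bundle_point \<Rightarrow> bundle_point) \<Rightarrow> real ^ 2 \<Rightarrow> real ^ 2" where
  "fibre_hom_real A f x = map_matrix of_int (matrix (fibre_hom A f)) *v x"

definition W1 :: "int ^ 2 ^ 2 \<Rightarrow> (bundle_point \<Rightarrow> bundle_point) \<Rightarrow> (real ^ 2) set" where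
  "W1 A f = {x. fibre_hom_real A f x = x}"

definition L_lattice :: "int ^ 2 ^ 2 \<Rightarrow> (bundle_point \<Rightarrow> bundle_point) \<Rightarrow> (int ^ 2) set" where
  "L_lattice A f = range (\<lambda>m. fibre_hom A f m - m)"

definition L_plane :: "int ^ 2 ^ 2 \<Rightarrow> (bundle_point \<Rightarrow> bundle_point) \<Rightarrow> (real ^ 2) set" where
  "L_plane A f = range (\<lambda>x. fibre_hom_real A f x - x)"

definition is_section :: "int ^ 2 ^ 2 \<Rightarrow> (real set \<Rightarrow> bundle_point) \<Rightarrow> bool" where
  "is_section A s \<longleftrightarrow> continuous_map circle (torus_bundle A) s \<and>
     (\<forall>z \<in> topspace circle. bundle_proj (s z) = z)"

text \<open>Both representatives of the base point of the circle give the same value.\<close>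

definition std_section :: "int ^ 2 ^ 2 \<Rightarrow> int ^ 2 \<Rightarrow> real set \<Rightarrow> bundle_point" where
  "std_section A v z = the_elem ((\<lambda>t. bundle_class A (torus_proj (t *\<^sub>R ivec v), t)) ` z)"

definition represents_section_class ::
    "int ^ 2 ^ 2 \<Rightarrow> (bundle_point \<Rightarrow> bundle_point) \<Rightarrow> int ^ 2 \<Rightarrow> bool" where
  "represents_section_class A f v \<longleftrightarrow>
     homotopic_with (is_section A) circle (torus_bundle A) (f \<circ> std_section A 0) (std_section A v)"

definition coset_rel :: "(int ^ 2) set \<Rightarrow> ((int ^ 2) \<times> (int ^ 2)) set" where
  "coset_rel H = {(u, w). u - w \<in> H}"

definition coker :: "int ^ 2 ^ 2 \<Rightarrow> (bundle_point \<Rightarrow> bundle_point) \<Rightarrow> (int ^ 2) set set" where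
  "coker A f = UNIV // coset_rel (L_lattice A f)"

definition beta ::
    "int ^ 2 ^ 2 \<Rightarrow> (bundle_point \<Rightarrow> bundle_point) \<Rightarrow> int ^ 2 \<Rightarrow> (int ^ 2) set \<Rightarrow> (int ^ 2) set" where
  "beta A f v C = the_elem ((\<lambda>u. coset_rel (L_lattice A f) `` {A *v (u - v)}) ` C)"

text \<open>As \<open>beta\<close> permutes \<open>coker\<close>, two elements lie in the same orbit of the group of all its
  (positive and negative) iterates iff one is a nonnegative iterate of the other.\<close>

definition beta_orbits ::
    "int ^ 2 ^ 2 \<Rightarrow> (bundle_point \<Rightarrow> bundle_point) \<Rightarrow> int ^ 2 \<Rightarrow> (int ^ 2) set set set" where
  "beta_orbits A f v = coker A f // {(C, D). C \<in> coker A f \<and> D \<in> coker A f \<and>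
     (\<exists>n. (beta A f v ^^ n) C = D \<or> (beta A f v ^^ n) D = C)}"

definition adapted_basis ::
    "int ^ 2 ^ 2 \<Rightarrow> (bundle_point \<Rightarrow> bundle_point) \<Rightarrow> int ^ 2 \<Rightarrow> int ^ 2 \<Rightarrow> bool" where
  "adapted_basis A f y1 y2 \<longleftrightarrow>
     bij (\<lambda>(a, b). a *s y1 + b *s y2) \<and>
     {m. ivec m \<in> L_plane A f} = range (\<lambda>a. a *s y1) \<and>
     infdist (ivec y2) (L_plane A f) > 0 \<and>
     (\<forall>m. infdist (ivec m) (L_plane A f) > 0 \<longrightarrow>
        infdist (ivec y2) (L_plane A f) \<le> infdist (ivec m) (L_plane A f))"

definition torsion_order :: "int ^ 2 ^ 2 \<Rightarrow> (bundle_point \<Rightarrow> bundle_point) \<Rightarrow> nat" where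
  "torsion_order A f = card ({m. ivec m \<in> L_plane A f} // coset_rel (L_lattice A f))"

end

(*
  A fiberwise map f lifts to F on R^2 x [0,1], and the difference D of the lifts of two fiberwise
  maps satisfies D (x + m, t) = D (x, t) + L m and D (A x, 0) = A (D (x, 1) - v) with
  L = f_* - id. These conditions cut out an affine space of maps, so the minimum numbers are
  minima over all such D for the image in the bundle of the set where D is integral. The value of D at an
  integral point is well defined up to u ~ u + L m ~ A (u - v), and each class is open and closed
  in the coincidence set. It remains to decide which classes are always attained, and to
  exhibit a D whose integral levels are convex and attain no other class.
  If L is invertible, each class is attained in every fibre by Brouwer's theorem. If L = 0, none is.
  If L has rank one, continue D over R^2 x [0,oo) and look at surfaces that project
  isomorphically to the plane of time and of the coordinate measured by L: when A preserves
  ker L pointwise, a class is attained by the Poincare-Miranda theorem; when A reverses ker L, a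
  class returning to itself after an odd number k of turns is attained, since otherwise the
  argument of D - u would be reversed after k turns, although it changes by an odd multiple of pi
  along the surface. Varying the surface gives uncountably many coincidences.
*)

theory Submission
  imports Defs
begin

section \<open>The torus\<close>

text \<open>In rank one, write D in a basis whose first vector spans the image of L. The first
  coordinate grows linearly in directions not killed by L, so it takes every value; the second is
  periodic, hence bounded over each fibre, and need not take a prescribed value. If A fixes ker L,
  the second coordinate drifts by v2 with each turn, and a long enough stretch of time forces it
  through every value. If A reverses ker L and v2 is normalised to 0, there is no drift; the only
  obstruction left is the reversal of sign after an odd number of turns, and this is where the
  parities in the formula come from. The matching maps take as second coordinate a small q-periodic
  function psi of the first that changes sign under the twist. Its zeros at integers must be exactly
  the classes of odd period: psi is zero, or a sine vanishing only at half-integers, or a sine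
  centred at v1/2. Since A commutes with L, its eigenvalue on ker L equals that on the quotient by
  the image of L; hence a single sign a governs both drift and reversal.\<close>

abbreviation rmat :: "int ^ 2 ^ 2 \<Rightarrow> real ^ 2 ^ 2" where
  "rmat A \<equiv> map_matrix of_int A"

lemma ivec_nth [simp]: "ivec m $ i = of_int (m $ i)"
  by (simp add: ivec_def)

lemma ivec_simps [simp]:
  "ivec 0 = 0" "ivec (m + n) = ivec m + ivec n" "ivec (m - n) = ivec m - ivec n"
  "ivec (- m) = - ivec m" "ivec (a *s m) = of_int a *\<^sub>R ivec m"
  by (simp_all add: vec_eq_iff)

lemma ivec_inject [simp]: "ivec m = ivec n \<longleftrightarrow> m = n"
  by (simp add: vec_eq_iff)

lemma ivec_eq_0 [simp]: "ivec m = 0 \<longleftrightarrow> m = 0"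
  using ivec_inject[of m 0] by (simp del: ivec_inject)

lemma rmat_ivec [simp]: "rmat A *v ivec m = ivec (A *v m)"
  by (simp add: vec_eq_iff matrix_vector_mult_def)

lemma rmat_mult: "rmat (A ** B) = rmat A ** rmat B"
  by (simp add: vec_eq_iff matrix_matrix_mult_def)

lemma rmat_1: "rmat (mat 1) = mat 1"
  by (simp add: vec_eq_iff mat_def)

lemma rmat_diff: "rmat (A - B) = rmat A - rmat B"
  by (simp add: vec_eq_iff)

lemma det_rmat: "det (rmat A) = of_int (det A)"
  by (simp add: det_2)

lemma continuous_on_rmat [continuous_intros]:
  "continuous_on S f \<Longrightarrow> continuous_on S (\<lambda>x. rmat A *v f x)"
  by (rule bounded_linear.continuous_on[OF matrix_vector_mul_bounded_linear])

lemma countable_range_ivec: "countable (range ivec)"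
  by simp

text \<open>Source of every integral constant below: two lifts of one map differ by a lattice-valued
  continuous function, and each coordinate of such a function jumps by at least 1 or not at
  all.\<close>

lemma constant_ivec:
  assumes "connected S" "continuous_on S f" "\<And>x. x \<in> S \<Longrightarrow> f x \<in> range ivec"
  obtains m where "\<And>x. x \<in> S \<Longrightarrow> f x = ivec m"
proof -
  have "(\<lambda>x. f x $ i) constant_on S" for i
  proof (rule continuous_discrete_range_constant[OF assms(1)])
    show "continuous_on S (\<lambda>x. f x $ i)" by (intro continuous_intros assms(2))
    fix x assume x: "x \<in> S"
    show "\<exists>e>0. \<forall>y. y \<in> S \<and> f y $ i \<noteq> f x $ i \<longrightarrow> e \<le> norm (f y $ i - f x $ i)"
    proof (intro exI[of _ 1] conjI allI impI)
      fix y assume y: "y \<in> S \<and> f y $ i \<noteq> f x $ i"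
      obtain a where "f x = ivec a" using assms(3) x by blast
      moreover obtain b where "f y = ivec b" using assms(3) y by blast
      ultimately show "1 \<le> norm (f y $ i - f x $ i)"
        using y by (auto simp flip: of_int_diff of_int_abs)
    qed simp
  qed
  then have "\<exists>c. \<forall>x\<in>S. f x $ i = c" for i unfolding constant_on_def by blast
  then obtain d where "\<And>x i. x \<in> S \<Longrightarrow> f x $ i = d i" by metis
  then have "\<exists>c. \<forall>x\<in>S. f x = c" by (intro exI[of _ "\<chi> i. d i"]) (simp add: vec_eq_iff)
  then obtain c where c: "\<And>x. x \<in> S \<Longrightarrow> f x = c"by blast
  show ?thesis
  proof (cases "S = {}")
    case False
    then obtain x m where "x \<in> S" "f x = ivec m" using assms(3) by blast
    then show ?thesis using c that[of m] by simp
  qed (use that in auto)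
qed

lemma torus_proj_eq_iff: "torus_proj x = torus_proj y \<longleftrightarrow> (\<exists>m. y = x + ivec m)"
proof
  assume "torus_proj x = torus_proj y"
  moreover have "y \<in> torus_proj y"
    unfolding torus_proj_def by (rule CollectI, rule exI[of _ 0]) simp
  ultimately show "\<exists>m. y = x + ivec m" unfolding torus_proj_def by blast
next
  assume "\<exists>m. y = x + ivec m"
  then obtain m where y: "y = x + ivec m" by blast
  have "\<exists>k. x + ivec n = x + ivec m + ivec k" for n
    by (intro exI[of _ "n - m"]) simp
  moreover have "\<exists>k. x + ivec m + ivec n = x + ivec k" for n
    by (intro exI[of _ "m + n"]) simp
  ultimately show "torus_proj x = torus_proj y"
    unfolding torus_proj_def y by blast
qed

lemma torus_proj_add_ivec [simp]: "torus_proj (x + ivec m) = torus_proj x"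
  using torus_proj_eq_iff by metis

lemma mem_torus_proj: "y \<in> torus_proj x \<longleftrightarrow> torus_proj y = torus_proj x"
proof -
  have "y \<in> torus_proj x \<longleftrightarrow> (\<exists>m. y = x + ivec m)" by (auto simp: torus_proj_def)
  then show ?thesis using torus_proj_eq_iff[of x y] by auto
qed

lemma quotient_map_torus_proj: "quotient_map euclidean torus torus_proj"
  unfolding torus_def by (rule quotient_map_quotient_topology)

lemma topspace_torus: "topspace torus = range torus_proj"
  using quotient_imp_surjective_map[OF quotient_map_torus_proj] by simp

lemma torus_proj_in_torus [simp]: "torus_proj x \<in> topspace torus"
  by (simp add: topspace_torus)

text \<open>\<open>torus_aut\<close> takes the image of a whole coset. This image is again a whole
  coset because the right inverse makes \<open>A\<close> surjective on the lattice.\<close>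

lemma torus_aut_proj:
  assumes "A ** B = mat 1"
  shows "torus_aut A (torus_proj x) = torus_proj (rmat A *v x)"
proof -
  have "A *v (B *v m) = m" for m
    using assms by (simp add: matrix_vector_mul_assoc)
  then have "\<exists>k. ivec m = rmat A *v ivec k" for m by (metis rmat_ivec)
  then have "\<exists>z. rmat A *v x + ivec m = rmat A *v z \<and> (\<exists>k. z = x + ivec k)" for m
    by (metis matrix_vector_right_distrib)
  moreover have "\<exists>k. rmat A *v (x + ivec m) = rmat A *v x + ivec k" for m
    by (auto simp: matrix_vector_right_distrib)
  ultimately show ?thesis
    unfolding torus_aut_def torus_proj_def by fast
qed

lemma continuous_map_torus_proj:
  "continuous_on S F \<Longrightarrow> continuous_map (top_of_set S) torus (torus_proj \<circ> F)"
  using quotient_imp_continuous_map[OF quotient_map_torus_proj]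
  by (metis continuous_map_compose continuous_map_iff_continuous)

text \<open>The two basic characters of the torus, which together identify it with a product of two
  unit circles. The choice of a representative is harmless, as an integral shift turns the angle by
  full circles.\<close>

definition torus_exp :: "2 \<Rightarrow> (real ^ 2) set \<Rightarrow> complex" where
  "torus_exp i u = cis (2 * pi * (SOME x. x \<in> u) $ i)"

lemma torus_exp_proj [simp]: "torus_exp i (torus_proj x) = cis (2 * pi * x $ i)"
proof -
  have "(SOME y. y \<in> torus_proj x) \<in> torus_proj x"
    by (rule someI[of _ x]) (simp add: mem_torus_proj)
  then obtain m where "(SOME y. y \<in> torus_proj x) = x + ivec m"
    by (auto simp: torus_proj_def)
  then show ?thesis
    using cis_multiple_2pi[of "of_int (m $ i)"] by (simp add: torus_exp_def distrib_left flip: cis_mult)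
qed

lemma continuous_map_torus_exp: "continuous_map torus euclidean (torus_exp i)"
proof -
  have "continuous_map euclidean euclidean (torus_exp i \<circ> torus_proj)"
    by (auto simp: o_def intro!: continuous_intros)
  then show ?thesis
    using continuous_compose_quotient_map_eq[OF quotient_map_torus_proj] by blast
qed

text \<open>In place of a covering argument: on a contractible domain both characters of
  \<open>g\<close> have continuous logarithms, and the imaginary parts divided by 2 pi are the
  coordinates of a lift.\<close>

lemma torus_lift:
  fixes S :: "'a::real_normed_vector set"
  assumes "contractible S" "continuous_map (top_of_set S) torus g"
  obtains F where "continuous_on S F" "\<And>x. x \<in> S \<Longrightarrow> g x = torus_proj (F x)"
proof -
  have "\<exists>h. continuous_on S h \<and> (\<forall>x\<in>S. torus_exp i (g x) = exp (h x))" for i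
  proof -
    have c: "continuous_on S (torus_exp i \<circ> g)"
      using continuous_map_compose[OF assms(2) continuous_map_torus_exp] by simp
    have "(torus_exp i \<circ> g) x \<noteq> 0" if "x \<in> S" for x
    proof -
      have "g x \<in> topspace torus" using continuous_map_image_subset_topspace[OF assms(2)] that by auto
      then show ?thesis by (auto simp: topspace_torus)
    qed
    from continuous_logarithm_on_contractible[OF c assms(1) this] show ?thesis by (metis comp_apply)
  qed
  then obtain h where h: "\<And>i. continuous_on S (h i)" "\<And>i x. x \<in> S \<Longrightarrow> torus_exp i (g x) = exp (h i x)"
    by metis
  define F where "F x = (\<chi> i. Im (h i x) / (2 * pi))" for x
  show thesis
  proof
    show "continuous_on S F" unfolding F_def by (intro continuous_intros h) simp
    fix x assume x: "x \<in> S"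
    have "g x \<in> topspace torus" using continuous_map_image_subset_topspace[OF assms(2)] x by auto
    then obtain y where y: "g x = torus_proj y" by (auto simp: topspace_torus)
    have "\<exists>n::int. y $ i = F x $ i + n" for i
    proof -
      have e: "cis (2 * pi * y $ i) = exp (h i x)" using h(2)[OF x, of i] y by simp
      then have "exp (Re (h i x)) = 1" by (metis norm_cis norm_exp_eq_Re)
      then have "exp (h i x) = cis (Im (h i x))" by (simp add: exp_eq_polar)
      then have "exp (\<i> * (2 * pi * y $ i)) = exp (\<i> * Im (h i x))" using e by (simp add: cis_conv_exp)
      then obtain n :: int where "\<i> * (2 * pi * y $ i) = \<i> * Im (h i x) + (of_int (2 * n) * pi) * \<i>"
        by (auto simp: exp_eq)
      then have "2 * pi * y $ i = Im (h i x) + of_int (2 * n) * pi"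
        by (simp add: complex_eq_iff)
      then have "y $ i = F x $ i + n" by (simp add: F_def field_simps)
      then show ?thesis ..
    qed
    then obtain n where n: "\<And>i. y $ i = F x $ i + of_int (n i)" by metis
    then have "y = F x + ivec (\<chi> i. n i)" by (simp add: vec_eq_iff)
    then show "g x = torus_proj (F x)" by (simp add: y)
  qed
qed

section \<open>The bundle and its fibrewise coordinate\<close>

lemma mem_glue_iff: "y \<in> glue R x \<longleftrightarrow> glue R x = glue R y"
proof -
  have "sym ((R \<union> R\<inverse>)\<^sup>*)" by (intro sym_rtrancl) (auto simp: sym_def)
  then show ?thesis
    unfolding glue_def set_eq_iff Image_singleton_iff
    by (meson rtrancl.rtrancl_refl rtrancl_trans symD)
qed

text \<open>No point is both a left and a right end of a pair, and each end has a single partner. So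
  two consecutive identifications undo each other, and chains of length at most one generate the
  whole relation.\<close>

lemma glue_iff:
  assumes "single_valued R" "single_valued (R\<inverse>)" "Domain R \<inter> Range R = {}"
  shows "glue R x = glue R y \<longleftrightarrow> x = y \<or> (x, y) \<in> R \<or> (y, x) \<in> R"
proof -
  have "(x, y) \<in> (R \<union> R\<inverse>)\<^sup>* \<longleftrightarrow> x = y \<or> (x, y) \<in> R \<union> R\<inverse>" for x y
  proof
    assume "(x, y) \<in> (R \<union> R\<inverse>)\<^sup>*"
    then show "x = y \<or> (x, y) \<in> R \<union> R\<inverse>"
    proof induction
      case (step y z)
      note sv = assms(1)[unfolded single_valued_def, rule_format] assms(2)[unfolded single_valued_def, rule_format]
      from step.IH step.hyps(2) consider "x = y" | "(x, y) \<in> R" "(z, y) \<in> R" | "(y, x) \<in> R" "(y, z) \<in> R"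
        using assms(3) by blast
      then show ?case
      proof cases
        case 1 then show ?thesis using step.hyps(2) by simp
      next
        case 2 then show ?thesis using sv(2)[of y x z] by simp
      next
        case 3 then show ?thesis using sv(1)[of y x z] by simp
      qed
    qed simp
  qed auto
  moreover have "glue R x = glue R y \<longleftrightarrow> (x, y) \<in> (R \<union> R\<inverse>)\<^sup>*"
    unfolding mem_glue_iff[symmetric] by (simp add: glue_def)
  ultimately show ?thesis by simp
qed

lemma circle_class_eq_iff:
  "circle_class s = circle_class t \<longleftrightarrow> s = t \<or> s = 0 \<and> t = 1 \<or> s = 1 \<and> t = 0"
  unfolding circle_class_def by (subst glue_iff) (auto simp: single_valued_def)

abbreviation strip :: "((real ^ 2) \<times> real) set" where
  "strip \<equiv> UNIV \<times> {0..1}"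

locale gluing =
  fixes A B :: "int ^ 2 ^ 2"
  assumes AB: "A ** B = mat 1" and BA: "B ** A = mat 1"
begin

abbreviation N where "N \<equiv> torus_bundle A"

text \<open>Composite of the two quotient maps. Its domain, the strip, is contractible, so fibrewise
  maps can be described there by vector-valued functions.\<close>

definition P :: "(real ^ 2) \<times> real \<Rightarrow> bundle_point" where
  "P p = bundle_class A (torus_proj (fst p), snd p)"

lemma A_B [simp]: "A *v (B *v m) = m" and B_A [simp]: "B *v (A *v m) = m"
  using AB BA by (simp_all add: matrix_vector_mul_assoc)

lemma rAB [simp]: "rmat A *v (rmat B *v x) = x" and rBA [simp]: "rmat B *v (rmat A *v x) = x"
  using AB BA by (simp_all add: matrix_vector_mul_assoc rmat_1 flip: rmat_mult)

lemma aut_A: "torus_aut A (torus_proj x) = torus_proj (rmat A *v x)"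
  and aut_B: "torus_aut B (torus_proj x) = torus_proj (rmat B *v x)"
  using torus_aut_proj[OF AB] torus_aut_proj[OF BA] by simp_all

lemma aut_AB [simp]: "u \<in> topspace torus \<Longrightarrow> torus_aut A (torus_aut B u) = u"
  and aut_BA [simp]: "u \<in> topspace torus \<Longrightarrow> torus_aut B (torus_aut A u) = u"
  and aut_A_in [simp]: "u \<in> topspace torus \<Longrightarrow> torus_aut A u \<in> topspace torus"
  and aut_B_in [simp]: "u \<in> topspace torus \<Longrightarrow> torus_aut B u \<in> topspace torus"
  by (auto simp: topspace_torus aut_A aut_B)

lemma continuous_map_aut_A: "continuous_map torus torus (torus_aut A)"
  and continuous_map_aut_B: "continuous_map torus torus (torus_aut B)"
proof -
  have "torus_aut A \<circ> torus_proj = torus_proj \<circ> (\<lambda>x. rmat A *v x)"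
    "torus_aut B \<circ> torus_proj = torus_proj \<circ> (\<lambda>x. rmat B *v x)"
    by (auto simp: aut_A aut_B)
  moreover have "continuous_map euclidean torus (torus_proj \<circ> (\<lambda>x. rmat C *v x))" for C
    using continuous_map_torus_proj[of UNIV "\<lambda>x. rmat C *v x"]
    by (simp add: continuous_intros)
  ultimately show "continuous_map torus torus (torus_aut A)" "continuous_map torus torus (torus_aut B)"
    using continuous_compose_quotient_map_eq[OF quotient_map_torus_proj] by metis+
qed

lemma bundle_class_eq_iff:
  "bundle_class A p = bundle_class A q \<longleftrightarrow>
     p = q \<or> (\<exists>u \<in> topspace torus. p = (u, 1) \<and> q = (torus_aut A u, 0)) \<or>
     (\<exists>u \<in> topspace torus. q = (u, 1) \<and> p = (torus_aut A u, 0))"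
proof -
  have inj: "u = w" if "torus_aut A u = torus_aut A w" "u \<in> topspace torus" "w \<in> topspace torus" for u w
    using that by (metis aut_BA)
  show ?thesis
    unfolding bundle_class_def
    by (subst glue_iff) (auto simp: single_valued_def dest: inj)
qed

lemma P_eq_iff:
  "P (x, s) = P (y, t) \<longleftrightarrow>
     s = t \<and> (\<exists>m. y = x + ivec m) \<or>
     s = 1 \<and> t = 0 \<and> (\<exists>m. y = rmat A *v x + ivec m) \<or>
     s = 0 \<and> t = 1 \<and> (\<exists>m. y = rmat B *v x + ivec m)"
proof -
  have "(\<exists>u\<in>topspace torus. (torus_proj y, t) = (u, 1) \<and> (torus_proj x, s) = (torus_aut A u, 0))
    \<longleftrightarrow> s = 0 \<and> t = 1 \<and> torus_proj x = torus_proj (rmat A *v y)"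
    by (auto simp: aut_A)
  moreover have "torus_proj x = torus_proj (rmat A *v y) \<longleftrightarrow> torus_proj (rmat B *v x) = torus_proj y"
    by (metis aut_A aut_B rAB rBA)
  moreover have "(\<exists>u\<in>topspace torus. (torus_proj x, s) = (u, 1) \<and> (torus_proj y, t) = (torus_aut A u, 0))
    \<longleftrightarrow> s = 1 \<and> t = 0 \<and> torus_proj (rmat A *v x) = torus_proj y"
    by (auto simp: aut_A)
  ultimately show ?thesis
    unfolding P_def bundle_class_eq_iff torus_proj_eq_iff[symmetric] by auto
qed

lemma P_add_ivec [simp]: "P (x + ivec m, t) = P (x, t)"
  by (simp add: P_def)

lemma P_glue: "P (rmat A *v x, 0) = P (x, 1)"
  by (simp add: P_eq_iff)

lemma quotient_map_bundle_class:
  "quotient_map (prod_topology torus (top_of_set {0..1})) N (bundle_class A)"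
  unfolding torus_bundle_def by (rule quotient_map_quotient_topology)

text \<open>The product of a quotient map with the identity of the interval is a quotient map
  because the interval is locally compact and Hausdorff.\<close>

lemma quotient_map_P: "quotient_map (top_of_set strip) N P"
proof -
  have "quotient_map (prod_topology euclidean (top_of_set {0..1::real}))
    (prod_topology torus (top_of_set {0..1})) (\<lambda>(x, t). (torus_proj x, t))"
    by (intro quotient_map_prod_left quotient_map_torus_proj disjI1 Hausdorff_space_subtopology Hausdorff_space_euclidean)
      (auto simp: compact_imp_locally_compact_space compact_space_subtopology)
  from quotient_map_compose[OF this quotient_map_bundle_class]
  have "quotient_map (prod_topology euclidean (top_of_set {0..1::real})) N
    (bundle_class A \<circ> (\<lambda>(x, t). (torus_proj x, t)))" .
  moreover have "bundle_class A \<circ> (\<lambda>(x, t). (torus_proj x, t)) = P"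
    by (auto simp: P_def)
  moreover have "prod_topology euclidean (top_of_set {0..1::real}) = top_of_set ((UNIV :: (real^2) set) \<times> {0..1})"
    using prod_topology_subtopology_eu[of UNIV "{0..1}"] by simp
  ultimately show ?thesis by simp
qed

lemma topspace_N: "topspace N = P ` strip"
  using quotient_imp_surjective_map[OF quotient_map_P] by simp

lemma P_in_N [simp]: "0 \<le> t \<Longrightarrow> t \<le> 1 \<Longrightarrow> P (x, t) \<in> topspace N"
  by (auto simp: topspace_N)

lemma quotient_map_I_P:
  "quotient_map (top_of_set ({0..1::real} \<times> strip)) (prod_topology (top_of_set {0..1}) N)
     (\<lambda>(s, p). (s, P p))"
proof -
  have "quotient_map (prod_topology (top_of_set {0..1::real}) (top_of_set strip))
     (prod_topology (top_of_set {0..1}) N) (\<lambda>(s, p). (s, P p))"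
    by (intro quotient_map_prod_right quotient_map_P disjI1 Hausdorff_space_subtopology Hausdorff_space_euclidean)
      (auto simp: compact_imp_locally_compact_space compact_space_subtopology)
  then show ?thesis by simp
qed

lemma bundle_proj_class:
  assumes "u \<in> topspace torus" shows "bundle_proj (bundle_class A (u, t)) = circle_class t"
proof -
  have "circle_class s = circle_class t" if "(w, s) \<in> bundle_class A (u, t)" for w s
    using that unfolding bundle_class_def mem_glue_iff
    unfolding bundle_class_def[symmetric] bundle_class_eq_iff circle_class_eq_iff by auto
  then have "(\<lambda>(u, t). circle_class t) ` bundle_class A (u, t) = (\<lambda>_. circle_class t) ` bundle_class A (u, t)"
    by (intro image_cong) auto
  moreover have "(u, t) \<in> bundle_class A (u, t)" by (simp add: bundle_class_def mem_glue_iff)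
  ultimately have "(\<lambda>(u, t). circle_class t) ` bundle_class A (u, t) = {circle_class t}"
    by auto
  then show ?thesis by (simp add: bundle_proj_def)
qed

lemma bundle_proj_P [simp]: "bundle_proj (P (x, t)) = circle_class t"
  by (simp add: P_def bundle_proj_class)

lemma fibre_point:
  assumes "z \<in> topspace N" "bundle_proj z = circle_class t"
  obtains x where "z = P (x, t)"
proof -
  obtain y s where z: "z = P (y, s)" using assms(1) by (auto simp: topspace_N)
  then have "s = t \<or> s = 0 \<and> t = 1 \<or> s = 1 \<and> t = 0"
    using assms(2) by (simp add: circle_class_eq_iff)
  then show ?thesis
    using that z P_glue[of y] P_glue[of "rmat B *v y"] by auto
qed

lemma openin_saturated:
  assumes "openin (prod_topology torus (top_of_set {0..1})) Q"
    and "\<And>u. u \<in> topspace torus \<Longrightarrow> (u, 1) \<in> Q \<longleftrightarrow> (torus_aut A u, 0) \<in> Q"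
  shows "openin N (bundle_class A ` Q)" "bundle_class A p \<in> bundle_class A ` Q \<longleftrightarrow> p \<in> Q"
proof -
  have mem: "bundle_class A p \<in> bundle_class A ` Q \<longleftrightarrow> p \<in> Q" for p
    using assms(2) by (auto simp: bundle_class_eq_iff image_iff)
  then show "bundle_class A p \<in> bundle_class A ` Q \<longleftrightarrow> p \<in> Q" .
  have Qs: "Q \<subseteq> topspace (prod_topology torus (top_of_set {0..1}))" using assms(1) by (rule openin_subset)
  then have eq: "{p \<in> topspace (prod_topology torus (top_of_set {0..1})). bundle_class A p \<in> bundle_class A ` Q} = Q"
    unfolding mem by blast
  then show "openin N (bundle_class A ` Q)"
    unfolding torus_bundle_def openin_quotient_topology eq
    using assms(1) Qs by (intro conjI image_mono)
qed

text \<open>At the seam a point of the bundle has two torus coordinates, but the prescribed time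
  \<open>tau\<close> selects one of them, and \<open>tau\<close> is continuous. What has to be shown
  is that neighbourhoods in the bundle, which see both sides of the seam, still control the selected
  coordinate.\<close>

lemma continuous_map_fibre_coordinate:
  assumes phi: "continuous_map X N phi" and tau: "continuous_map X (top_of_set {0..1}) tau"
    and G: "\<And>x. x \<in> topspace X \<Longrightarrow> G x \<in> topspace torus \<and> phi x = bundle_class A (G x, tau x)"
  shows "continuous_map X torus G"
  unfolding continuous_map_def
proof (intro conjI allI impI)
  show "G \<in> topspace X \<rightarrow> topspace torus" using G by blast
next
  fix V assume V: "openin torus V"
  then have Vs: "V \<subseteq> topspace torus" by (rule openin_subset)
  \<comment> \<open>\<open>W U\<close> is the preimage of \<open>U\<close> under the gluing, so
    \<open>Q U\<close> is a saturated neighbourhood of the seam that shows \<open>U\<close> just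
    after time 0. To see \<open>V\<close> just before time 1 one takes \<open>Q V'\<close>, where
    \<open>V'\<close> is the image of \<open>V\<close> under the gluing; \<open>Q1\<close> handles
    interior times.\<close>
  define W where "W U = {u \<in> topspace torus. torus_aut A u \<in> U}" for U
  define V' where "V' = {u \<in> topspace torus. torus_aut B u \<in> V}"
  define Q where "Q U = U \<times> {0..<1/2} \<union> W U \<times> {1/2<..1::real}" for U
  define Q1 where "Q1 = V \<times> {0<..<1::real}"
  have V': "openin torus V'" unfolding V'_def
    using openin_continuous_map_preimage[OF continuous_map_aut_B V] .
  have WV': "W V' = V" using Vs by (auto simp: W_def V'_def)
  have I: "openin (top_of_set {0..1}) {0..<1/2::real}" "openin (top_of_set {0..1}) {1/2<..1::real}"
    "openin (top_of_set {0..1}) {0<..<1::real}"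
  proof -
    have "{0..<1/2::real} = {0..1} \<inter> {..<1/2}" "{1/2<..1::real} = {0..1} \<inter> {1/2<..}"
       "{0<..<1::real} = {0..1} \<inter> {0<..<1}" by auto
    then show "openin (top_of_set {0..1}) {0..<1/2::real}" "openin (top_of_set {0..1}) {1/2<..1::real}"
    "openin (top_of_set {0..1}) {0<..<1::real}" by (metis openin_open_Int open_lessThan open_greaterThan open_greaterThanLessThan)+
  qed
  have Q: "openin (prod_topology torus (top_of_set {0..1})) (Q U)" if "openin torus U" for U
    unfolding Q_def W_def using openin_continuous_map_preimage[OF continuous_map_aut_A that] that I
    by (intro openin_Un) (auto simp: openin_prod_Times_iff)
  have Q1: "openin (prod_topology torus (top_of_set {0..1})) Q1"
    unfolding Q1_def using V I by (auto simp: openin_prod_Times_iff)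
  have satQ: "(u, 1) \<in> Q U \<longleftrightarrow> (torus_aut A u, 0) \<in> Q U" if "u \<in> topspace torus" for u U
    using that by (auto simp: Q_def W_def)
  have satQ1: "(u, 1) \<in> Q1 \<longleftrightarrow> (torus_aut A u, 0) \<in> Q1" for u
    by (auto simp: Q1_def)
  define pre where "pre J Q = {x \<in> topspace X. tau x \<in> J} \<inter> {x \<in> topspace X. phi x \<in> bundle_class A ` Q}" for J Q
  have tau01: "0 \<le> tau x \<and> tau x \<le> 1" if "x \<in> topspace X" for x
    using continuous_map_image_subset_topspace[OF tau] that by auto
  have "{x \<in> topspace X. G x \<in> V} = pre {0..<1/2} (Q V) \<union> pre {1/2<..1} (Q V') \<union> pre {0<..<1} Q1"
  proof -
    have mQ: "phi x \<in> bundle_class A ` Q U \<longleftrightarrow>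
        G x \<in> U \<and> tau x < 1/2 \<or> G x \<in> W U \<and> 1/2 < tau x" if "x \<in> topspace X" "openin torus U" for x U
    proof -
      have "phi x \<in> bundle_class A ` Q U \<longleftrightarrow> (G x, tau x) \<in> Q U"
        using G[OF that(1)] openin_saturated(2)[OF Q[OF that(2)] satQ] by simp
      then show ?thesis using tau01[OF that(1)] by (simp add: Q_def)
    qed
    have mQ1: "phi x \<in> bundle_class A ` Q1 \<longleftrightarrow> G x \<in> V \<and> 0 < tau x \<and> tau x < 1" if "x \<in> topspace X" for x
    proof -
      have "phi x \<in> bundle_class A ` Q1 \<longleftrightarrow> (G x, tau x) \<in> Q1"
        using G[OF that] openin_saturated(2)[OF Q1 satQ1] by simp
      then show ?thesis by (simp add: Q1_def)
    qed
    have "x \<in> pre {0..<1/2} (Q V) \<union> pre {1/2<..1} (Q V') \<union> pre {0<..<1} Q1 \<longleftrightarrow> G x \<in> V"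
      if x: "x \<in> topspace X" for x
    proof -
      have "x \<in> pre {0..<1/2} (Q V) \<longleftrightarrow> G x \<in> V \<and> tau x < 1/2"
        using x tau01[OF x] unfolding pre_def Int_iff mem_Collect_eq mQ[OF x V] by auto
      moreover have "x \<in> pre {1/2<..1} (Q V') \<longleftrightarrow> G x \<in> V \<and> 1/2 < tau x"
        using x tau01[OF x] unfolding pre_def Int_iff mem_Collect_eq mQ[OF x V'] WV' by auto
      moreover have "x \<in> pre {0<..<1} Q1 \<longleftrightarrow> G x \<in> V \<and> 0 < tau x \<and> tau x < 1"
        using x tau01[OF x] unfolding pre_def Int_iff mem_Collect_eq mQ1[OF x] by auto
      ultimately show ?thesis using tau01[OF x] unfolding Un_iff by argo
    qed
    then show ?thesis by (auto simp: pre_def)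
  qed
  moreover have "openin X (pre J Q)" if "openin (top_of_set {0..1}) J" "openin N (bundle_class A ` Q)" for J Q
    unfolding pre_def using that phi tau by (intro openin_Int openin_continuous_map_preimage)
  ultimately show "openin X {x \<in> topspace X. G x \<in> V}"
    by (simp add: openin_Un I openin_saturated(1)[OF Q[OF V] satQ] openin_saturated(1)[OF Q[OF V'] satQ]
        openin_saturated(1)[OF Q1 satQ1])
qed

lemma lift_over_base:
  fixes S :: "'a::real_normed_vector set"
  assumes S: "convex S" and phi: "continuous_map (top_of_set S) N phi"
    and tau: "continuous_on S tau" "\<And>x. x \<in> S \<Longrightarrow> 0 \<le> tau x \<and> tau x \<le> 1"
    and proj: "\<And>x. x \<in> S \<Longrightarrow> bundle_proj (phi x) = circle_class (tau x)"
  obtains F where "continuous_on S F" "\<And>x. x \<in> S \<Longrightarrow> phi x = P (F x, tau x)"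
proof -
  have "\<exists>y. phi x = P (y, tau x)" if "x \<in> S" for x
  proof -
    have "phi x \<in> topspace N" using continuous_map_image_subset_topspace[OF phi] that by auto
    from fibre_point[OF this proj[OF that]] show ?thesis by blast
  qed
  then obtain g where g: "\<And>x. x \<in> S \<Longrightarrow> phi x = P (g x, tau x)" by metis
  \<comment> \<open>The points \<open>g x\<close> are chosen arbitrarily and need not depend
    continuously on \<open>x\<close>; only their classes in the torus do.\<close>
  have "continuous_map (top_of_set S) torus (torus_proj \<circ> g)"
    by (rule continuous_map_fibre_coordinate[OF phi, of tau]) (use tau g in \<open>auto simp: P_def\<close>)
  from torus_lift[OF convex_imp_contractible[OF S] this]
  obtain F where F: "continuous_on S F" "\<And>x. x \<in> S \<Longrightarrow> torus_proj (g x) = torus_proj (F x)" by auto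
  show thesis
    by (rule that[OF F(1)]) (use F(2) g in \<open>simp add: P_def\<close>)
qed

end

section \<open>Lifts of fiberwise maps\<close>

lemma additive_int_vec_eq_matrix:
  fixes h :: "int ^ 2 \<Rightarrow> int ^ 2"
  assumes add: "\<And>m n. h (m + n) = h m + h n"
  obtains M where "\<And>m. h m = M *v m"
proof
  have h0: "h 0 = 0" using add[of 0 0] by simp
  have hm: "h (- m) = - h m" for m using add[of m "- m"] h0 by (simp add: eq_neg_iff_add_eq_0 add.commute)
  have nat: "h (int k *s m) = int k *s h m" for k m
    by (induction k) (simp_all add: h0 add vector_sadd_rdistrib)
  have scale: "h (a *s m) = a *s h m" for a m
  proof (cases "a \<ge> 0")
    case True
    then show ?thesis using nat[of "nat a" m] by simp
  next
    case False
    have "a *s m = - ((- a) *s m)" by (simp add: vec_eq_iff)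
    then have "h (a *s m) = - h ((- a) *s m)" by (metis hm)
    also have "\<dots> = a *s h m" using nat[of "nat (- a)" m] False by (simp add: vec_eq_iff)
    finally show ?thesis .
  qed
  fix m :: "int ^ 2"
  have "m = m $ 1 *s axis 1 1 + m $ 2 *s axis 2 1"
    by (simp add: vec_eq_iff forall_2 axis_def)
  then have "h m = m $ 1 *s h (axis 1 1) + m $ 2 *s h (axis 2 1)" by (metis add scale)
  then show "h m = (\<chi> i j. h (axis j 1) $ i) *v m"
    by (simp add: vec_eq_iff matrix_vector_mult_def sum_2 mult.commute)
qed

context gluing
begin

text \<open>\<open>L\<close> records the effect on the fundamental group of the fibre and
  \<open>v\<close> the homotopy class of the induced section. The vector \<open>v\<close> is
  subtracted before \<open>A\<close> acts, so that the lift t -> t v of the standard section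
  satisfies the equation with this very \<open>v\<close>, and so that values cross the seam by the
  formula of \<open>beta\<close>.\<close>

definition equivariant :: "int ^ 2 ^ 2 \<Rightarrow> int ^ 2 \<Rightarrow> ((real ^ 2) \<times> real \<Rightarrow> real ^ 2) \<Rightarrow> bool" where
  "equivariant L v F \<longleftrightarrow> continuous_on strip F \<and>
     (\<forall>x m. \<forall>t\<in>{0..1}. F (x + ivec m, t) = F (x, t) + ivec (L *v m)) \<and>
     (\<forall>x. F (rmat A *v x, 0) = rmat A *v (F (x, 1) - ivec v))"

definition is_lift :: "(bundle_point \<Rightarrow> bundle_point) \<Rightarrow> ((real ^ 2) \<times> real \<Rightarrow> real ^ 2) \<Rightarrow> bool" where
  "is_lift f F \<longleftrightarrow> (\<forall>x. \<forall>t\<in>{0..1}. f (P (x, t)) = P (F (x, t), t))"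

definition descend :: "((real ^ 2) \<times> real \<Rightarrow> real ^ 2) \<Rightarrow> bundle_point \<Rightarrow> bundle_point" where
  "descend F z = (let p = SOME p. p \<in> strip \<and> P p = z in P (F p, snd p))"

lemma equivariant_respects:
  assumes F: "equivariant L v F" and "P (x, s) = P (y, t)" "s \<in> {0..1}" "t \<in> {0..1}"
  shows "P (F (x, s), s) = P (F (y, t), t)"
proof -
  have tr: "P (F (x + ivec m, t), t) = P (F (x, t), t)" if "t \<in> {0..1}" for x m t
    using F that by (simp add: equivariant_def)
  have gl: "P (F (rmat A *v x, 0), 0) = P (F (x, 1), 1)" for x
    using F P_glue[of "F (x, 1) - ivec v"] P_add_ivec[of "F (x, 1)" "- v" 1]
    by (simp add: equivariant_def)
  from assms(2) consider m where "s = t" "y = x + ivec m" | m where "s = 1" "t = 0" "y = rmat A *v x + ivec m"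
    | m where "s = 0" "t = 1" "y = rmat B *v x + ivec m"
    unfolding P_eq_iff by blast
  then show ?thesis
  proof cases
    case 1 then show ?thesis using tr assms(4) by simp
  next
    case 2 then show ?thesis using tr[of 0] gl by simp
  next
    case 3 then show ?thesis using tr[of 1] gl[of "rmat B *v x"] by simp
  qed
qed

lemma is_lift_descend:
  assumes "equivariant L v F" shows "is_lift (descend F) F"
  unfolding is_lift_def
proof (intro allI ballI)
  fix x and t :: real assume t: "t \<in> {0..1}"
  define p where "p = (SOME p. p \<in> strip \<and> P p = P (x, t))"
  have "p \<in> strip \<and> P p = P (x, t)"
    unfolding p_def by (rule someI[of _ "(x, t)"]) (use t in auto)
  then have "P (F p, snd p) = P (F (x, t), t)"
    using equivariant_respects[OF assms, of "fst p" "snd p" x t] t by auto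
  then show "descend F (P (x, t)) = P (F (x, t), t)"
    by (simp add: descend_def p_def[symmetric])
qed

lemma continuous_map_P:
  assumes "continuous_on S F" "continuous_on S tau" "\<And>x. x \<in> S \<Longrightarrow> tau x \<in> {0..1}"
  shows "continuous_map (top_of_set S) N (\<lambda>x. P (F x, tau x))"
proof -
  have "continuous_map (top_of_set S) (top_of_set strip) (\<lambda>x. (F x, tau x))"
    using assms by (auto intro!: continuous_intros)
  from continuous_map_compose[OF this quotient_imp_continuous_map[OF quotient_map_P]]
  show ?thesis by (simp add: o_def)
qed

lemma fiberwise_if_lift:
  assumes "is_lift f F" "continuous_on strip F"
  shows "fiberwise A f"
proof -
  have "continuous_map (top_of_set strip) N (\<lambda>p. P (F p, snd p))"
    using assms(2) by (intro continuous_map_P continuous_intros) auto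
  then have "continuous_map (top_of_set strip) N (f \<circ> P)"
    by (rule continuous_map_eq) (use assms(1) in \<open>auto simp: is_lift_def\<close>)
  then have "continuous_map N N f"
    using continuous_compose_quotient_map_eq[OF quotient_map_P] by blast
  then show ?thesis
    using assms(1) by (auto simp: fiberwise_def topspace_N is_lift_def)
qed

lemma fiberwise_cong:
  assumes "\<And>z. z \<in> topspace N \<Longrightarrow> h z = k z"
  shows "fiberwise A h \<longleftrightarrow> fiberwise A k"
  unfolding fiberwise_def using assms continuous_map_eq by (metis (no_types, lifting))

lemma equivariant_convex:
  assumes "equivariant L v F" "equivariant L v G"
  shows "equivariant L v (\<lambda>p. (1 - s) *\<^sub>R F p + s *\<^sub>R G p)"
proof -
  have "(1 - s) *\<^sub>R F (rmat A *v x, 0) + s *\<^sub>R G (rmat A *v x, 0)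
     = rmat A *v ((1 - s) *\<^sub>R F (x, 1) + s *\<^sub>R G (x, 1) - ivec v)" for x
  proof -
    have "(1 - s) *\<^sub>R F (x, 1) + s *\<^sub>R G (x, 1) - ivec v = (1 - s) *\<^sub>R (F (x, 1) - ivec v) + s *\<^sub>R (G (x, 1) - ivec v)"
      by (simp add: algebra_simps)
    then show ?thesis
      using assms by (simp add: equivariant_def matrix_vector_right_distrib matrix_vector_mult_scaleR)
  qed
  moreover have "continuous_on strip (\<lambda>p. (1 - s) *\<^sub>R F p + s *\<^sub>R G p)"
    using assms by (intro continuous_intros) (simp_all add: equivariant_def)
  ultimately show ?thesis
    using assms by (auto simp: equivariant_def algebra_simps)
qed

text \<open>The straight-line homotopy between the lifts keeps \<open>L\<close> and \<open>v\<close>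
  at each stage, hence descends.\<close>

lemma fiberwise_homotopic_lifts:
  assumes "is_lift f F" "equivariant L v F" "is_lift g G" "equivariant L v G"
  shows "fiberwise_homotopic A f g"
proof -
  define H where "H s p = (1 - s) *\<^sub>R F p + s *\<^sub>R G p" for s :: real and p
  have lift: "is_lift (descend (H s)) (H s)" for s
    unfolding H_def by (rule is_lift_descend[OF equivariant_convex[OF assms(2,4)]])
  define h where "h = (\<lambda>(s, z). descend (H s) z)"
  have "continuous_map (top_of_set ({0..1} \<times> strip)) N (\<lambda>q. P (H (fst q) (snd q), snd (snd q)))"
  proof (rule continuous_map_P)
    have "continuous_on ({0..1::real} \<times> strip) (\<lambda>q. F (snd q))"
      "continuous_on ({0..1::real} \<times> strip) (\<lambda>q. G (snd q))"
      using assms(2,4) by (auto simp: equivariant_def intro!: continuous_on_compose2[where f = snd] continuous_intros)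
    then show "continuous_on ({0..1} \<times> strip) (\<lambda>q. H (fst q) (snd q))"
      unfolding H_def by (intro continuous_intros)
  qed (auto intro!: continuous_intros)
  then have "continuous_map (top_of_set ({0..1} \<times> strip)) N (h \<circ> (\<lambda>(s, p). (s, P p)))"
    by (rule continuous_map_eq) (use lift in \<open>auto simp: h_def is_lift_def\<close>)
  then have "continuous_map (prod_topology (top_of_set {0..1}) N) N h"
    using continuous_compose_quotient_map_eq[OF quotient_map_I_P] by blast
  moreover have "fiberwise A (descend (H s))" for s
    using fiberwise_if_lift[OF lift] equivariant_convex[OF assms(2,4)] by (simp add: equivariant_def H_def)
  moreover have "descend (H 0) z = f z" "descend (H 1) z = g z" if "z \<in> topspace N" for z
    using that lift assms(1,3) by (auto simp: topspace_N is_lift_def H_def)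
  ultimately show ?thesis
    unfolding fiberwise_homotopic_def
    by (subst homotopic_with[OF fiberwise_cong]) (auto simp: h_def)
qed

lemma P_same_level: "P (x, t) = P (y, t) \<Longrightarrow> y - x \<in> range ivec"
  unfolding P_eq_iff by auto

text \<open>Any continuous lift over the strip has lattice-valued defects with respect to
  translation and gluing. Being constant, the first is an additive function of the translation
  vector, which gives \<open>L\<close>; the second gives the gluing vector.\<close>

lemma fiberwise_lift_exists:
  assumes "fiberwise A f"
  obtains F L v where "is_lift f F" "equivariant L v F"
proof -
  let ?S = strip
  have cS: "convex ?S" by (intro convex_Times) auto
  have cm: "continuous_map (top_of_set ?S) N (f \<circ> P)"
    using assms quotient_imp_continuous_map[OF quotient_map_P]
    by (auto simp: fiberwise_def intro: continuous_map_compose)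
  have pr: "bundle_proj ((f \<circ> P) p) = circle_class (snd p)" if "p \<in> ?S" for p
    using assms that by (auto simp: fiberwise_def)
  have "continuous_on ?S snd" and "0 \<le> snd p \<and> snd p \<le> 1" if "p \<in> ?S" for p
    using that by (auto intro: continuous_intros)
  from lift_over_base[OF cS cm this pr]
  obtain F where F: "continuous_on ?S F" "\<And>p. p \<in> ?S \<Longrightarrow> (f \<circ> P) p = P (F p, snd p)"
    by blast
  have FP: "f (P (x, t)) = P (F (x, t), t)" if "t \<in> {0..1}" for x t
    using F(2)[of "(x, t)"] that by simp
  have "\<exists>n. \<forall>x. \<forall>t\<in>{0..1}. F (x + ivec m, t) = F (x, t) + ivec n" for m
  proof -
    have c: "continuous_on ?S (\<lambda>p. F (fst p + ivec m, snd p) - F p)"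
      by (intro continuous_intros F(1) continuous_on_compose2[OF F(1)]) auto
    have "F (fst p + ivec m, snd p) - F p \<in> range ivec" if "p \<in> ?S" for p
      using FP[of "snd p" "fst p + ivec m"] FP[of "snd p" "fst p"] that
      by (intro P_same_level[of _ "snd p"]) auto
    from constant_ivec[OF convex_connected[OF cS] c this] obtain n where
      "\<And>p. p \<in> ?S \<Longrightarrow> F (fst p + ivec m, snd p) - F p = ivec n" by blast
    then show ?thesis
      by (intro exI[of _ n] allI ballI) (metis SigmaI UNIV_I add.commute diff_add_cancel fst_conv snd_conv)
  qed
  then obtain h where h: "\<And>m x t. t \<in> {0..1} \<Longrightarrow> F (x + ivec m, t) = F (x, t) + ivec (h m)" by metis
  have "h (m + n) = h m + h n" for m n
  proof -
    have "F (0 + ivec (m + n), 0) = F (0 + ivec m + ivec n, 0)" by simp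
    then have "ivec (h (m + n)) = ivec (h m + h n)"
      unfolding h[of 0, simplified] by (simp add: add.assoc)
    then show ?thesis by (simp only: ivec_inject)
  qed
  then obtain L where L: "\<And>m. h m = L *v m" using additive_int_vec_eq_matrix by blast
  have c: "continuous_on UNIV (\<lambda>x. rmat A *v F (x, 1) - F (rmat A *v x, 0))"
    by (intro continuous_intros continuous_on_compose2[OF F(1)]) auto
  have "rmat A *v F (x, 1) - F (rmat A *v x, 0) \<in> range ivec" for x
    using FP[of 1 x] FP[of 0 "rmat A *v x"] P_glue[of x] P_glue[of "F (x, 1)"]
    by (intro P_same_level[of _ 0]) auto
  from constant_ivec[OF connected_UNIV c this] obtain w
    where w: "\<And>x. rmat A *v F (x, 1) - F (rmat A *v x, 0) = ivec w" by (auto intro: UNIV_I)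
  \<comment> \<open>The constant \<open>w\<close> stands outside \<open>A\<close>, while
    \<open>v\<close> is subtracted inside; hence \<open>v\<close> is \<open>B *v w\<close>.\<close>
  have "F (rmat A *v x, 0) = rmat A *v (F (x, 1) - ivec (B *v w))" for x
  proof -
    have "F (rmat A *v x, 0) = rmat A *v F (x, 1) - ivec w" using w[of x] by (simp add: algebra_simps)
    then show ?thesis by (simp add: matrix_vector_mult_diff_distrib)
  qed
  then have "equivariant L (B *v w) F" using F(1) h L by (simp add: equivariant_def)
  moreover have "is_lift f F" using FP by (simp add: is_lift_def)
  ultimately show ?thesis using that by blast
qed

text \<open>The whole homotopy is lifted. Its translation and gluing defects are lattice-valued, so
  they keep throughout the values that they have at the start, where the lift differs from
  \<open>F\<close> by a constant \<open>n\<close>.\<close>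

lemma fiberwise_homotopic_lift:
  assumes "fiberwise_homotopic A f g" "is_lift f F" "equivariant L v F"
  obtains G where "is_lift g G" "equivariant L v G"
proof -
  let ?S = strip
  let ?T = "{0..1::real} \<times> ?S"
  have cS: "convex ?S" and cT: "convex ?T" by (intro convex_Times; simp)+
  obtain h where h: "continuous_map (prod_topology (top_of_set {0..1::real}) N) N h"
    "\<And>z. h (0, z) = f z" "\<And>z. h (1, z) = g z" "\<And>s. s \<in> {0..1} \<Longrightarrow> fiberwise A (\<lambda>z. h (s, z))"
    using assms(1) unfolding fiberwise_homotopic_def homotopic_with_def by auto
  have cm: "continuous_map (top_of_set ?T) N (h \<circ> (\<lambda>(s, p). (s, P p)))"
    using continuous_map_compose[OF quotient_imp_continuous_map[OF quotient_map_I_P] h(1)] .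
  have pr: "bundle_proj ((h \<circ> (\<lambda>(s, p). (s, P p))) q) = circle_class (snd (snd q))" if "q \<in> ?T" for q
    using h(4)[of "fst q"] that by (auto simp: fiberwise_def)
  have "continuous_on ?T (\<lambda>q. snd (snd q))" and "0 \<le> snd (snd q) \<and> snd (snd q) \<le> 1" if "q \<in> ?T" for q
    using that by (auto intro!: continuous_intros)
  from lift_over_base[OF cT cm this pr] obtain K where K: "continuous_on ?T K"
    "\<And>q. q \<in> ?T \<Longrightarrow> (h \<circ> (\<lambda>(s, p). (s, P p))) q = P (K q, snd (snd q))"
    by blast
  have KP: "h (s, P (x, t)) = P (K (s, x, t), t)" if "s \<in> {0..1}" "t \<in> {0..1}" for s x t
    using K(2)[of "(s, x, t)"] that by simp
  have Fc: "continuous_on ?S F" and Ft: "\<And>x m t. t \<in> {0..1} \<Longrightarrow> F (x + ivec m, t) = F (x, t) + ivec (L *v m)"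
    and Fg: "\<And>x. F (rmat A *v x, 0) = rmat A *v (F (x, 1) - ivec v)"
    using assms(3) by (auto simp: equivariant_def)
  have c0: "continuous_on ?S (\<lambda>p. K (0, p) - F p)"
    by (intro continuous_intros Fc continuous_on_compose2[OF K(1)]) auto
  have "K (0, p) - F p \<in> range ivec" if "p \<in> ?S" for p
    using KP[of 0 "snd p" "fst p"] assms(2) that h(2) unfolding is_lift_def
    by (intro P_same_level[of _ "snd p"]) auto
  from constant_ivec[OF convex_connected[OF cS] c0 this] obtain n where n: "\<And>p. p \<in> ?S \<Longrightarrow> K (0, p) - F p = ivec n"
    by blast
  have K0: "K (0, x, t) = F (x, t) + ivec n" if "t \<in> {0..1}" for x t
    using n[of "(x, t)"] that by (simp add: algebra_simps)
  have tr: "K (s, x + ivec m, t) = K (s, x, t) + ivec (L *v m)" if "s \<in> {0..1}" "t \<in> {0..1}" for s x t m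
  proof -
    have c: "continuous_on ?T (\<lambda>q. K (fst q, fst (snd q) + ivec m, snd (snd q)) - K q)"
      by (intro continuous_intros K(1) continuous_on_compose2[OF K(1)]) auto
    have "K (fst q, fst (snd q) + ivec m, snd (snd q)) - K q \<in> range ivec" if "q \<in> ?T" for q
      using KP[of "fst q" "snd (snd q)" "fst (snd q) + ivec m"] KP[of "fst q" "snd (snd q)" "fst (snd q)"] that
      by (intro P_same_level[of _ "snd (snd q)"]) auto
    from constant_ivec[OF convex_connected[OF cT] c this] obtain k where
      k: "\<And>q. q \<in> ?T \<Longrightarrow> K (fst q, fst (snd q) + ivec m, snd (snd q)) - K q = ivec k" by blast
    have "ivec k = ivec (L *v m)"
      using k[of "(0, 0, 0)"] K0[of 0 "0 + ivec m"] K0[of 0 0] Ft[of 0 0 m] by simp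
    then show ?thesis using k[of "(s, x, t)"] that by (simp add: algebra_simps)
  qed
  have gl: "rmat A *v K (s, x, 1) - K (s, rmat A *v x, 0) = ivec (A *v v + (A *v n - n))" if "s \<in> {0..1}" for s x
  proof -
    let ?U = "{0..1::real} \<times> (UNIV :: (real^2) set)"
    have cU: "convex ?U" by (intro convex_Times) auto
    have c: "continuous_on ?U (\<lambda>q. rmat A *v K (fst q, snd q, 1) - K (fst q, rmat A *v snd q, 0))"
      by (intro continuous_intros continuous_on_compose2[OF K(1)]) auto
    have "rmat A *v K (fst q, snd q, 1) - K (fst q, rmat A *v snd q, 0) \<in> range ivec" if "q \<in> ?U" for q
      using KP[of "fst q" 1 "snd q"] KP[of "fst q" 0 "rmat A *v snd q"] P_glue[of "snd q"]
        P_glue[of "K (fst q, snd q, 1)"] that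
      by (intro P_same_level[of _ 0]) auto
    from constant_ivec[OF convex_connected[OF cU] c this] obtain k where
      k: "\<And>q. q \<in> ?U \<Longrightarrow> rmat A *v K (fst q, snd q, 1) - K (fst q, rmat A *v snd q, 0) = ivec k"
      by blast
    have "ivec k = ivec (A *v v + (A *v n - n))"
      using k[of "(0, 0)"] K0[of 1 0] K0[of 0 0] Fg[of 0]
      by (simp add: matrix_vector_right_distrib matrix_vector_mult_diff_distrib add.commute add_diff_eq)
    then show ?thesis using k[of "(s, x)"] that by simp
  qed
  \<comment> \<open>Without subtracting \<open>n\<close> the gluing vector would be
    \<open>v + n - B *v n\<close> in place of \<open>v\<close>.\<close>
  define G where "G p = K (1, p) - ivec n" for p
  have "continuous_on ?S G"
    unfolding G_def by (intro continuous_intros continuous_on_compose2[OF K(1)]) auto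
  moreover have "G (rmat A *v x, 0) = rmat A *v (G (x, 1) - ivec v)" for x
    using gl[of 1 x] by (simp add: G_def matrix_vector_mult_diff_distrib algebra_simps)
  ultimately have "equivariant L v G"
    using tr by (simp add: equivariant_def G_def)
  moreover have "is_lift g G"
    using KP[of 1] h(3) P_add_ivec[of _ "- n"] by (simp add: is_lift_def G_def)
  ultimately show ?thesis using that by blast
qed

end

section \<open>Induced homomorphism, sections and coincidence sets\<close>

lemma homotopic_with_loop_class_eq:
  assumes "homotopic_with (loop_at X x) (top_of_set {0..1}) X c d"
  shows "loop_class X x c = loop_class X x d"
  unfolding loop_class_def using assms homotopic_with_sym homotopic_with_trans by blast

lemma pi1_map_loop_class:
  assumes "continuous_map X Y g" "loop_at X x c"
  shows "pi1_map Y x g (loop_class X x c) = loop_class Y (g x) (g \<circ> c)"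
proof -
  have "c \<in> loop_class X x c"
    using assms(2) by (simp add: loop_class_def loop_at_def pathin_def)
  moreover have "loop_class Y (g x) (g \<circ> d) = loop_class Y (g x) (g \<circ> c)" if "d \<in> loop_class X x c" for d
  proof -
    have "homotopic_with (loop_at X x) (top_of_set {0..1}) X c d" using that by (simp add: loop_class_def)
    then have "homotopic_with (loop_at Y (g x)) (top_of_set {0..1}) Y (g \<circ> c) (g \<circ> d)"
      by (rule homotopic_with_compose_continuous_map_left[OF _ assms(1)])
        (use assms(1) in \<open>auto simp: loop_at_def pathin_def intro: continuous_map_compose\<close>)
    then show ?thesis using homotopic_with_loop_class_eq by metis
  qed
  ultimately have "(\<lambda>d. loop_class Y (g x) (g \<circ> d)) ` loop_class X x c = {loop_class Y (g x) (g \<circ> c)}"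
    by blast
  then show ?thesis by (simp add: pi1_map_def)
qed

lemma homotopic_torus_loops:
  assumes c: "continuous_on {0..1} c" and d: "continuous_on {0..1} d"
    and ends: "c 0 = d 0" "c 1 = d 1" "torus_proj (c 0) = u" "torus_proj (c 1) = u"
  shows "homotopic_with (loop_at torus u) (top_of_set {0..1}) torus (\<lambda>s. torus_proj (c s)) (\<lambda>s. torus_proj (d s))"
proof -
  define K where "K = (\<lambda>q. (1 - fst q) *\<^sub>R c (snd q) + fst q *\<^sub>R d (snd q))"
  have "continuous_on ({0..1} \<times> {0..1}) (\<lambda>q. c (snd q))" "continuous_on ({0..1} \<times> {0..1}) (\<lambda>q. d (snd q))"
    by (auto intro!: continuous_on_compose2[OF c] continuous_on_compose2[OF d] continuous_intros)
  then have "continuous_on ({0..1} \<times> {0..1}) K"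
    unfolding K_def by (intro continuous_intros)
  then have cm: "continuous_map (top_of_set ({0..1} \<times> {0..1})) torus (torus_proj \<circ> K)"
    by (rule continuous_map_torus_proj)
  have loop: "loop_at torus u (\<lambda>r. (torus_proj \<circ> K) (s, r))" if "s \<in> {0..1}" for s
  proof -
    have "continuous_on {0..1} (\<lambda>r. K (s, r))"
      unfolding K_def by (auto intro!: continuous_intros c d)
    then have "pathin torus (\<lambda>r. (torus_proj \<circ> K) (s, r))"
      using continuous_map_torus_proj[of "{0..1}" "\<lambda>r. K (s, r)"] by (simp add: pathin_def o_def)
    moreover have "K (s, 0) = c 0" "K (s, 1) = c 1"
      using ends by (simp_all add: K_def flip: scaleR_add_left)
    ultimately show ?thesis using ends by (simp add: loop_at_def)
  qed
  show ?thesis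
    unfolding homotopic_with_def
    by (rule exI[of _ "torus_proj \<circ> K"]) (use cm loop in \<open>auto simp: K_def\<close>)
qed

lemma translate_torus_proj: "(\<lambda>x. x + z) ` torus_proj y = torus_proj (y + z)"
  by (auto simp: torus_proj_def image_iff algebra_simps)

lemma torus_pi1_proj: "torus_pi1 (torus_proj y) m = loop_class torus (torus_proj y) (\<lambda>s. torus_proj (y + s *\<^sub>R ivec m))"
  by (simp add: torus_pi1_def translate_torus_proj)

lemma loop_at_linear: "loop_at torus (torus_proj y) (\<lambda>s. torus_proj (y + s *\<^sub>R ivec m))"
proof -
  have "continuous_on {0..1} (\<lambda>s. y + s *\<^sub>R ivec m)" by (intro continuous_intros)
  from continuous_map_torus_proj[OF this] show ?thesis
    by (simp add: loop_at_def pathin_def o_def)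
qed

text \<open>This makes the inverse in \<open>fibre_hom\<close> meaningful. A homotopy of loops lifts
  to the square; the displacement between the two ends of the lifted loops is a lattice vector,
  constant along the homotopy, equal to \<open>m\<close> on one side and to \<open>n\<close> on the
  other.\<close>

lemma inj_torus_pi1: "inj (torus_pi1 (torus_proj y))"
proof (rule injI)
  fix m n assume eq: "torus_pi1 (torus_proj y) m = torus_pi1 (torus_proj y) n"
  have "(\<lambda>s. torus_proj (y + s *\<^sub>R ivec n)) \<in> torus_pi1 (torus_proj y) n"
    using loop_at_linear[of y n] by (simp add: torus_pi1_proj loop_class_def loop_at_def pathin_def)
  then have "homotopic_with (loop_at torus (torus_proj y)) (top_of_set {0..1}) torus
      (\<lambda>s. torus_proj (y + s *\<^sub>R ivec m)) (\<lambda>s. torus_proj (y + s *\<^sub>R ivec n))"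
    unfolding eq[symmetric] by (simp add: torus_pi1_proj loop_class_def)
  then obtain h where h: "continuous_map (prod_topology (top_of_set {0..1::real}) (top_of_set {0..1::real})) torus h"
    "\<And>r. h (0, r) = torus_proj (y + r *\<^sub>R ivec m)" "\<And>r. h (1, r) = torus_proj (y + r *\<^sub>R ivec n)"
    "\<And>s. s \<in> {0..1} \<Longrightarrow> loop_at torus (torus_proj y) (\<lambda>r. h (s, r))"
    unfolding homotopic_with_def by auto
  let ?S = "{0..1::real} \<times> {0..1::real}"
  have cS: "convex ?S" by (intro convex_Times) auto
  have "continuous_map (top_of_set ?S) torus h" using h(1) by simp
  from torus_lift[OF convex_imp_contractible[OF cS] this]
  obtain K where K: "continuous_on ?S K" "\<And>q. q \<in> ?S \<Longrightarrow> h q = torus_proj (K q)" by blast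
  have c: "continuous_on {0..1} (\<lambda>s. K (s, 1) - K (s, 0))"
    by (intro continuous_intros continuous_on_compose2[OF K(1)]) auto
  have "K (s, 1) - K (s, 0) \<in> range ivec" if "s \<in> {0..1}" for s
  proof -
    have "torus_proj (K (s, 0)) = torus_proj (K (s, 1))"
      using h(4)[OF that] K(2)[of "(s, 0)"] K(2)[of "(s, 1)"] that by (auto simp: loop_at_def)
    then show ?thesis by (auto simp: torus_proj_eq_iff)
  qed
  from constant_ivec[OF _ c this] obtain k where k: "\<And>s. s \<in> {0..1} \<Longrightarrow> K (s, 1) - K (s, 0) = ivec k"
    by auto
  have end_diff: "K (s, 1) - K (s, 0) = ivec j"
    if s: "s \<in> {0..1}" and j: "\<And>r. h (s, r) = torus_proj (y + r *\<^sub>R ivec j)" for s j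
  proof -
    have c: "continuous_on {0..1} (\<lambda>r. K (s, r) - (y + r *\<^sub>R ivec j))"
      using s by (intro continuous_intros continuous_on_compose2[OF K(1)]) auto
    have "K (s, r) - (y + r *\<^sub>R ivec j) \<in> range ivec" if "r \<in> {0..1}" for r
    proof -
      have "torus_proj (y + r *\<^sub>R ivec j) = torus_proj (K (s, r))"
        using K(2)[of "(s, r)"] that s j by auto
      then show ?thesis by (auto simp: torus_proj_eq_iff)
    qed
    from constant_ivec[OF _ c this] obtain i where "\<And>r. r \<in> {0..1} \<Longrightarrow> K (s, r) - (y + r *\<^sub>R ivec j) = ivec i"
      by auto
    from this[of 0] this[of 1] show ?thesis by (simp add: algebra_simps)
  qed
  have "ivec m = ivec n"
    using end_diff[of 0 m] end_diff[of 1 n] k[of 0] k[of 1] h(2,3) by simp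
  then show "m = n" by simp
qed

lemma mem_circle_class: "s \<in> circle_class t \<longleftrightarrow> s = t \<or> s = 0 \<and> t = 1 \<or> s = 1 \<and> t = 0"
  using mem_glue_iff[of s "{(0, 1)}" t] circle_class_eq_iff[of t s] by (auto simp: circle_class_def)

lemma quotient_map_circle_class: "quotient_map (top_of_set {0..1}) circle circle_class"
  unfolding circle_def by (rule quotient_map_quotient_topology)

context gluing
begin

lemma fibre_incl_proj: "fibre_incl A (torus_proj x) = P (x, 1)"
  by (simp add: fibre_incl_def P_def)

lemma fibre_map_proj:
  assumes "is_lift f F" shows "fibre_map A f (torus_proj x) = torus_proj (F (x, 1))"
proof -
  have "inj_on (fibre_incl A) (topspace torus)"
    by (auto simp: inj_on_def topspace_torus fibre_incl_proj P_eq_iff torus_proj_eq_iff)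
  moreover have "f (fibre_incl A (torus_proj x)) = fibre_incl A (torus_proj (F (x, 1)))"
    using assms by (simp add: fibre_incl_proj is_lift_def)
  ultimately show ?thesis
    by (simp add: fibre_map_def)
qed

text \<open>The loop of \<open>m\<close> lifts to a segment, whose image under the lift runs from
  \<open>y\<close> to \<open>y + ivec (L *v m)\<close>. In the plane this path is homotopic to the
  straight one with fixed ends.\<close>

lemma fibre_hom_eq:
  assumes f: "is_lift f F" and F: "equivariant L v F"
  shows "fibre_hom A f m = L *v m"
proof -
  define g where "g = fibre_map A f"
  define y where "y = F (0, 1)"
  have gp: "g (torus_proj x) = torus_proj (F (x, 1))" for x
    unfolding g_def by (rule fibre_map_proj[OF f])
  have Fc: "continuous_on strip F" using F by (simp add: equivariant_def)
  have c1: "continuous_on UNIV (\<lambda>x. F (x, 1))"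
    by (rule continuous_on_compose2[OF Fc]) (auto intro!: continuous_intros)
  have "g \<circ> torus_proj = torus_proj \<circ> (\<lambda>x. F (x, 1))" by (auto simp: gp)
  then have "continuous_map euclidean torus (g \<circ> torus_proj)"
    using continuous_map_torus_proj[OF c1] by simp
  then have g: "continuous_map torus torus g"
    using continuous_compose_quotient_map_eq[OF quotient_map_torus_proj] by blast
  have "pi1_map torus (torus_proj 0) g (torus_pi1 (torus_proj 0) m) =
      loop_class torus (g (torus_proj 0)) (g \<circ> (\<lambda>s. torus_proj (0 + s *\<^sub>R ivec m)))"
    unfolding torus_pi1_proj by (rule pi1_map_loop_class[OF g loop_at_linear])
  also have "\<dots> = loop_class torus (torus_proj y) (\<lambda>s. torus_proj (F (s *\<^sub>R ivec m, 1)))"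
    by (simp add: gp y_def o_def)
  also have "\<dots> = loop_class torus (torus_proj y) (\<lambda>s. torus_proj (y + s *\<^sub>R ivec (L *v m)))"
  proof (rule homotopic_with_loop_class_eq, rule homotopic_torus_loops)
    show "continuous_on {0..1} (\<lambda>s. F (s *\<^sub>R ivec m, 1))"
      by (rule continuous_on_compose2[OF c1]) (auto intro!: continuous_intros)
    show "F (1 *\<^sub>R ivec m, 1) = y + 1 *\<^sub>R ivec (L *v m)"
      using F unfolding equivariant_def y_def by (metis add.left_neutral atLeastAtMost_iff order_refl scaleR_one zero_le_one)
    then show "torus_proj (F (1 *\<^sub>R ivec m, 1)) = torus_proj y" by simp
  qed (auto simp: y_def intro!: continuous_intros)
  also have "\<dots> = torus_pi1 (torus_proj y) (L *v m)"
    by (simp add: torus_pi1_proj)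
  finally show ?thesis
    unfolding fibre_hom_def Let_def g_def[symmetric]
    by (simp add: gp y_def[symmetric] inv_f_f[OF inj_torus_pi1])
qed

section \<open>Differences of lifts and coincidence sets\<close>

lemma equivariant_diff:
  assumes "equivariant L v F" "equivariant M w G"
  shows "equivariant (L - M) (v - w) (\<lambda>p. F p - G p)"
  using assms unfolding equivariant_def
  by (auto intro!: continuous_intros simp: matrix_vector_mult_diff_distrib matrix_vector_mult_diff_rdistrib)

lemma equivariant_add:
  assumes "equivariant L v F" "equivariant M w G"
  shows "equivariant (L + M) (v + w) (\<lambda>p. F p + G p)"
  using assms unfolding equivariant_def
  by (auto intro!: continuous_intros simp: matrix_vector_mult_diff_distrib matrix_vector_mult_add_rdistrib
      matrix_vector_right_distrib)

lemma is_lift_id: "is_lift id fst" and equivariant_fst: "equivariant (mat 1) 0 fst"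
  by (auto simp: is_lift_def equivariant_def intro!: continuous_intros)

text \<open>The indeterminacy of \<open>v\<close> modulo the image of A - id: the change is (A - id)
  applied to \<open>B *v n\<close>.\<close>

lemma shift_lift:
  assumes "is_lift f F" "equivariant L v F"
  shows "is_lift f (\<lambda>p. F p + ivec n)" "equivariant L (v + n - B *v n) (\<lambda>p. F p + ivec n)"
  using assms unfolding is_lift_def equivariant_def
  by (auto intro!: continuous_intros simp: matrix_vector_mult_diff_distrib matrix_vector_right_distrib)

text \<open>Zeros of the torus-valued map induced by \<open>D\<close>: every lattice value counts,
  since lifts that differ by a lattice vector describe the same point.\<close>

definition zeros :: "((real ^ 2) \<times> real \<Rightarrow> real ^ 2) \<Rightarrow> bundle_point set" where
  "zeros D = P ` {p \<in> strip. D p \<in> range ivec}"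

abbreviation "coincidence_space D \<equiv> subtopology N (zeros D)"

lemma coincidences_lift:
  assumes "is_lift f F" "is_lift h H"
  shows "coincidences A f h = zeros (\<lambda>p. F p - H p)"
proof -
  have "f (P p) = h (P p) \<longleftrightarrow> F p - H p \<in> range ivec" if "p \<in> strip" for p
  proof -
    have "f (P p) = P (F p, snd p)" "h (P p) = P (H p, snd p)"
      using assms that by (auto simp: is_lift_def)
    moreover have "P (F p, snd p) = P (H p, snd p) \<longleftrightarrow> F p - H p \<in> range ivec"
      unfolding P_eq_iff by (auto simp: image_iff) (metis ivec_simps(4) add_uminus_conv_diff diff_add_cancel add.commute minus_diff_eq)+
    ultimately show ?thesis by simp
  qed
  then show ?thesis by (auto simp: coincidences_def zeros_def topspace_N)
qed

text \<open>Deforming the identity as well produces no further coincidence sets: a difference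
  \<open>D\<close> of arbitrary lifts is also the difference of \<open>D + fst\<close> and
  \<open>fst\<close>.\<close>

lemma coincidence_sets:
  assumes "is_lift f F" "equivariant L v F"
  shows "{coincidences A f' h' | f' h'. fiberwise_homotopic A f f' \<and> fiberwise_homotopic A id h'} =
    zeros ` {D. equivariant (L - mat 1) v D}"
proof (intro equalityI subsetI)
  fix C assume "C \<in> {coincidences A f' h' | f' h'. fiberwise_homotopic A f f' \<and> fiberwise_homotopic A id h'}"
  then obtain f' h' where C: "C = coincidences A f' h'" "fiberwise_homotopic A f f'" "fiberwise_homotopic A id h'" by blast
  obtain F' where F': "is_lift f' F'" "equivariant L v F'" using fiberwise_homotopic_lift[OF C(2) assms] by blast
  obtain H where H: "is_lift h' H" "equivariant (mat 1) 0 H"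
    using fiberwise_homotopic_lift[OF C(3) is_lift_id equivariant_fst] by blast
  show "C \<in> zeros ` {D. equivariant (L - mat 1) v D}"
    using coincidences_lift[OF F'(1) H(1)] equivariant_diff[OF F'(2) H(2)] C(1) by simp
next
  fix C assume "C \<in> zeros ` {D. equivariant (L - mat 1) v D}"
  then obtain D where D: "C = zeros D" "equivariant (L - mat 1) v D" by blast
  have e: "equivariant L v (\<lambda>p. D p + fst p)" using equivariant_add[OF D(2) equivariant_fst] by simp
  define f' where "f' = descend (\<lambda>p. D p + fst p)"
  have l: "is_lift f' (\<lambda>p. D p + fst p)" unfolding f'_def by (rule is_lift_descend[OF e])
  have "C = coincidences A f' id"
    using coincidences_lift[OF l is_lift_id] D(1) by simp
  moreover have "fiberwise_homotopic A f f'" using fiberwise_homotopic_lifts[OF assms l e] .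
  moreover have "fiberwise_homotopic A id id"
    using fiberwise_homotopic_lifts[OF is_lift_id equivariant_fst is_lift_id equivariant_fst] .
  ultimately show "C \<in> {coincidences A f' h' | f' h'. fiberwise_homotopic A f f' \<and> fiberwise_homotopic A id h'}"
    by blast
qed

lemma MC_eq_INF:
  assumes "is_lift f F" "equivariant L v F"
  shows "MC A f id = (INF D\<in>{D. equivariant (L - mat 1) v D}. ecount (zeros D))"
proof -
  have "MC A f id = Inf (ecount ` {coincidences A f' h' | f' h'. fiberwise_homotopic A f f' \<and> fiberwise_homotopic A id h'})"
    unfolding MC_def by (rule arg_cong[where f = Inf]) blast
  then show ?thesis by (simp add: coincidence_sets[OF assms] image_image)
qed

lemma MCC_eq_INF:
  assumes "is_lift f F" "equivariant L v F"
  shows "MCC A f id =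
    (INF D\<in>{D. equivariant (L - mat 1) v D}. ecount (path_components_of (coincidence_space D)))"
proof -
  have "MCC A f id = Inf ((\<lambda>C. ecount (path_components_of (subtopology N C))) `
      {coincidences A f' h' | f' h'. fiberwise_homotopic A f f' \<and> fiberwise_homotopic A id h'})"
    unfolding MCC_def by (rule arg_cong[where f = Inf]) blast
  then show ?thesis by (simp add: coincidence_sets[OF assms] image_image)
qed

section \<open>Sections of the bundle and the gluing vector\<close>

lemma std_section_circle_class:
  assumes "t \<in> {0..1}" shows "std_section A v (circle_class t) = P (t *\<^sub>R ivec v, t)"
proof -
  have "P (s *\<^sub>R ivec v, s) = P (t *\<^sub>R ivec v, t)" if "s \<in> circle_class t" for s
    using that P_add_ivec[of 0 v 1] P_glue[of 0] by (auto simp: mem_circle_class)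
  moreover have "t \<in> circle_class t" by (simp add: mem_circle_class)
  ultimately have "(\<lambda>s. P (s *\<^sub>R ivec v, s)) ` circle_class t = {P (t *\<^sub>R ivec v, t)}"
    by blast
  moreover have "std_section A v (circle_class t) = the_elem ((\<lambda>s. P (s *\<^sub>R ivec v, s)) ` circle_class t)"
    by (simp add: std_section_def P_def)
  ultimately show ?thesis by simp
qed

text \<open>Every representative of the section class is the gluing vector of some lift. Lifting the
  homotopy of sections compares its ends by A (v + n) - n = A (v' + n') - n', and the resulting
  difference of \<open>v'\<close> and \<open>v\<close> is what a shift of the lift by
  \<open>n - n'\<close> produces.\<close>

lemma represents_section_class_lift:
  assumes rep: "represents_section_class A f v'" and f: "is_lift f F" and F: "equivariant L v F"
  obtains G where "is_lift f G" "equivariant L v' G"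
proof -
  let ?S = "{0..1::real} \<times> {0..1::real}"
  have cS: "convex ?S" by (intro convex_Times) auto
  obtain h where h: "continuous_map (prod_topology (top_of_set {0..1::real}) circle) N h"
    "\<And>z. h (0, z) = f (std_section A 0 z)" "\<And>z. h (1, z) = std_section A v' z"
    "\<And>s. s \<in> {0..1} \<Longrightarrow> is_section A (\<lambda>z. h (s, z))"
    using rep unfolding represents_section_class_def homotopic_with_def by auto
  have circ: "circle_class t \<in> topspace circle" if "t \<in> {0..1}" for t
    using quotient_imp_surjective_map[OF quotient_map_circle_class] that by auto
  have "continuous_map (prod_topology (top_of_set {0..1::real}) (top_of_set {0..1::real}))
    (prod_topology (top_of_set {0..1::real}) circle) (\<lambda>(s, t). (s, circle_class t))"
    by (rule quotient_imp_continuous_map[OF quotient_map_prod_right[OF _ _ quotient_map_circle_class]])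
      (auto simp: compact_imp_locally_compact_space compact_space_subtopology intro!: disjI1 Hausdorff_space_subtopology)
  from continuous_map_compose[OF this h(1)]
  have cm: "continuous_map (top_of_set ?S) N (h \<circ> (\<lambda>(s, t). (s, circle_class t)))" by simp
  have pr: "bundle_proj ((h \<circ> (\<lambda>(s, t). (s, circle_class t))) q) = circle_class (snd q)" if "q \<in> ?S" for q
    using h(4)[of "fst q"] circ[of "snd q"] that by (auto simp: is_section_def)
  have "continuous_on ?S snd" and "0 \<le> snd q \<and> snd q \<le> 1" if "q \<in> ?S" for q
    using that by (auto intro!: continuous_intros)
  from lift_over_base[OF cS cm this pr] obtain K where K: "continuous_on ?S K"
    "\<And>q. q \<in> ?S \<Longrightarrow> (h \<circ> (\<lambda>(s, t). (s, circle_class t))) q = P (K q, snd q)" by blast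
  have KP: "h (s, circle_class t) = P (K (s, t), t)" if "s \<in> {0..1}" "t \<in> {0..1}" for s t
    using K(2)[of "(s, t)"] that by simp
  have Fc: "continuous_on strip F" and Fg: "\<And>x. F (rmat A *v x, 0) = rmat A *v (F (x, 1) - ivec v)"
    using F by (auto simp: equivariant_def)
  have c: "continuous_on {0..1} (\<lambda>t. K (0, t) - F (0, t))" "continuous_on {0..1} (\<lambda>t. K (1, t) - t *\<^sub>R ivec v')"
    by (intro continuous_intros continuous_on_compose2[OF K(1)] continuous_on_compose2[OF Fc]; auto)+
  have "K (0, t) - F (0, t) \<in> range ivec" "K (1, t) - t *\<^sub>R ivec v' \<in> range ivec" if "t \<in> {0..1}" for t
    using KP[of 0 t] KP[of 1 t] that h(2,3) f std_section_circle_class[OF that]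
    by (auto simp: is_lift_def intro!: P_same_level[of _ t])
  from constant_ivec[OF _ c(1) this(1)] constant_ivec[OF _ c(2) this(2)] obtain n n' where
    n: "\<And>t. t \<in> {0..1} \<Longrightarrow> K (0, t) - F (0, t) = ivec n" "\<And>t. t \<in> {0..1} \<Longrightarrow> K (1, t) - t *\<^sub>R ivec v' = ivec n'"
    by (metis connected_Icc)
  have c: "continuous_on {0..1} (\<lambda>s. rmat A *v K (s, 1) - K (s, 0))"
    by (intro continuous_intros continuous_on_compose2[OF K(1)]) auto
  have "rmat A *v K (s, 1) - K (s, 0) \<in> range ivec" if "s \<in> {0..1}" for s
  proof -
    have "circle_class 1 = circle_class 0" by (simp add: circle_class_eq_iff)
    then show ?thesis
      using KP[of s 1] KP[of s 0] P_glue[of "K (s, 1)"] that by (intro P_same_level[of _ 0]) simp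
  qed
  from constant_ivec[OF _ c this] obtain k where k: "\<And>s. s \<in> {0..1} \<Longrightarrow> rmat A *v K (s, 1) - K (s, 0) = ivec k"
    by auto
  have K01: "K (0, 0) = F (0, 0) + ivec n" "K (0, 1) = F (0, 1) + ivec n" "K (1, 0) = ivec n'" "K (1, 1) = ivec v' + ivec n'"
    using n(1)[of 0] n(1)[of 1] n(2)[of 0] n(2)[of 1] by (simp_all add: algebra_simps)
  have F0: "F (0, 0) = rmat A *v F (0, 1) - ivec (A *v v)"
    using Fg[of 0] by (simp add: matrix_vector_mult_diff_distrib)
  have "ivec (A *v (v + n) - n) = ivec k"
    using k[of 0] by (simp add: K01 F0 matrix_vector_mult_diff_distrib matrix_vector_right_distrib algebra_simps)
  also have "\<dots> = ivec (A *v (v' + n') - n')"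
    using k[of 1] by (simp add: K01 matrix_vector_mult_diff_distrib matrix_vector_right_distrib algebra_simps)
  finally have "A *v (v + n) - n = A *v (v' + n') - n'" by (simp only: ivec_inject)
  then have "B *v (A *v (v + n) - n) = B *v (A *v (v' + n') - n')" by simp
  then have "v + (n - n') - B *v (n - n') = v'"
    by (simp add: matrix_vector_mult_diff_distrib algebra_simps)
  then show ?thesis
    using shift_lift[OF f F, of "n - n'"] that by simp
qed

end

section \<open>Level sets and path components\<close>

lemma norm_ivec_ge_1:
  assumes "m \<noteq> 0" shows "norm (ivec m) \<ge> 1"
proof -
  obtain i where "m $ i \<noteq> 0" using assms by (auto simp: vec_eq_iff)
  then have "1 \<le> \<bar>ivec m $ i\<bar>" by simp
  also have "\<dots> \<le> norm (ivec m)" by (rule component_le_norm_cart)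
  finally show ?thesis .
qed

lemma closed_ivec_image: "closed (ivec ` Z)"
proof (rule discrete_imp_closed[of 1])
  show "\<forall>x\<in>ivec ` Z. \<forall>y\<in>ivec ` Z. dist y x < 1 \<longrightarrow> y = x"
  proof (intro ballI impI)
    fix x y assume "x \<in> ivec ` Z" "y \<in> ivec ` Z" "dist y x < 1"
    then obtain m n where "x = ivec m" "y = ivec n" "norm (ivec (n - m)) < 1" by (auto simp: dist_norm)
    then show "y = x" using norm_ivec_ge_1[of "n - m"] by force
  qed
qed simp

lemma ecount_ge:
  assumes "finite R" "\<And>r. r \<in> R \<Longrightarrow> h r \<in> S" "inj_on h R"
  shows "enat (card R) \<le> ecount S"
  using assms card_inj_on_le[of h R S] by (auto simp: ecount_def)

lemma ecount_le:
  assumes "finite R" "S \<subseteq> h ` R"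
  shows "ecount S \<le> enat (card R)"
proof -
  have "finite S" using assms finite_surj by blast
  moreover have "card S \<le> card R" using assms surj_card_le by blast
  ultimately show ?thesis by (simp add: ecount_def)
qed

context gluing
begin

text \<open>The map \<open>beta\<close> before passing to the cokernel: if \<open>D\<close> has the
  value \<open>u\<close> at \<open>(x, 1)\<close>, it has the value \<open>twist v u\<close> at the
  glued point at time 0.\<close>

definition twist :: "int ^ 2 \<Rightarrow> int ^ 2 \<Rightarrow> int ^ 2" where
  "twist v u = A *v (u - v)"

lemma ivec_twist: "ivec (twist v u) = rmat A *v (ivec u - ivec v)"
  by (simp add: twist_def flip: ivec_simps)

lemma twist_inverse: "twist v (B *v u + v) = u"
  by (simp add: twist_def)

lemma equivariant_translate:
  "equivariant L v D \<Longrightarrow> t \<in> {0..1} \<Longrightarrow> D (x + ivec m, t) = D (x, t) + ivec (L *v m)"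
  by (simp add: equivariant_def)

lemma equivariant_glue:
  "equivariant L v D \<Longrightarrow> D (rmat A *v x, 0) = rmat A *v (D (x, 1) - ivec v)"
  by (simp add: equivariant_def)

text \<open>Translate by \<open>m\<close> and cross the seam, in either order.\<close>

lemma equivariant_commute:
  assumes "equivariant L v D" shows "A *v (L *v m) = L *v (A *v m)"
proof -
  have "D (rmat A *v (0 + ivec m), 0) = rmat A *v (D (0 + ivec m, 1) - ivec v)"
    by (rule equivariant_glue[OF assms])
  also have "\<dots> = D (rmat A *v 0, 0) + ivec (A *v (L *v m))"
    unfolding equivariant_glue[OF assms] 
    using equivariant_translate[OF assms, of 1 0 m]
    by (simp add: matrix_vector_right_distrib matrix_vector_mult_diff_distrib)
  finally have "ivec (L *v (A *v m)) = ivec (A *v (L *v m))"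
    using equivariant_translate[OF assms, of 0 0 "A *v m"] by simp
  then show ?thesis by (simp only: ivec_inject)
qed

lemma twist_translate:
  assumes "equivariant L v D" shows "twist v (u + L *v m) = twist v u + L *v (A *v m)"
proof -
  have "twist v (u + L *v m) = twist v u + A *v (L *v m)"
    by (simp add: twist_def algebra_simps matrix_vector_right_distrib matrix_vector_mult_diff_distrib)
  then show ?thesis by (simp add: equivariant_commute[OF assms])
qed

text \<open>\<open>lab\<close> stands for any invariant of the classes u ~ u + L m ~ A (u - v).
  Points of the strip over one point of the bundle are related by translations and by the seam,
  which change the value in these two ways.\<close>

lemma level_value:
  assumes D: "equivariant L v D" and lab: "\<And>u m. lab (u + L *v m) = lab u" "\<And>u. lab (twist v u) = lab u"
    and Ppq: "P p = P q" and pI: "p \<in> strip" and qI: "q \<in> strip" and Dp: "D p = ivec u"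
  obtains w where "D q = ivec w" "lab w = lab u"
proof -
  obtain x s y t where p: "p = (x, s)" and q: "q = (y, t)" by fastforce
  have eq: "P (x, s) = P (y, t)" and s: "s \<in> {0..1}" and t: "t \<in> {0..1}" and u: "D (x, s) = ivec u"
    using Ppq pI qI Dp p q by auto
  have that: thesis if "D (y, t) = ivec w" "lab w = lab u" for w
    using that \<open>\<And>w. D q = ivec w \<Longrightarrow> lab w = lab u \<Longrightarrow> thesis\<close> q by simp
  note tr = equivariant_translate[OF D] and gl = equivariant_glue[OF D]
  from eq consider m where "s = t" "y = x + ivec m" | m where "s = 1" "t = 0" "y = rmat A *v x + ivec m"
    | m where "s = 0" "t = 1" "y = rmat B *v x + ivec m"
    unfolding P_eq_iff by blast
  then show ?thesis
  proof cases
    case 1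
    then show ?thesis using that[of "u + L *v m"] lab(1) tr[OF t] u by simp
  next
    case 2
    then have "D (y, t) = ivec (twist v u + L *v m)"
      using tr[OF t, of "rmat A *v x" m] gl[of x] u by (simp add: ivec_twist)
    then show ?thesis using that lab by metis
  next
    case 3
    have "D (x, 0) = rmat A *v (D (rmat B *v x, 1) - ivec v)" using gl[of "rmat B *v x"] by simp
    then have "rmat B *v ivec u + ivec v = D (rmat B *v x, 1)"
      using u 3 by (metis diff_add_cancel rBA)
    then have "D (y, t) = ivec (B *v u + v + L *v m)"
      using tr[OF t, of "rmat B *v x" m] 3 by simp
    then show ?thesis using that[of "B *v u + v + L *v m"] lab twist_inverse by metis
  qed
qed

text \<open>The arbitrary set \<open>J\<close> of labels is what gives openness too: applied to a
  label and to all the others, it splits the coincidence set into two closed pieces. Closedness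
  holds because every set of lattice points is closed.\<close>

lemma closedin_level_image:
  assumes D: "equivariant L v D" and lab: "\<And>u m. lab (u + L *v m) = lab u" "\<And>u. lab (twist v u) = lab u"
  shows "closedin N (P ` {p \<in> strip. D p \<in> ivec ` {u. lab u \<in> J}})"
proof -
  let ?S = "{p \<in> (UNIV :: (real^2) set) \<times> {0..1::real}. D p \<in> ivec ` {u. lab u \<in> J}}"
  have sat: "p \<in> ?S" if pq: "p \<in> strip" "q \<in> ?S" "P q = P p" for p q
  proof -
    obtain u where u: "D q = ivec u" "lab u \<in> J" using \<open>q \<in> ?S\<close> by blast
    obtain w where "D p = ivec w" "lab w = lab u"
      using level_value[OF D lab pq(3) _ pq(1) u(1)] pq(2) by blast
    then show ?thesis using u pq(1) by auto
  qed
  have "closedin (top_of_set strip) (strip \<inter> D -` (ivec ` {u. lab u \<in> J}))"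
    using D unfolding equivariant_def by (intro continuous_closedin_preimage closed_ivec_image) auto
  moreover have "{p \<in> strip. P p \<in> P ` ?S} = strip \<inter> D -` (ivec ` {u. lab u \<in> J})"
  proof (intro equalityI subsetI)
    fix p assume "p \<in> {p \<in> strip. P p \<in> P ` ?S}"
    then obtain q where "q \<in> ?S" "P p = P q" "p \<in> strip" by blast
    then have "p \<in> ?S" using sat[of p q] by simp
    then show "p \<in> strip \<inter> D -` (ivec ` {u. lab u \<in> J})" by simp
  qed auto
  moreover have "closedin (top_of_set strip) {p \<in> strip. P p \<in> P ` ?S} \<longleftrightarrow> closedin N (P ` ?S)"
  proof -
    have "P ` ?S \<subseteq> topspace N" by (auto simp: topspace_N)
    then show ?thesis
      using quotient_map_P unfolding quotient_map_closedin topspace_euclidean_subtopology by blast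
  qed
  ultimately show ?thesis by metis
qed

lemma component_label:
  assumes D: "equivariant L v D" and lab: "\<And>u m. lab (u + L *v m) = lab u" "\<And>u. lab (twist v u) = lab u"
    and p: "p \<in> strip" "D p = ivec u" and q: "q \<in> strip" "D q = ivec w"
    and conn: "path_component_of (coincidence_space D) (P p) (P q)"
  shows "lab u = lab w"
proof (rule ccontr)
  assume ne: "lab u \<noteq> lab w"
  define S where "S J = P ` {p \<in> strip. D p \<in> ivec ` {u. lab u \<in> J}}" for J
  have cl: "closedin N (S J)" for J
    unfolding S_def by (rule closedin_level_image[OF D lab])
  obtain C where "path_connectedin (coincidence_space D) C" "P p \<in> C" "P q \<in> C"
    using conn path_component_of by metis
  then have C: "connectedin N C" "C \<subseteq> zeros D" "P p \<in> C" "P q \<in> C"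
    by (auto simp: path_connectedin_subtopology intro: path_connectedin_imp_connectedin)
  have "zeros D = S {lab u} \<union> S (- {lab u})"
    by (auto simp: zeros_def S_def)
  moreover have "S {lab u} \<inter> S (- {lab u}) = {}"
  proof -
    have "z \<notin> S (- {lab u})" if z: "z \<in> S {lab u}" for z
    proof -
      obtain a i where a: "z = P a" "a \<in> strip" "D a = ivec i" "lab i = lab u"
        using z unfolding S_def by fast
      show ?thesis
      proof
        assume "z \<in> S (- {lab u})"
        then obtain b j where b: "z = P b" "b \<in> strip" "D b = ivec j" "lab j \<noteq> lab u"
          unfolding S_def by fast
        obtain k where "D b = ivec k" "lab k = lab i"
          using level_value[OF D lab _ a(2) b(2) a(3)] a(1) b(1) by metis
        then show False using a(4) b(3,4) by simp
      qed
    qed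
    then show ?thesis by fast
  qed
  moreover have "P p \<in> S {lab u}" "P q \<in> S (- {lab u})"
    using p q ne by (auto simp: S_def)
  ultimately show False
    using C cl[of "{lab u}"] cl[of "- {lab u}"] unfolding connectedin_closedin by blast
qed

lemma zeros_subset: "zeros D \<subseteq> topspace N"
  by (auto simp: zeros_def topspace_N)

lemma components_ge:
  assumes D: "equivariant L v D" and lab: "\<And>u m. lab (u + L *v m) = lab u" "\<And>u. lab (twist v u) = lab u"
    and R: "finite R" "inj_on lab R"
    and att: "\<And>r. r \<in> R \<Longrightarrow> \<exists>p\<in>strip. \<exists>u. D p = ivec u \<and> lab u = lab r"
  shows "enat (card R) \<le> ecount (path_components_of (coincidence_space D))"
proof -
  obtain p u where pu: "\<And>r. r \<in> R \<Longrightarrow> p r \<in> strip \<and> D (p r) = ivec (u r) \<and> lab (u r) = lab r"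
    using att by metis
  define h where "h r = path_component_of_set (coincidence_space D) (P (p r))" for r
  have inz: "P (p r) \<in> zeros D" if "r \<in> R" for r
    using pu[OF that] by (auto simp: zeros_def)
  have top: "topspace (coincidence_space D) = zeros D" using zeros_subset by auto
  show ?thesis
  proof (rule ecount_ge[OF R(1), of h])
    show "h r \<in> path_components_of (coincidence_space D)" if "r \<in> R" for r
      unfolding h_def path_components_of_def top using inz[OF that] by blast
    show "inj_on h R"
    proof (rule inj_onI)
      fix r s assume rs: "r \<in> R" "s \<in> R" "h r = h s"
      have "P (p s) \<in> h s" using inz[OF rs(2)] top by (simp add: h_def path_component_of_refl)
      then have "path_component_of (coincidence_space D) (P (p r)) (P (p s))"
        using rs(3) unfolding h_def by blast
      then have "lab (u r) = lab (u s)"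
        using component_label[OF D lab, of "p r" "u r" "p s" "u s"] pu[OF rs(1)] pu[OF rs(2)] by blast
      then show "r = s" using pu[OF rs(1)] pu[OF rs(2)] R(2) rs(1,2) by (auto dest: inj_onD)
    qed
  qed
qed

definition level :: "((real ^ 2) \<times> real \<Rightarrow> real ^ 2) \<Rightarrow> int ^ 2 \<Rightarrow> ((real ^ 2) \<times> real) set" where
  "level D u = {p \<in> strip. D p = ivec u}"

text \<open>Vacuous if one of the levels is empty, which is why transitivity requires a point of the
  middle level.\<close>

definition joined :: "((real ^ 2) \<times> real \<Rightarrow> real ^ 2) \<Rightarrow> int ^ 2 \<Rightarrow> int ^ 2 \<Rightarrow> bool" where
  "joined D u w \<longleftrightarrow> (\<forall>p\<in>level D u. \<forall>q\<in>level D w. path_component_of (coincidence_space D) (P p) (P q))"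

lemma level_in_zeros: "p \<in> level D u \<Longrightarrow> P p \<in> zeros D"
  by (auto simp: level_def zeros_def)

lemma joined_refl:
  assumes "path_connected (level D u)" shows "joined D u u"
  unfolding joined_def
proof (intro ballI)
  fix p q assume pq: "p \<in> level D u" "q \<in> level D u"
  have "path_connectedin (top_of_set strip) (level D u)"
    using assms by (auto simp: path_connectedin_subtopology level_def)
  from path_connectedin_continuous_map_image[OF quotient_imp_continuous_map[OF quotient_map_P] this]
  have "path_connectedin (coincidence_space D) (P ` level D u)"
    using level_in_zeros by (auto simp: path_connectedin_subtopology)
  then show "path_component_of (coincidence_space D) (P p) (P q)"
    unfolding path_component_of using pq by (intro exI[of _ "P ` level D u"]) simp
qed

lemma joined_sym: "joined D u w \<Longrightarrow> joined D w u"
  unfolding joined_def using path_component_of_sym by metis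

lemma joined_trans: "joined D u w \<Longrightarrow> joined D w z \<Longrightarrow> level D w \<noteq> {} \<Longrightarrow> joined D u z"
  unfolding joined_def using path_component_of_trans by (metis ex_in_conv)

lemma joined_common:
  assumes "path_connected (level D u)" "path_connected (level D w)" "p \<in> level D u" "q \<in> level D w" "P p = P q"
  shows "joined D u w"
  using joined_refl[OF assms(1)] joined_refl[OF assms(2)] assms(3-5)
  unfolding joined_def using path_component_of_trans by metis

lemma joined_translate:
  assumes D: "equivariant L v D" and pc: "\<And>u. path_connected (level D u)" and p: "level D u \<noteq> {}"
  shows "joined D u (u + L *v m)" "level D (u + L *v m) \<noteq> {}"
proof -
  obtain x t where xt: "(x, t) \<in> level D u" using p by auto
  then have l: "(x + ivec m, t) \<in> level D (u + L *v m)"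
    using equivariant_translate[OF D] by (auto simp: level_def)
  show "joined D u (u + L *v m)" by (rule joined_common[OF pc pc xt l]) simp
  show "level D (u + L *v m) \<noteq> {}" using l by blast
qed

text \<open>A level can be continued into the level of the twisted value across the seam, provided
  that it reaches time 1.\<close>

lemma joined_twist:
  assumes D: "equivariant L v D" and pc: "\<And>u. path_connected (level D u)" and p: "(x, 1) \<in> level D u"
  shows "joined D u (twist v u)" "level D (twist v u) \<noteq> {}"
proof -
  have l: "(rmat A *v x, 0) \<in> level D (twist v u)"
    using p equivariant_glue[OF D, of x] by (simp add: level_def ivec_twist)
  show "joined D u (twist v u)" by (rule joined_common[OF pc pc p l]) (simp add: P_glue)
  show "level D (twist v u) \<noteq> {}" using l by blast
qed

lemma components_le:
  assumes R: "finite R" and j: "\<And>u. level D u \<noteq> {} \<Longrightarrow> \<exists>r\<in>R. joined D u r \<and> level D r \<noteq> {}"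
  shows "ecount (path_components_of (coincidence_space D)) \<le> enat (card R)"
proof -
  have top: "topspace (coincidence_space D) = zeros D" using zeros_subset by auto
  define h where "h r = path_component_of_set (coincidence_space D) (P (SOME p. p \<in> level D r))" for r
  have "path_component_of_set (coincidence_space D) (P p) \<in> h ` R" if p: "p \<in> level D u" for p u
  proof -
    obtain r where r: "r \<in> R" "joined D u r" "level D r \<noteq> {}" using j p by blast
    then have "path_component_of (coincidence_space D) (P p) (P (SOME p. p \<in> level D r))"
      using p unfolding joined_def by (metis some_in_eq)
    then have "path_component_of_set (coincidence_space D) (P p) = h r"
      by (simp add: h_def path_component_of_equiv)
    then show ?thesis using r(1) by (rule image_eqI)
  qed
  then have "path_components_of (coincidence_space D) \<subseteq> h ` R"
    unfolding path_components_of_def top by (auto simp: zeros_def level_def)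
  then show ?thesis by (rule ecount_le[OF R])
qed

lemma zeros_empty_components: "zeros D = {} \<Longrightarrow> path_components_of (coincidence_space D) = {}"
  using path_components_of_eq_empty by (simp add: path_components_of_def)

section \<open>Continuation over several turns of the circle\<close>

lemma equivariant_extension:
  assumes D: "equivariant L v D"
  obtains E where "continuous_on (UNIV \<times> {0..real n + 1}) E"
    "\<And>x t. t \<in> {0..1} \<Longrightarrow> E (x, t) = D (x, t)"
    "\<And>x t m. t \<in> {0..real n + 1} \<Longrightarrow> E (x + ivec m, t) = E (x, t) + ivec (L *v m)"
    "\<And>x t. t \<in> {0..real n} \<Longrightarrow> E (rmat A *v x, t) = rmat A *v (E (x, t + 1) - ivec v)"
proof (induction n arbitrary: thesis)
  case 0
  show ?case
    by (rule 0[of D]) (use D in \<open>auto simp: equivariant_def\<close>)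
next
  case (Suc n)
  obtain E where E: "continuous_on (UNIV \<times> {0..real n + 1}) E"
    "\<And>x t. t \<in> {0..1} \<Longrightarrow> E (x, t) = D (x, t)"
    "\<And>x t m. t \<in> {0..real n + 1} \<Longrightarrow> E (x + ivec m, t) = E (x, t) + ivec (L *v m)"
    "\<And>x t. t \<in> {0..real n} \<Longrightarrow> E (rmat A *v x, t) = rmat A *v (E (x, t + 1) - ivec v)"
    using Suc.IH by metis
  \<comment> \<open>The gluing equation solved for the later time. It reproduces \<open>E\<close> on
    the overlap from time 1 to time n + 1, so the two pieces can be pasted.\<close>
  define E' where "E' p = rmat B *v E (rmat A *v fst p, snd p - 1) + ivec v" for p
  have EE': "E (x, t) = E' (x, t)" if "t \<in> {1..real n + 1}" for x t
    using E(4)[of "t - 1" x] that by (simp add: E'_def)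
  define G where "G p = (if snd p \<le> real n + 1 then E p else E' p)" for p
  have GE': "G (x, t) = E' (x, t)" if "t \<in> {1..real n + 2}" for x t
    using EE'[of t x] that by (simp add: G_def)
  show ?case
  proof (rule Suc.prems[of G])
    have "{p \<in> (UNIV :: (real^2) set) \<times> {0..real n + 2}. snd p \<le> real n + 1} = UNIV \<times> {0..real n + 1}" by auto
    moreover have "continuous_on {p \<in> (UNIV :: (real^2) set) \<times> {0..real n + 2}. real n + 1 \<le> snd p} E'"
      unfolding E'_def by (intro continuous_intros continuous_on_compose2[OF E(1)]) auto
    ultimately have "continuous_on (UNIV \<times> {0..real n + 2}) G"
      unfolding G_def using E(1) EE' by (intro continuous_on_cases_le) (auto intro!: continuous_intros)
    then show "continuous_on (UNIV \<times> {0..real (Suc n) + 1}) G" by (simp add: add.commute)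
    show "G (x, t) = D (x, t)" if "t \<in> {0..1}" for x t
      using that E(2) by (simp add: G_def)
    show "G (x + ivec m, t) = G (x, t) + ivec (L *v m)" if "t \<in> {0..real (Suc n) + 1}" for x t m
    proof (cases "t \<le> real n + 1")
      case True
      then show ?thesis using that E(3) by (simp add: G_def)
    next
      case False
      then have "E (rmat A *v x + ivec (A *v m), t - 1) = E (rmat A *v x, t - 1) + ivec (L *v (A *v m))"
        using that by (intro E(3)) auto
      moreover have "B *v (L *v (A *v m)) = L *v m"
        by (simp flip: equivariant_commute[OF D])
      ultimately show ?thesis
        using False by (simp add: G_def E'_def matrix_vector_right_distrib)
    qed
    show "G (rmat A *v x, t) = rmat A *v (G (x, t + 1) - ivec v)" if "t \<in> {0..real (Suc n)}" for x t
      using that GE'[of "t + 1" x] by (simp add: G_def E'_def)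
  qed
qed

text \<open>An integral value at a late time is carried back to the strip one turn at a time. Each
  turn applies \<open>twist v\<close>, so the value stays in its orbit.\<close>

lemma extension_value:
  assumes "\<And>x t. t \<in> {0..1} \<Longrightarrow> E (x, t) = D (x, t)"
    and E: "\<And>x t. t \<in> {0..real n} \<Longrightarrow> E (rmat A *v x, t) = rmat A *v (E (x, t + 1) - ivec v)"
    and "E (x, t) = ivec u" "t \<in> {0..real n + 1}"
  shows "\<exists>p\<in>strip. \<exists>k. D p = ivec ((twist v ^^ k) u)"
  using assms(3,4)
proof (induction "nat \<lfloor>t\<rfloor>" arbitrary: t x u)
  case 0
  have "t < 1" using 0(1) by linarith
  then have "t \<in> {0..1}" using 0(3) by simp
  then have "(x, t) \<in> strip" "D (x, t) = ivec ((twist v ^^ 0) u)"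
    using 0(2) assms(1) by auto
  then show ?case by blast
next
  case (Suc j)
  then have t: "t \<ge> 1" by linarith
  then have "E (rmat A *v x, t - 1) = ivec (twist v u)"
    using E[of "t - 1" x] Suc.prems by (simp add: ivec_twist)
  moreover have "j = nat \<lfloor>t - 1\<rfloor>" using Suc.hyps(2) t by simp
  moreover have "t - 1 \<in> {0..real n + 1}" using t Suc.prems(2) by simp
  ultimately obtain p k where "p \<in> strip" "D p = ivec ((twist v ^^ k) (twist v u))"
    using Suc.hyps(1) by blast
  then have "D p = ivec ((twist v ^^ Suc k) u)" by (simp add: funpow_swap1)
  then show ?case using \<open>p \<in> strip\<close> by blast
qed

lemma countable_fibre_P: "countable {p. P p = z}"
proof (cases "\<exists>x t. P (x, t) = z")
  case True
  then obtain x t where "P (x, t) = z" by blast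
  have "{p. P p = z} \<subseteq> (\<lambda>m. (x + ivec m, t)) ` UNIV \<union> (\<lambda>m. (rmat A *v x + ivec m, 0)) ` UNIV
      \<union> (\<lambda>m. (rmat B *v x + ivec m, 1)) ` UNIV"
  proof
    fix p assume "p \<in> {p. P p = z}"
    then have "P (x, t) = P (fst p, snd p)" using \<open>P (x, t) = z\<close> by simp
    then have "(\<exists>m. p = (x + ivec m, t)) \<or> (\<exists>m. p = (rmat A *v x + ivec m, 0)) \<or> (\<exists>m. p = (rmat B *v x + ivec m, 1))"
      unfolding P_eq_iff prod_eq_iff by auto
    then show "p \<in> (\<lambda>m. (x + ivec m, t)) ` UNIV \<union> (\<lambda>m. (rmat A *v x + ivec m, 0)) ` UNIV
      \<union> (\<lambda>m. (rmat B *v x + ivec m, 1)) ` UNIV" by fast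
  qed
  then show ?thesis by (rule countable_subset) auto
next
  case False
  then have "{p. P p = z} = {}" by fastforce
  then show ?thesis by (metis countable_empty)
qed

text \<open>A point of the bundle has countably many preimages in the strip, and each further turn
  adds at most a copy of what was there before. Hence uncountably many integral points of
  \<open>E\<close> force infinitely many coincidences.\<close>

lemma countable_extension_zeros:
  assumes "\<And>x t. t \<in> {0..1} \<Longrightarrow> E (x, t) = D (x, t)"
    and E: "\<And>x t. t \<in> {0..real n} \<Longrightarrow> E (rmat A *v x, t) = rmat A *v (E (x, t + 1) - ivec v)"
    and fin: "finite (zeros D)"
  shows "countable {p \<in> UNIV \<times> {0..real n + 1}. E p \<in> range ivec}"
proof -
  have "countable {p \<in> UNIV \<times> {0..real k + 1}. E p \<in> range ivec}" if "k \<le> n" for k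
    using that
  proof (induction k)
    case 0
    have "{p \<in> UNIV \<times> {0..real 0 + 1}. E p \<in> range ivec} \<subseteq> (\<Union>z\<in>zeros D. {p. P p = z})"
      using assms(1) by (auto simp: zeros_def)
    then show ?case
      by (rule countable_subset) (intro countable_UN countable_fibre_P countable_finite fin)
  next
    case (Suc k)
    define Q where "Q = {p \<in> (UNIV :: (real^2) set) \<times> {0..real k + 1}. E p \<in> range ivec}"
    have Q: "countable Q" using Suc by (simp add: Q_def)
    have "{p \<in> UNIV \<times> {0..real (Suc k) + 1}. E p \<in> range ivec} \<subseteq> Q \<union> (\<lambda>p. (rmat B *v fst p, snd p + 1)) ` Q"
    proof
      fix p assume p: "p \<in> {p \<in> (UNIV :: (real^2) set) \<times> {0..real (Suc k) + 1}. E p \<in> range ivec}"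
      obtain x t where xt: "p = (x, t)" by force
      show "p \<in> Q \<union> (\<lambda>p. (rmat B *v fst p, snd p + 1)) ` Q"
      proof (cases "t \<le> real k + 1")
        case True
        then show ?thesis using p xt by (auto simp: Q_def)
      next
        case False
        obtain u where "E (x, t) = ivec u" using p xt by auto
        then have "E (rmat A *v x, t - 1) = ivec (twist v u)"
          using E[of "t - 1" x] False p xt Suc.prems by (simp add: ivec_twist)
        then have "(rmat A *v x, t - 1) \<in> Q" using False p xt by (auto simp: Q_def)
        then show ?thesis using xt by (auto simp: image_iff intro!: bexI[of _ "(rmat A *v x, t - 1)"])
      qed
    qed
    then show ?case by (rule countable_subset) (use Q in auto)
  qed
  from this[of n] show ?thesis by simp
qed

end

section \<open>Bounds for periodic functions and a planar intermediate value theorem\<close>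

lemma periodic_bounded:
  fixes h :: "(real ^ 2) \<times> real \<Rightarrow> 'a::real_normed_vector"
  assumes c: "continuous_on (UNIV \<times> {a..b}) h"
    and per: "\<And>x t m. t \<in> {a..b} \<Longrightarrow> h (x + ivec m, t) = h (x, t)"
  obtains K where "K > 0" "\<And>x t. t \<in> {a..b} \<Longrightarrow> norm (h (x, t)) \<le> K"
proof -
  have "compact (h ` (cbox 0 1 \<times> {a..b}))"
    by (intro compact_continuous_image continuous_on_subset[OF c] compact_Times) auto
  then obtain K where K: "K > 0" "\<And>p. p \<in> cbox 0 1 \<times> {a..b} \<Longrightarrow> norm (h p) \<le> K"
    using compact_imp_bounded bounded_pos by (metis imageI)
  show thesis
  proof (rule that[OF K(1)])
    fix x :: "real ^ 2" and t :: real assume t: "t \<in> {a..b}"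
    define m :: "int ^ 2" where "m = (\<chi> i. \<lfloor>x $ i\<rfloor>)"
    have "x - ivec m \<in> cbox 0 1"
      by (auto simp: m_def mem_box_cart) linarith
    then have "norm (h (x - ivec m, t)) \<le> K" using K(2) t by auto
    then show "norm (h (x, t)) \<le> K" using per[OF t, of "x - ivec m" m] by simp
  qed
qed

text \<open>Brouwer's theorem for p - (f p, g p), clamped to the rectangle. At a fixed point the
  clamp can act only on an edge, and there the sign condition makes the component vanish all the
  same.\<close>

lemma poincare_miranda:
  fixes f g :: "real \<times> real \<Rightarrow> real"
  assumes ab: "a \<le> b" "c \<le> d"
    and cont: "continuous_on ({a..b} \<times> {c..d}) f" "continuous_on ({a..b} \<times> {c..d}) g"
    and f: "\<And>t. t \<in> {c..d} \<Longrightarrow> f (a, t) \<le> 0 \<and> 0 \<le> f (b, t)"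
    and g: "\<And>s. s \<in> {a..b} \<Longrightarrow> g (s, c) \<le> 0 \<and> 0 \<le> g (s, d)"
  obtains s t where "s \<in> {a..b}" "t \<in> {c..d}" "f (s, t) = 0" "g (s, t) = 0"
proof -
  let ?S = "{a..b} \<times> {c..d}"
  define h where "h p = (max a (min b (fst p - f p)), max c (min d (snd p - g p)))" for p
  have "continuous_on ?S h"
    unfolding h_def by (intro continuous_intros cont)
  moreover have "h \<in> ?S \<rightarrow> ?S" using ab by (auto simp: h_def)
  moreover have "compact ?S" "convex ?S" "?S \<noteq> {}" using ab by (auto intro: compact_Times convex_Times)
  ultimately obtain p where p: "p \<in> ?S" "h p = p" using brouwer[of ?S h] by blast
  obtain s t where st: "p = (s, t)" by force
  have s: "s \<in> {a..b}" and t: "t \<in> {c..d}" using p st by auto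
  have hs: "max a (min b (s - f (s, t))) = s" and ht: "max c (min d (t - g (s, t))) = t"
    using p(2) by (auto simp: h_def st)
  have "f (s, t) = 0"
  proof -
    have "s = a \<Longrightarrow> f (s, t) \<le> 0" "s = b \<Longrightarrow> f (s, t) \<ge> 0" using f[OF t] by auto
    then show ?thesis using hs s by (auto simp: max_def min_def split: if_splits)
  qed
  moreover have "g (s, t) = 0"
  proof -
    have "t = c \<Longrightarrow> g (s, t) \<le> 0" "t = d \<Longrightarrow> g (s, t) \<ge> 0" using g[OF s] by auto
    then show ?thesis using ht t by (auto simp: max_def min_def split: if_splits)
  qed
  ultimately show thesis using that s t by blast
qed

section \<open>Orbits\<close>

lemma constant_int_valued:
  fixes f :: "'a::topological_space \<Rightarrow> real"
  assumes "connected S" "continuous_on S f" "\<And>x. x \<in> S \<Longrightarrow> f x \<in> \<int>"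
  obtains n :: int where "\<And>x. x \<in> S \<Longrightarrow> f x = of_int n"
proof -
  have "continuous_on S (\<lambda>x. f x *\<^sub>R (axis 1 1 :: real ^ 2))" by (intro continuous_intros assms(2))
  moreover have "f x *\<^sub>R (axis 1 1 :: real ^ 2) \<in> range ivec" if x: "x \<in> S" for x
  proof -
    obtain k where "f x = of_int k" using assms(3)[OF x] by (auto elim: Ints_cases)
    then have "f x *\<^sub>R (axis 1 1 :: real ^ 2) = ivec (k *s axis 1 1)"
      by (simp add: vec_eq_iff axis_def)
    then show ?thesis by blast
  qed
  ultimately obtain m where m: "\<And>x. x \<in> S \<Longrightarrow> f x *\<^sub>R (axis 1 1 :: real ^ 2) = ivec m"
    using constant_ivec[OF assms(1)] by blast
  have "f x = of_int (m $ 1)" if "x \<in> S" for x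
    using arg_cong[OF m[OF that], of "\<lambda>y. y $ 1"] by simp
  then show ?thesis using that by blast
qed

text \<open>Along a horizontal line the argument of \<open>z\<close> changes by an odd multiple of \<open>\<pi>\<close>, which is
  independent of the height; a seam reversing its sign is impossible.\<close>

lemma no_reversing_seam:
  fixes z :: "real \<times> real \<Rightarrow> complex"
  assumes c: "continuous_on (UNIV \<times> {0..k}) z" and nz: "\<And>p. p \<in> UNIV \<times> {0..k} \<Longrightarrow> z p \<noteq> 0"
    and k: "0 \<le> k"
    and pos: "\<And>s t. t \<in> {0..k} \<Longrightarrow> s \<ge> S \<Longrightarrow> Re (z (s, t)) > 0"
    and neg: "\<And>s t. t \<in> {0..k} \<Longrightarrow> s \<le> - S \<Longrightarrow> Re (z (s, t)) < 0"
    and seam: "(\<forall>s. z (s + s0, 0) = cnj (z (s, k))) \<or> (\<forall>s. z (- s + s0, 0) = - z (s, k))"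
  shows False
proof -
  have cv: "convex ((UNIV :: real set) \<times> {0..k})" by (intro convex_Times) auto
  obtain g where gc: "continuous_on (UNIV \<times> {0..k}) g" and g: "\<And>p. p \<in> UNIV \<times> {0..k} \<Longrightarrow> z p = exp (g p)"
    using continuous_logarithm_on_contractible[OF c convex_imp_contractible[OF cv] nz] by blast
  define th where "th p = Im (g p)" for p
  have thc: "continuous_on (UNIV \<times> {0..k}) th" unfolding th_def by (intro continuous_intros gc)
  have z_polar: "z p = of_real (exp (Re (g p))) * cis (th p)" if "p \<in> UNIV \<times> {0..k}" for p
    using g[OF that] by (simp add: exp_eq_polar th_def)
  \<comment> \<open>Where \<open>z\<close> stays in the open half plane around the direction
    \<open>r\<close>, the lifted angle \<open>th\<close> stays within pi / 2 of a single
    representative of \<open>r\<close> modulo 2 pi.\<close>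
  have branch: "\<exists>n::int. \<forall>p\<in>T. \<bar>th p - r - 2 * pi * n\<bar> < pi / 2"
    if T: "T \<subseteq> UNIV \<times> {0..k}" "connected T" and r: "\<And>p. p \<in> T \<Longrightarrow> Re (z p * cis (- r)) > 0" for T r
  proof -
    define q where "q p = Im (Ln (z p * cis (- r)))" for p
    have nonpos: "z p * cis (- r) \<notin> \<real>\<^sub>\<le>\<^sub>0" if "p \<in> T" for p
      using r[OF that] by (auto simp: complex_nonpos_Reals_iff)
    have q: "\<bar>q p\<bar> < pi / 2" if p: "p \<in> T" for p
    proof -
      have "z p * cis (- r) \<noteq> 0" using r[OF p] by force
      then show ?thesis using r[OF p] Re_Ln_pos_lt unfolding q_def by blast
    qed
    have "continuous_on T (\<lambda>p. (th p - r - q p) / (2 * pi))"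
      unfolding q_def
      by (intro continuous_intros continuous_on_subset[OF thc T(1)] continuous_on_subset[OF c T(1)] nonpos) auto
    moreover have "(th p - r - q p) / (2 * pi) \<in> \<int>" if p: "p \<in> T" for p
    proof -
      have ne: "z p * cis (- r) \<noteq> 0" using r[OF p] by force
      have pI: "p \<in> UNIV \<times> {0..k}" using p T(1) by blast
      have "exp (g p + \<i> * (- r)) = exp (Ln (z p * cis (- r)))"
        using exp_Ln[OF ne] g[OF pI] by (simp add: cis_conv_exp flip: exp_add)
      then obtain n :: int where "g p + \<i> * (- r) = Ln (z p * cis (- r)) + (of_int (2 * n) * pi) * \<i>"
        using exp_eq by metis
      then have "th p - r - q p = 2 * pi * n"
        by (simp add: complex_eq_iff th_def q_def)
      then show ?thesis by simp
    qed
    ultimately obtain n :: int where "\<And>p. p \<in> T \<Longrightarrow> (th p - r - q p) / (2 * pi) = of_int n"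
      using constant_int_valued[OF T(2)] by blast
    then have "\<And>p. p \<in> T \<Longrightarrow> th p - r - 2 * pi * n = q p" by (simp add: field_simps)
    then show ?thesis using q by (intro exI[of _ n]) simp
  qed
  have cR: "connected ({S..} \<times> {0..k})" and cL: "connected ({..-S} \<times> {0..k})"
    by (intro convex_connected convex_Times; simp)+
  have "\<exists>n::int. \<forall>p\<in>{S..} \<times> {0..k}. \<bar>th p - 0 - 2 * pi * n\<bar> < pi / 2"
    by (rule branch[OF _ cR]) (use pos in auto)
  then obtain n :: int where n: "\<And>p. p \<in> {S..} \<times> {0..k} \<Longrightarrow> \<bar>th p - 2 * pi * n\<bar> < pi / 2" by auto
  have "\<exists>j::int. \<forall>p\<in>{..-S} \<times> {0..k}. \<bar>th p - pi - 2 * pi * j\<bar> < pi / 2"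
    by (rule branch[OF _ cL]) (use neg in auto)
  then obtain j :: int where j: "\<And>p. p \<in> {..-S} \<times> {0..k} \<Longrightarrow> \<bar>th p - pi - 2 * pi * j\<bar> < pi / 2" by blast
  \<comment> \<open>Far enough out that \<open>b\<close> and \<open>- b\<close> remain beyond the
    threshold \<open>S\<close> after the shift by \<open>s0\<close>.\<close>
  define b where "b = \<bar>S\<bar> + \<bar>s0\<bar>"
  have nb: "\<bar>th (b + s0, 0) - 2 * pi * n\<bar> < pi / 2" "\<bar>th (b, k) - 2 * pi * n\<bar> < pi / 2"
    and jb: "\<bar>th (- b + s0, 0) - pi - 2 * pi * j\<bar> < pi / 2" "\<bar>th (- b, k) - pi - 2 * pi * j\<bar> < pi / 2"
    using k by (intro n j; auto simp: b_def)+
  have lines: "continuous_on UNIV (\<lambda>s. th (s + s0, 0))" "continuous_on UNIV (\<lambda>s. th (- s + s0, 0))"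
    "continuous_on UNIV (\<lambda>s. th (s, k))"
    using k by (auto intro!: continuous_on_compose2[OF thc] continuous_intros)
  have mod_2pi: "\<exists>N::int. x - y = 2 * pi * N" if "cis x = cis y" for x y :: real
  proof -
    have "exp (\<i> * x) = exp (\<i> * y)" using that by (simp add: cis_conv_exp)
    then obtain N :: int where "\<i> * x = \<i> * y + (of_int (2 * N) * pi) * \<i>" using exp_eq by metis
    then have "x - y = 2 * pi * N" by (simp add: complex_eq_iff)
    then show ?thesis ..
  qed
  have sgn_eq: "cis (th p) = w / cmod w" if "p \<in> UNIV \<times> {0..k}" "z p = w" for p w
    using z_polar[OF that(1)] that(2) by (simp add: norm_mult)
  from seam show False
  proof
    assume s: "\<forall>s. z (s + s0, 0) = cnj (z (s, k))"
    have "(th (s + s0, 0) + th (s, k)) / (2 * pi) \<in> \<int>" for s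
    proof -
      have "cis (th (s + s0, 0)) = cnj (cis (th (s, k)))"
        using sgn_eq[of "(s + s0, 0)" "cnj (z (s, k))"] sgn_eq[of "(s, k)" "z (s, k)"] s k by simp
      then have "cis (th (s + s0, 0)) = cis (- th (s, k))" by (simp add: cis_cnj)
      then obtain N :: int where "th (s + s0, 0) + th (s, k) = 2 * pi * N" using mod_2pi by force
      then show ?thesis by simp
    qed
    moreover have "continuous_on UNIV (\<lambda>s. (th (s + s0, 0) + th (s, k)) / (2 * pi))"
      by (intro continuous_intros lines) auto
    ultimately obtain N :: int where N: "\<And>s. (th (s + s0, 0) + th (s, k)) / (2 * pi) = of_int N"
      using constant_int_valued[of UNIV "\<lambda>s. (th (s + s0, 0) + th (s, k)) / (2 * pi)"] by auto
    have N: "th (s + s0, 0) + th (s, k) = 2 * pi * N" for s using N[of s] by (simp add: field_simps)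
    \<comment> \<open>Each angle has an error below pi / 2, so the sum of two is known up to pi. The
      right end shows that \<open>N\<close> is even, the left end that it is odd.\<close>
    have "\<bar>pi * (2 * N - 4 * n)\<bar> < pi * 1"
    proof -
      have "pi * (2 * N - 4 * n) = (th (b + s0, 0) - 2 * pi * n) + (th (b, k) - 2 * pi * n)"
        using N[of "b"] by (simp add: algebra_simps)
      then show ?thesis using nb jb unfolding abs_less_iff by linarith
    qed
    then have "\<bar>real_of_int (2 * N - 4 * n)\<bar> < 1" unfolding abs_mult by simp
    moreover have "\<bar>pi * (2 * N - 4 * j - 2)\<bar> < pi * 1"
    proof -
      have "pi * (2 * N - 4 * j - 2) = (th (- b + s0, 0) - pi - 2 * pi * j) + (th (- b, k) - pi - 2 * pi * j)"
        using N[of "- b"] by (simp add: algebra_simps)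
      then show ?thesis using nb jb unfolding abs_less_iff by linarith
    qed
    then have "\<bar>real_of_int (2 * N - 4 * j - 2)\<bar> < 1" unfolding abs_mult by simp
    ultimately have "2 * N - 4 * n = 0" "2 * N - 4 * j - 2 = 0" by linarith+
    then show False by presburger
  next
    assume s: "\<forall>s. z (- s + s0, 0) = - z (s, k)"
    have "(th (- s + s0, 0) - th (s, k) - pi) / (2 * pi) \<in> \<int>" for s
    proof -
      have "cis (th (- s + s0, 0)) = - cis (th (s, k))"
        using sgn_eq[of "(- s + s0, 0)" "- z (s, k)"] sgn_eq[of "(s, k)" "z (s, k)"] s k by simp
      then have "cis (th (- s + s0, 0)) = cis (th (s, k) + pi)" by (simp flip: cis_mult)
      then obtain N :: int where "th (- s + s0, 0) - (th (s, k) + pi) = 2 * pi * N" using mod_2pi by blast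
      then have "th (- s + s0, 0) - th (s, k) - pi = 2 * pi * N" by simp
      then show ?thesis by simp
    qed
    moreover have "continuous_on UNIV (\<lambda>s. (th (- s + s0, 0) - th (s, k) - pi) / (2 * pi))"
      by (intro continuous_intros lines) auto
    ultimately obtain N :: int where N: "\<And>s. (th (- s + s0, 0) - th (s, k) - pi) / (2 * pi) = of_int N"
      using constant_int_valued[of UNIV "\<lambda>s. (th (- s + s0, 0) - th (s, k) - pi) / (2 * pi)"] by auto
    have N: "th (- s + s0, 0) - th (s, k) - pi = 2 * pi * N" for s using N[of s] by (simp add: field_simps)
    \<comment> \<open>The seam now exchanges the two ends. One comparison gives N = j - n, the other
      N = n - j - 1, so 2 N would be -1.\<close>
    have "\<bar>pi * (2 * j - 2 * n - 2 * N)\<bar> < pi * 1"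
    proof -
      have "pi * (2 * j - 2 * n - 2 * N) = (th (b, k) - 2 * pi * n) - (th (- b + s0, 0) - pi - 2 * pi * j)"
        using N[of "b"] by (simp add: algebra_simps)
      then show ?thesis using nb jb unfolding abs_less_iff by linarith
    qed
    then have "\<bar>real_of_int (2 * j - 2 * n - 2 * N)\<bar> < 1" unfolding abs_mult by simp
    moreover have "\<bar>pi * (2 * n - 2 * j - 2 - 2 * N)\<bar> < pi * 1"
    proof -
      have "pi * (2 * n - 2 * j - 2 - 2 * N) = (th (- b, k) - pi - 2 * pi * j) - (th (b + s0, 0) - 2 * pi * n)"
        using N[of "- b"] by (simp add: algebra_simps)
      then show ?thesis using nb jb unfolding abs_less_iff by linarith
    qed
    then have "\<bar>real_of_int (2 * n - 2 * j - 2 - 2 * N)\<bar> < 1" unfolding abs_mult by simp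
    ultimately have "2 * j - 2 * n - 2 * N = 0" "2 * n - 2 * j - 2 - 2 * N = 0" by linarith+
    then show False by presburger
  qed
qed

lemma INF_enat_eq_infinity: "(\<And>x. x \<in> S \<Longrightarrow> f x = \<infinity>) \<Longrightarrow> (INF x\<in>S. f x) = (\<infinity> :: enat)"
  by (metis INF_greatest enat_ord_code(3) order_antisym order_refl)

lemma INF_enat_eq:
  fixes f :: "'a \<Rightarrow> enat"
  assumes "x \<in> S" "f x \<le> c" "\<And>y. y \<in> S \<Longrightarrow> c \<le> f y"
  shows "(INF x\<in>S. f x) = c"
  using assms by (meson INF_greatest INF_lower2 order_antisym)

section \<open>The orbit relation on the lattice\<close>

context gluing
begin

text \<open>Orbits of \<open>beta\<close> pulled back to the lattice. The alternative takes the
  place of negative iterates.\<close>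

definition orb :: "int ^ 2 ^ 2 \<Rightarrow> int ^ 2 \<Rightarrow> int ^ 2 \<Rightarrow> int ^ 2 \<Rightarrow> bool" where
  "orb L v u w \<longleftrightarrow> (\<exists>n m. (twist v ^^ n) u = w + L *v m \<or> (twist v ^^ n) w = u + L *v m)"

lemma twist_funpow_translate:
  assumes "equivariant L v D"
  obtains k where "\<And>u. (twist v ^^ n) (u + L *v m) = (twist v ^^ n) u + L *v k"
proof -
  have "\<exists>k. \<forall>u. (twist v ^^ n) (u + L *v m) = (twist v ^^ n) u + L *v k"
  proof (induction n)
    case 0 then show ?case by auto
  next
    case (Suc n)
    then obtain k where "\<And>u. (twist v ^^ n) (u + L *v m) = (twist v ^^ n) u + L *v k" by blast
    then show ?case using twist_translate[OF assms, of _ k] by auto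
  qed
  then show ?thesis using that by blast
qed

lemma twist_cancel:
  assumes D: "equivariant L v D" and eq: "(twist v ^^ n) u = (twist v ^^ n) w + L *v m"
  shows "\<exists>k. u = w + L *v k"
  using eq
proof (induction n arbitrary: m)
  case (Suc n)
  have "twist v ((twist v ^^ n) u) = twist v ((twist v ^^ n) w) + L *v (A *v (B *v m))"
    using Suc.prems by simp
  also have "\<dots> = twist v ((twist v ^^ n) w + L *v (B *v m))" by (simp only: twist_translate[OF D])
  finally have "B *v twist v ((twist v ^^ n) u) = B *v twist v ((twist v ^^ n) w + L *v (B *v m))" by simp
  then have "(twist v ^^ n) u = (twist v ^^ n) w + L *v (B *v m)" by (simp add: twist_def)
  then show ?case by (rule Suc.IH)
qed auto

lemma orb_refl: "orb L v u u"
  unfolding orb_def by (rule exI[of _ 0], rule exI[of _ 0]) simp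

lemma orb_sym: "orb L v u w \<Longrightarrow> orb L v w u"
  unfolding orb_def by blast

text \<open>Each link may run forwards or backwards. Links in one direction compose, since an
  iterate carries translates to translates; for links with a common end or a common start the
  shorter iterate is split off from the longer one, which for a common end uses that the twist is
  injective modulo the image of \<open>L\<close>.\<close>

lemma orb_trans:
  assumes D: "equivariant L v D" and uw: "orb L v u w" and wz: "orb L v w z"
  shows "orb L v u z"
proof -
  let ?T = "twist v"
  have fwd: "orb L v u z" if "(?T ^^ n) u = w + L *v m" "(?T ^^ k) w = z + L *v j" for u w z n m k j
  proof -
    obtain i where "(?T ^^ k) (w + L *v m) = (?T ^^ k) w + L *v i"
      using twist_funpow_translate[OF D] by metis
    then have "(?T ^^ (k + n)) u = z + L *v (j + i)"
      using that by (simp add: funpow_add matrix_vector_right_distrib)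
    then show ?thesis unfolding orb_def by blast
  qed
  have meet: "orb L v u z" if "(?T ^^ n) u = w + L *v m" "(?T ^^ k) z = w + L *v j" for u w z n m k j
  proof -
    have "orb L v a b" if le: "n \<le> k" and a: "(?T ^^ n) a = w + L *v m" and b: "(?T ^^ k) b = w + L *v j" for a b n k m j
    proof -
      have "(?T ^^ n) ((?T ^^ (k - n)) b) = (?T ^^ k) b"
        using le by (metis add_diff_inverse_nat comp_apply funpow_add not_less)
      also have "\<dots> = (?T ^^ n) a + L *v (j - m)"
        using a b by (simp add: matrix_vector_mult_diff_distrib)
      finally obtain i where "(?T ^^ (k - n)) b = a + L *v i" using twist_cancel[OF D] by blast
      then show ?thesis unfolding orb_def by blast
    qed
    from this[of n k u m z j] this[of k n z j u m] that show ?thesis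
      using orb_sym by (metis nat_le_linear)
  qed
  have split: "orb L v u z" if "(?T ^^ n) w = u + L *v m" "(?T ^^ k) w = z + L *v j" for u w z n m k j
  proof -
    have "orb L v a b" if le: "n \<le> k" and a: "(?T ^^ n) w = a + L *v m" and b: "(?T ^^ k) w = b + L *v j" for a b n k m j
    proof -
      obtain i where "(?T ^^ (k - n)) (a + L *v m) = (?T ^^ (k - n)) a + L *v i"
        using twist_funpow_translate[OF D] by metis
      moreover have "(?T ^^ k) w = (?T ^^ (k - n)) ((?T ^^ n) w)"
        using le by (metis comp_apply funpow_add le_add_diff_inverse2)
      ultimately have "(?T ^^ (k - n)) a = b + L *v (j - i)"
        using a b by (simp add: matrix_vector_mult_diff_distrib algebra_simps)
      then show ?thesis unfolding orb_def by blast
    qed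
    from this[of n k u m z j] this[of k n z j u m] that show ?thesis
      using orb_sym by (metis nat_le_linear)
  qed
  from uw wz show ?thesis
    unfolding orb_def[of L v u w] orb_def[of L v w z] using fwd meet split orb_sym by metis
qed

lemma orb_class_eq_iff:
  assumes D: "equivariant L v D"
  shows "{x. orb L v u x} = {x. orb L v w x} \<longleftrightarrow> orb L v u w"
  using orb_refl orb_sym orb_trans[OF D] by blast

lemma orb_translate: "orb L v (u + L *v m) u"
  unfolding orb_def by (rule exI[of _ 0]) auto

lemma orb_twist: "orb L v (twist v u) u"
  unfolding orb_def by (rule exI[of _ 1], rule exI[of _ 0]) simp

lemma orb_twist_funpow: "orb L v ((twist v ^^ n) u) u"
  unfolding orb_def by (rule exI[of _ n], rule exI[of _ 0]) simp

lemma components_ge_orbits: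
  assumes D: "equivariant L v D" and R: "finite R" "\<And>r s. r \<in> R \<Longrightarrow> s \<in> R \<Longrightarrow> orb L v r s \<Longrightarrow> r = s"
    and att: "\<And>r. r \<in> R \<Longrightarrow> \<exists>p\<in>strip. \<exists>u. D p = ivec u \<and> orb L v u r"
  shows "enat (card R) \<le> ecount (path_components_of (coincidence_space D))"
proof (rule components_ge[OF D, where lab = "\<lambda>u. {x. orb L v u x}"])
  show "inj_on (\<lambda>u. {x. orb L v u x}) R"
    using R(2) unfolding inj_on_def orb_class_eq_iff[OF D] by blast
qed (use R(1) att in \<open>auto simp only: orb_class_eq_iff[OF D] orb_translate orb_twist\<close>)

text \<open>If every nonempty level reaches time 1, it can be carried across the seam again and
  again, so all levels of an orbit lie in one path component. The linear model with a drift lacks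
  this property and is counted directly.\<close>

lemma components_le_orbits:
  assumes D: "equivariant L v D" and pc: "\<And>u. path_connected (level D u)"
    and full: "\<And>u. level D u \<noteq> {} \<Longrightarrow> \<exists>x. (x, 1) \<in> level D u"
    and R: "finite R" "\<And>u. level D u \<noteq> {} \<Longrightarrow> \<exists>r\<in>R. orb L v u r \<and> level D r \<noteq> {}"
  shows "ecount (path_components_of (coincidence_space D)) \<le> enat (card R)"
proof (rule components_le[OF R(1)])
  have tw: "joined D u ((twist v ^^ n) u) \<and> level D ((twist v ^^ n) u) \<noteq> {}" if "level D u \<noteq> {}" for u n
  proof (induction n)
    case 0 then show ?case using that joined_refl[OF pc] by simp
  next
    case (Suc n)
    then obtain x where "(x, 1) \<in> level D ((twist v ^^ n) u)" using full by blast
    note tw = joined_twist[OF D pc this]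
    have "joined D u (twist v ((twist v ^^ n) u))"
      using joined_trans[OF _ tw(1)] Suc by blast
    then show ?case using tw(2) by simp
  qed
  have one: "joined D u w" if "level D u \<noteq> {}" "level D w \<noteq> {}" "(twist v ^^ n) u = w + L *v m" for u w n m
  proof -
    have t: "joined D w (w + L *v m)" "level D (w + L *v m) \<noteq> {}"
      by (rule joined_translate[OF D pc that(2)])+
    show ?thesis
      by (rule joined_trans[OF _ joined_sym[OF t(1)] t(2)]) (use tw[OF that(1), of n] that(3) in simp)
  qed
  fix u assume u: "level D u \<noteq> {}"
  then obtain r where r: "r \<in> R" "orb L v u r" "level D r \<noteq> {}" using R(2) by blast
  from r(2) obtain n m where "(twist v ^^ n) u = r + L *v m \<or> (twist v ^^ n) r = u + L *v m"
    unfolding orb_def by blast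
  then have "joined D u r"
    using one[OF u r(3)] joined_sym[OF one[OF r(3) u]] by metis
  then show "\<exists>r\<in>R. joined D u r \<and> level D r \<noteq> {}" using r(1,3) by blast
qed

text \<open>The simplest admissible map: the term t v has grown to \<open>v\<close> at time 1, where
  the gluing subtracts it.\<close>

lemma equivariant_linear:
  assumes comm: "\<And>m. A *v (L *v m) = L *v (A *v m)"
  shows "equivariant L v (\<lambda>p. rmat L *v fst p + snd p *\<^sub>R ivec v)"
proof -
  have "A ** L = L ** A" by (simp add: matrix_eq comm flip: matrix_vector_mul_assoc)
  then have "rmat A *v (rmat L *v x) = rmat L *v (rmat A *v x)" for x
    by (simp add: matrix_vector_mul_assoc flip: rmat_mult)
  then show ?thesis
    by (auto simp: equivariant_def matrix_vector_right_distrib intro!: continuous_intros)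
qed

end

section \<open>Fibrewise nonsingular and trivial cases\<close>

lemma sum_vec_2: "(L *v m) $ i = L $ i $ 1 * m $ 1 + L $ i $ 2 * m $ (2::2)"
  by (simp add: matrix_vector_mult_def sum_2)

context gluing
begin

text \<open>On a fibre \<open>D\<close> is \<open>L\<close> plus a periodic, hence bounded, map
  \<open>h\<close>. A solution of D = y is a fixed point of x -> M (y - h x) with M inverse to
  \<open>L\<close>, and this map sends the ball of radius \<open>r\<close> into itself.\<close>

lemma surjective_on_fibre:
  assumes D: "equivariant L v D" and det: "det L \<noteq> 0" and t: "t \<in> {0..1}"
  obtains x where "D (x, t) = y"
proof -
  define h where "h p = D p - rmat L *v fst p" for p
  have Dc: "continuous_on strip D" using D by (simp add: equivariant_def)
  have hc: "continuous_on strip h" unfolding h_def by (intro continuous_intros Dc)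
  have "h (x + ivec m, t) = h (x, t)" if "t \<in> {0..1}" for x t m
    using equivariant_translate[OF D that] by (simp add: h_def matrix_vector_right_distrib)
  from periodic_bounded[OF hc this] obtain K where K: "K > 0" "\<And>x t. t \<in> {0..1} \<Longrightarrow> norm (h (x, t)) \<le> K"
    by blast
  have "invertible (rmat L)" using det by (simp add: invertible_det_nz det_rmat)
  then obtain M where M: "rmat L ** M = mat 1" unfolding invertible_def by blast
  obtain C where C: "C > 0" "\<And>z. norm (M *v z) \<le> C * norm z"
    using bounded_linear.pos_bounded[OF matrix_vector_mul_bounded_linear[of M]] by (metis mult.commute)
  define r where "r = C * (norm y + K)"
  have "continuous_on (cball 0 r) (\<lambda>x. M *v (y - h (x, t)))"
    using t by (intro bounded_linear.continuous_on[OF matrix_vector_mul_bounded_linear] continuous_intros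
        continuous_on_compose2[OF hc]) auto
  moreover have "(\<lambda>x. M *v (y - h (x, t))) \<in> cball 0 r \<rightarrow> cball 0 r"
  proof
    fix x
    have "norm (M *v (y - h (x, t))) \<le> C * norm (y - h (x, t))" by (rule C(2))
    also have "\<dots> \<le> C * (norm y + K)"
      using norm_triangle_ineq4[of y "h (x, t)"] K(2)[OF t, of x] C(1) by simp
    finally show "M *v (y - h (x, t)) \<in> cball 0 r" by (simp add: r_def)
  qed
  moreover have "0 < r" using C(1) K(1) by (simp add: r_def add_nonneg_pos)
  ultimately obtain x where "M *v (y - h (x, t)) = x"
    using brouwer_ball[of r 0 "\<lambda>x. M *v (y - h (x, t))"] by blast
  then have "rmat L *v x = (rmat L ** M) *v (y - h (x, t))"
    by (metis matrix_vector_mul_assoc)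
  then have "D (x, t) = y" by (simp add: M h_def)
  then show ?thesis by (rule that)
qed

text \<open>Each of the infinitely many fibres contains a coincidence.\<close>

lemma infinite_zeros_nonsingular:
  assumes D: "equivariant L v D" and det: "det L \<noteq> 0"
  shows "infinite (zeros D)"
proof
  assume "finite (zeros D)"
  moreover have "circle_class ` {0..<1} \<subseteq> bundle_proj ` zeros D"
  proof
    fix c assume "c \<in> circle_class ` {0..<1}"
    then obtain t where "t \<in> {0..<1}" and c: "c = circle_class t" by blast
    then have t: "t \<in> {0..1}" by simp
    obtain x where "D (x, t) = ivec 0" using surjective_on_fibre[OF D det t] by blast
    then have "P (x, t) \<in> zeros D" unfolding zeros_def using t by (intro imageI) simp
    then show "c \<in> bundle_proj ` zeros D" unfolding c by (metis bundle_proj_P image_eqI)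
  qed
  ultimately have "finite (circle_class ` {0..<1})" by (metis finite_imageI finite_subset)
  moreover have "inj_on circle_class {0..<1}" by (auto simp: inj_on_def circle_class_eq_iff)
  ultimately have "finite {0..<1::real}" by (metis finite_imageD)
  then show False using infinite_Ico[of "0::real" 1] by simp
qed

lemma path_connected_level_linear:
  "path_connected (level (\<lambda>p. rmat L *v fst p + snd p *\<^sub>R ivec v) u)"
proof -
  have lin: "linear (\<lambda>p. rmat L *v fst p + snd p *\<^sub>R ivec v)"
    by (rule linearI) (simp_all add: matrix_vector_right_distrib matrix_vector_mult_scaleR algebra_simps)
  have "level (\<lambda>p. rmat L *v fst p + snd p *\<^sub>R ivec v) u
      = strip \<inter> (\<lambda>p. rmat L *v fst p + snd p *\<^sub>R ivec v) -` {ivec u}"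
    by (auto simp: level_def)
  moreover have "convex \<dots>"
    by (intro convex_Int convex_Times convex_linear_vimage lin) auto
  ultimately have "convex (level (\<lambda>p. rmat L *v fst p + snd p *\<^sub>R ivec v) u)" by simp
  then show ?thesis by (rule convex_imp_path_connected)
qed

text \<open>Cramer's rule: \<open>m\<close> is the adjugate of \<open>L\<close> applied to
  \<open>k\<close>.\<close>

lemma multiple_of_det:
  fixes L :: "int ^ 2 ^ 2" shows "\<exists>m. L *v m = det L *s k"
proof
  show "L *v (\<chi> i. if i = 1 then L $ 2 $ 2 * k $ 1 - L $ 1 $ 2 * k $ 2 else L $ 1 $ 1 * k $ 2 - L $ 2 $ 1 * k $ 1) = det L *s k"
    by (simp add: vec_eq_iff forall_2 sum_vec_2 det_2 algebra_simps)
qed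

section \<open>The cokernel, and the minimum numbers for invertible or vanishing L\<close>

context
  fixes f F Phi L v
  assumes f: "is_lift f F" and F: "equivariant Phi v F" and L: "L = Phi - mat 1"
begin

lemma L_lattice_eq: "L_lattice A f = range ((*v) L)"
  unfolding L_lattice_def fibre_hom_eq[OF f F] L by (simp add: matrix_vector_mult_diff_rdistrib)

definition coset where "coset u = coset_rel (L_lattice A f) `` {u}"

lemma mem_coset_iff: "x \<in> coset u \<longleftrightarrow> (\<exists>m. x = u - L *v m)"
proof -
  have "x \<in> coset u \<longleftrightarrow> (\<exists>m. u - x = L *v m)"
    by (auto simp: coset_def coset_rel_def L_lattice_eq)
  moreover have "u - x = y \<longleftrightarrow> x = u - y" for y by (auto simp: algebra_simps)
  ultimately show ?thesis by simp
qed

lemma coset_eq_iff: "coset u = coset w \<longleftrightarrow> (\<exists>m. u = w + L *v m)"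
proof -
  note mem = mem_coset_iff
  have "u \<in> coset u" unfolding mem by (rule exI[of _ 0]) simp
  show ?thesis
  proof
    assume "coset u = coset w"
    then obtain m where "u = w - L *v m" using \<open>u \<in> coset u\<close> mem by blast
    then show "\<exists>m. u = w + L *v m" by (intro exI[of _ "- m"]) (simp add: vec_eq_iff sum_vec_2)
  next
    assume "\<exists>m. u = w + L *v m"
    then obtain m where u: "u = w + L *v m" by blast
    have "(\<exists>k. x = u - L *v k) \<longleftrightarrow> (\<exists>k. x = w - L *v k)" for x
    proof
      assume "\<exists>k. x = u - L *v k"
      then obtain k where "x = u - L *v k" by blast
      then show "\<exists>k. x = w - L *v k"
        by (intro exI[of _ "k - m"]) (simp add: u matrix_vector_mult_diff_distrib)
    next
      assume "\<exists>k. x = w - L *v k"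
      then obtain k where "x = w - L *v k" by blast
      then show "\<exists>k. x = u - L *v k"
        by (intro exI[of _ "k + m"]) (simp add: u matrix_vector_right_distrib)
    qed
    then show "coset u = coset w" using mem by (simp add: set_eq_iff)
  qed
qed

lemma coker_eq: "coker A f = range coset"
  by (auto simp: coker_def quotient_def coset_def)

lemma equivariant_L: "equivariant L v (\<lambda>p. F p - fst p)"
  using equivariant_diff[OF F equivariant_fst] by (simp add: L)

lemma beta_coset: "beta A f v (coset u) = coset (twist v u)"
proof -
  have "coset (twist v w) = coset (twist v u)" if w: "w \<in> coset u" for w
  proof -
    obtain m where "w = u - L *v m" using w mem_coset_iff by blast
    then have "w = u + L *v (- m)" by (simp add: vec_eq_iff sum_vec_2)
    then have "twist v w = twist v u + L *v (A *v (- m))"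
      by (simp only: twist_translate[OF equivariant_L])
    then show ?thesis unfolding coset_eq_iff by (rule exI)
  qed
  moreover have "u \<in> coset u"
    unfolding mem_coset_iff by (rule exI[of _ 0]) simp
  ultimately have "(\<lambda>w. coset (twist v w)) ` coset u = {coset (twist v u)}" by blast
  then show ?thesis by (simp add: beta_def coset_def[symmetric] twist_def)
qed

lemma beta_funpow_coset: "(beta A f v ^^ n) (coset u) = coset ((twist v ^^ n) u)"
  by (induction n) (simp_all add: beta_coset)

lemma beta_orbits_eq: "beta_orbits A f v = range (\<lambda>u. coset ` {w. orb L v u w})"
proof -
  define Rl where "Rl = {(C, D). C \<in> coker A f \<and> D \<in> coker A f \<and>
     (\<exists>n. (beta A f v ^^ n) C = D \<or> (beta A f v ^^ n) D = C)}"
  have "Rl `` {coset u} = coset ` {w. orb L v u w}" for u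
  proof -
    have "(coset u, coset w) \<in> Rl \<longleftrightarrow> orb L v u w" for w
      by (simp add: Rl_def coker_eq beta_funpow_coset coset_eq_iff orb_def) blast
    moreover have "Rl `` {coset u} \<subseteq> range coset" by (auto simp: Rl_def coker_eq)
    ultimately show ?thesis by blast
  qed
  moreover have "beta_orbits A f v = (\<lambda>C. Rl `` {C}) ` range coset"
    unfolding beta_orbits_def Rl_def[symmetric] quotient_def UNION_singleton_eq_range by (simp only: coker_eq)
  ultimately show ?thesis by (simp add: image_image)
qed

lemma coset_orb_eq_iff: "coset ` {x. orb L v u x} = coset ` {x. orb L v w x} \<longleftrightarrow> orb L v u w"
proof
  assume "coset ` {x. orb L v u x} = coset ` {x. orb L v w x}"
  moreover have "coset u \<in> coset ` {x. orb L v u x}" using orb_refl by blast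
  ultimately obtain x where x: "coset u = coset x" "orb L v w x" by blast
  then obtain m where "u = x + L *v m" using coset_eq_iff by blast
  then have "orb L v u x" using orb_translate by blast
  then show "orb L v u w" using x(2) orb_trans[OF equivariant_L] orb_sym by blast
next
  assume "orb L v u w"
  then have "{x. orb L v u x} = {x. orb L v w x}" by (simp add: orb_class_eq_iff[OF equivariant_L])
  then show "coset ` {x. orb L v u x} = coset ` {x. orb L v w x}" by simp
qed

text \<open>The image of \<open>L\<close> contains all multiples of \<open>det L\<close>, so the
  vectors with entries reduced modulo the absolute value of the determinant represent every
  coset.\<close>

lemma finite_coker:
  assumes det: "det L \<noteq> 0" shows "finite (range coset)"
proof -
  define d where "d = \<bar>det L\<bar>"
  define S where "S = (\<lambda>(a, b). (\<chi> i. if i = 1 then a else b) :: int ^ 2) ` ({0..<d} \<times> {0..<d})"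
  have "coset u \<in> coset ` S" for u
  proof -
    define w :: "int ^ 2" where "w = (\<chi> i. if i = 1 then u $ 1 mod d else u $ 2 mod d)"
    have "d > 0" using det by (simp add: d_def)
    then have "w \<in> S" unfolding S_def w_def by (intro image_eqI[of _ _ "(u $ 1 mod d, u $ 2 mod d)"]) auto
    define k :: "int ^ 2" where "k = (\<chi> i. sgn (det L) * (u $ i div d))"
    have sd: "det L * sgn (det L) = d" by (simp add: d_def abs_sgn mult.commute)
    have "u = w + det L *s k"
      by (simp add: vec_eq_iff forall_2 w_def k_def sd flip: mult.assoc)
    then have "coset u = coset w"
      using multiple_of_det[of L k] coset_eq_iff by metis
    then show ?thesis using \<open>w \<in> S\<close> by blast
  qed
  then have "range coset \<subseteq> coset ` S" by blast
  moreover have "finite (coset ` S)" by (simp add: S_def)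
  ultimately show ?thesis by (rule finite_subset)
qed

text \<open>Every map attains every lattice value in each fibre, so no orbit can be avoided. In the
  linear model the levels are convex, and surjectivity on the fibre at time 1 lets each of them
  cross the seam, so each orbit gives one component.\<close>

lemma MCC_nonsingular:
  assumes det: "det L \<noteq> 0"
  shows "finite (beta_orbits A f v)" "MCC A f id = enat (card (beta_orbits A f v))"
proof -
  define lab where "lab u = coset ` {w. orb L v u w}" for u
  have orbits: "beta_orbits A f v = range lab" by (simp add: beta_orbits_eq lab_def)
  have lab_eq: "lab u = lab w \<longleftrightarrow> orb L v u w" for u w
    unfolding lab_def by (rule coset_orb_eq_iff)
  show fin: "finite (beta_orbits A f v)"
    unfolding beta_orbits_def quotient_def UNION_singleton_eq_range
    by (rule finite_imageI) (use finite_coker[OF det] in \<open>simp only: coker_eq\<close>)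
  define R where "R = inv_into UNIV lab ` range lab"
  have R: "finite R" "card R = card (range lab)"
    using fin by (auto simp: R_def orbits card_image inj_on_inv_into)
  have rep: "\<exists>r\<in>R. orb L v u r" for u
  proof -
    have "lab (inv_into UNIV lab (lab u)) = lab u" by (simp add: f_inv_into_f)
    then have "orb L v u (inv_into UNIV lab (lab u))"
      unfolding lab_eq by (rule orb_sym)
    then show ?thesis unfolding R_def by (intro bexI[of _ "inv_into UNIV lab (lab u)"]) auto
  qed
  have unique: "r = s" if "r \<in> R" "s \<in> R" "orb L v r s" for r s
  proof -
    have "lab r = lab s" using that(3) by (simp only: lab_eq)
    moreover have "inv_into UNIV lab (lab r) = r" "inv_into UNIV lab (lab s) = s"
      using that(1,2) by (auto simp: R_def f_inv_into_f)
    ultimately show ?thesis by metis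
  qed
  let ?D = "\<lambda>p. rmat L *v fst p + snd p *\<^sub>R ivec v"
  have D: "equivariant L v ?D" by (intro equivariant_linear equivariant_commute[OF equivariant_L])
  have full: "\<exists>x. (x, 1) \<in> level ?D u" for u
  proof -
    obtain x where "?D (x, 1) = ivec u" using surjective_on_fibre[OF D det, of 1 "ivec u"] by auto
    then show ?thesis by (auto simp: level_def)
  qed
  show "MCC A f id = enat (card (beta_orbits A f v))"
    unfolding MCC_eq_INF[OF f F] L[symmetric] orbits R(2)[symmetric]
  proof (rule INF_enat_eq[of ?D])
    show "ecount (path_components_of (coincidence_space ?D)) \<le> enat (card R)"
    proof (rule components_le_orbits[OF D path_connected_level_linear _ R(1)])
      show "\<exists>x. (x, 1) \<in> level ?D u" for u by (rule full)
      show "\<exists>r\<in>R. orb L v u r \<and> level ?D r \<noteq> {}" for u using rep full by blast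
    qed
    fix E assume "E \<in> {D. equivariant L v D}"
    then have E: "equivariant L v E" by simp
    show "enat (card R) \<le> ecount (path_components_of (coincidence_space E))"
    proof (rule components_ge_orbits[OF E R(1) unique])
      fix r assume "r \<in> R"
      obtain x where "E (x, 0) = ivec r" using surjective_on_fibre[OF E det, of 0 "ivec r"] by auto
      then show "\<exists>p\<in>strip. \<exists>u. E p = ivec u \<and> orb L v u r"
        using orb_refl by (intro bexI[of _ "(x, 0)"]) auto
    qed
  qed (use D in simp)
qed

lemma MC_nonsingular:
  assumes det: "det L \<noteq> 0" shows "MC A f id = \<infinity>"
  unfolding MC_eq_INF[OF f F] L[symmetric]
  by (rule INF_enat_eq_infinity) (use infinite_zeros_nonsingular[OF _ det] in \<open>auto simp: ecount_def\<close>)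

lemma MC_MCC_0:
  assumes D: "equivariant L v D" and z: "zeros D = {}"
  shows "MC A f id = 0" "MCC A f id = 0"
proof -
  have e: "ecount {} = 0" by (simp add: ecount_def zero_enat_def)
  show "MC A f id = 0"
    unfolding MC_eq_INF[OF f F] L[symmetric]
    by (rule INF_enat_eq[of D]) (use D z e in auto)
  show "MCC A f id = 0"
    unfolding MCC_eq_INF[OF f F] L[symmetric]
    by (rule INF_enat_eq[of D]) (use D z e zeros_empty_components[OF z] in auto)
qed

text \<open>With \<open>L = 0\<close> the map \<open>D\<close> may depend on time alone. It is then
  a path that has to avoid the lattice, from a point \<open>a\<close> to the point
  \<open>rmat B *v a + ivec v\<close> dictated by the gluing; the complement of a countable set in
  the plane is path connected.\<close>

lemma MC_MCC_identity:
  assumes "L = 0" shows "MC A f id = 0" "MCC A f id = 0"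
proof -
  define a :: "real ^ 2" where "a = (\<chi> i. 1 / 2)"
  have a: "a \<notin> range ivec"
  proof
    assume "a \<in> range ivec"
    then obtain m where "a $ 1 = ivec m $ 1" by auto
    then have "1 / 2 = real_of_int (m $ 1)" by (simp add: a_def)
    then have "real_of_int (2 * m $ 1) = real_of_int 1" by simp
    then have "2 * m $ 1 = 1" by (simp only: of_int_eq_iff)
    then show False by presburger
  qed
  have "rmat B *v a + ivec v \<notin> range ivec"
  proof
    assume "rmat B *v a + ivec v \<in> range ivec"
    then obtain m where "rmat B *v a = ivec (m - v)" by (auto simp: algebra_simps)
    then have "a = ivec (A *v (m - v))" by (metis rAB rmat_ivec)
    then show False using a by blast
  qed
  moreover have "path_connected (- range ivec)"
    by (rule path_connected_complement_countable) (use countable_range_ivec in auto)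
  ultimately obtain g where g: "path g" "path_image g \<subseteq> - range ivec" "pathstart g = a" "pathfinish g = rmat B *v a + ivec v"
    using a unfolding path_connected_def by blast
  define D where "D = (\<lambda>p::(real^2) \<times> real. g (snd p))"
  have "continuous_on strip D"
    unfolding D_def by (rule continuous_on_compose2[OF g(1)[unfolded path_def]]) (auto intro!: continuous_intros)
  then have "equivariant L v D"
    using g(3,4) by (simp add: equivariant_def D_def assms pathstart_def pathfinish_def)
  moreover have "zeros D = {}"
    using g(2) by (force simp: zeros_def D_def path_image_def)
  ultimately show "MC A f id = 0" "MCC A f id = 0" using MC_MCC_0 by blast+
qed

end

end

section \<open>The rank one case\<close>

text \<open>In the basis \<open>y1\<close>, \<open>y2\<close> the matrix \<open>A\<close> is
  triangular: \<open>eps\<close> is its eigenvalue on the image of \<open>L\<close>, and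
  \<open>a\<close> the one on the quotient, which is also the one on ker L. The form
  \<open>l\<close> gives L = l y1, and \<open>d\<close> is the determinant of the basis.\<close>

locale rank_one = gluing +
  fixes L :: "int ^ 2 ^ 2" and v y1 y2 l :: "int ^ 2" and eps a c d v1 v2 :: int
  assumes basis: "y1 $ 1 * y2 $ 2 - y1 $ 2 * y2 $ 1 = d" and dd: "d * d = 1"
    and L_eq: "L *v m = (l $ 1 * m $ 1 + l $ 2 * m $ 2) *s y1" and l_nonzero: "l \<noteq> 0"
    and A_y1: "A *v y1 = eps *s y1" and A_y2: "A *v y2 = a *s y2 + c *s y1"
    and l_A: "l $ 1 * (A *v m) $ 1 + l $ 2 * (A *v m) $ 2 = eps * (l $ 1 * m $ 1 + l $ 2 * m $ 2)"
    and eps: "eps * eps = 1" and aa: "a * a = 1"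
    and v_eq: "v = v1 *s y1 + v2 *s y2"
begin

text \<open>Coordinates with respect to \<open>y1\<close> and \<open>y2\<close> by Cramer's rule; as
  \<open>d\<close> is 1 or -1, multiplying by it is dividing by it.\<close>

definition c1 :: "real ^ 2 \<Rightarrow> real" where "c1 x = d * (x $ 1 * y2 $ 2 - x $ 2 * y2 $ 1)"
definition c2 :: "real ^ 2 \<Rightarrow> real" where "c2 x = d * (y1 $ 1 * x $ 2 - y1 $ 2 * x $ 1)"
definition i1 :: "int ^ 2 \<Rightarrow> int" where "i1 u = d * (u $ 1 * y2 $ 2 - u $ 2 * y2 $ 1)"
definition i2 :: "int ^ 2 \<Rightarrow> int" where "i2 u = d * (y1 $ 1 * u $ 2 - y1 $ 2 * u $ 1)"
definition ell :: "real ^ 2 \<Rightarrow> real" where "ell x = l $ 1 * x $ 1 + l $ 2 * x $ 2"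
definition ill :: "int ^ 2 \<Rightarrow> int" where "ill m = l $ 1 * m $ 1 + l $ 2 * m $ 2"
text \<open>The values of \<open>ill\<close> are the multiples of this gcd, so \<open>L\<close> maps
  the lattice onto the multiples of \<open>q *s y1\<close>. It is therefore the torsion order of the
  cokernel.\<close>

definition q :: int where "q = gcd (l $ 1) (l $ 2)"

lemma coord_linear [simp]:
  "c1 (x + y) = c1 x + c1 y" "c1 (x - y) = c1 x - c1 y" "c1 (r *\<^sub>R x) = r * c1 x"
  "c2 (x + y) = c2 x + c2 y" "c2 (x - y) = c2 x - c2 y" "c2 (r *\<^sub>R x) = r * c2 x"
  "ell (x + y) = ell x + ell y" "ell (x - y) = ell x - ell y" "ell (r *\<^sub>R x) = r * ell x"
  by (simp_all add: c1_def c2_def ell_def algebra_simps)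

lemma coord_ivec [simp]: "c1 (ivec u) = i1 u" "c2 (ivec u) = i2 u" "ell (ivec u) = ill u"
  by (simp_all add: c1_def c2_def i1_def i2_def ell_def ill_def)

lemma icoord_linear [simp]:
  "i1 (u + w) = i1 u + i1 w" "i1 (u - w) = i1 u - i1 w" "i1 (k *s u) = k * i1 u"
  "i2 (u + w) = i2 u + i2 w" "i2 (u - w) = i2 u - i2 w" "i2 (k *s u) = k * i2 u"
  by (simp_all add: i1_def i2_def algebra_simps)

lemma coord_basis [simp]: "i1 y1 = 1" "i1 y2 = 0" "i2 y1 = 0" "i2 y2 = 1"
proof -
  show "i1 y1 = 1" "i2 y2 = 1"
    using basis dd by (simp_all add: i1_def i2_def)
qed (simp_all add: i1_def i2_def)

lemma icoord_v [simp]: "i1 v = v1" "i2 v = v2"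
  by (simp_all add: v_eq)

lemma continuous_on_coord [continuous_intros]:
  assumes "continuous_on S f"
  shows "continuous_on S (\<lambda>x. c1 (f x))" "continuous_on S (\<lambda>x. c2 (f x))" "continuous_on S (\<lambda>x. ell (f x))"
  unfolding c1_def c2_def ell_def by (intro continuous_intros assms)+

lemma expand: "x = c1 x *\<^sub>R ivec y1 + c2 x *\<^sub>R ivec y2"
proof -
  have b: "real_of_int (y1 $ 1) * y2 $ 2 - y1 $ 2 * y2 $ 1 = d" and e: "real_of_int d * d = 1"
    using basis dd by (metis of_int_diff of_int_mult, metis of_int_1 of_int_mult)
  have "x $ 1 = d * (real_of_int (y1 $ 1) * y2 $ 2 - y1 $ 2 * y2 $ 1) * x $ 1"
    "x $ 2 = d * (real_of_int (y1 $ 1) * y2 $ 2 - y1 $ 2 * y2 $ 1) * x $ 2"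
    unfolding b e by simp_all
  then show ?thesis
    by (simp add: vec_eq_iff forall_2 c1_def c2_def algebra_simps)
qed

lemma coord_eqI: "c1 x = c1 y \<Longrightarrow> c2 x = c2 y \<Longrightarrow> x = y"
  using expand[of x] expand[of y] by simp

lemma icoord_eqI: "i1 u = i1 w \<Longrightarrow> i2 u = i2 w \<Longrightarrow> u = w"
  using coord_eqI[of "ivec u" "ivec w"] by simp

lemma mem_lattice_iff: "x \<in> range ivec \<longleftrightarrow> c1 x \<in> \<int> \<and> c2 x \<in> \<int>"
proof
  assume "c1 x \<in> \<int> \<and> c2 x \<in> \<int>"
  then obtain j k where "c1 x = of_int j" "c2 x = of_int k" by (auto elim!: Ints_cases)
  then have "x = ivec (j *s y1 + k *s y2)" by (intro coord_eqI) simp_all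
  then show "x \<in> range ivec" by blast
qed auto

lemma coord_A [simp]: "c1 (rmat A *v x) = eps * c1 x + c * c2 x" "c2 (rmat A *v x) = a * c2 x"
proof -
  have "rmat A *v x = rmat A *v (c1 x *\<^sub>R ivec y1 + c2 x *\<^sub>R ivec y2)" using expand by metis
  also have "\<dots> = c1 x *\<^sub>R ivec (eps *s y1) + c2 x *\<^sub>R ivec (a *s y2 + c *s y1)"
    by (simp only: matrix_vector_right_distrib matrix_vector_mult_scaleR rmat_ivec A_y1 A_y2)
  finally have e: "rmat A *v x = c1 x *\<^sub>R ivec (eps *s y1) + c2 x *\<^sub>R ivec (a *s y2 + c *s y1)" .
  show "c1 (rmat A *v x) = eps * c1 x + c * c2 x" "c2 (rmat A *v x) = a * c2 x"
    unfolding e by (simp_all del: ivec_simps)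
qed

lemma icoord_A [simp]: "i1 (A *v u) = eps * i1 u + c * i2 u" "i2 (A *v u) = a * i2 u"
proof -
  have "real_of_int (i1 (A *v u)) = of_int (eps * i1 u + c * i2 u)" "real_of_int (i2 (A *v u)) = of_int (a * i2 u)"
    using coord_A[of "ivec u"] by simp_all
  then show "i1 (A *v u) = eps * i1 u + c * i2 u" "i2 (A *v u) = a * i2 u" by (simp_all only: of_int_eq_iff)
qed

lemma icoord_twist [simp]:
  "i1 (twist v u) = eps * (i1 u - v1) + c * (i2 u - v2)" "i2 (twist v u) = a * (i2 u - v2)"
  by (simp_all add: twist_def)

lemma icoord_L [simp]: "i1 (L *v m) = ill m" "i2 (L *v m) = 0"
  by (simp_all add: L_eq ill_def)

lemma rmat_L: "rmat L *v x = ell x *\<^sub>R ivec y1"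
proof -
  have "L $ i $ j = (L *v axis j 1) $ i" for i j
    using exhaust_2[of j] by (auto simp: sum_vec_2 axis_def)
  then have "L $ i $ 1 = l $ 1 * y1 $ i" "L $ i $ 2 = l $ 2 * y1 $ i" for i
    by (simp_all add: L_eq axis_def)
  then show ?thesis
    by (simp add: vec_eq_iff matrix_vector_mult_def sum_2 ell_def algebra_simps)
qed

lemma ell_A [simp]: "ell (rmat A *v x) = eps * ell x"
proof -
  have e: "l $ 1 * A $ 1 $ 1 + l $ 2 * A $ 2 $ 1 = eps * l $ 1" "l $ 1 * A $ 1 $ 2 + l $ 2 * A $ 2 $ 2 = eps * l $ 2"
    using l_A[of "axis 1 1"] l_A[of "axis 2 1"] by (simp_all add: sum_vec_2 axis_def)
  have "ell (rmat A *v x) = of_int (l $ 1 * A $ 1 $ 1 + l $ 2 * A $ 2 $ 1) * x $ 1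
      + of_int (l $ 1 * A $ 1 $ 2 + l $ 2 * A $ 2 $ 2) * x $ 2"
    by (simp add: ell_def matrix_vector_mult_def sum_2 algebra_simps)
  then show ?thesis unfolding e by (simp add: ell_def algebra_simps)
qed

lemma commute: "A *v (L *v m) = L *v (A *v m)"
  by (rule icoord_eqI) (simp_all add: l_A ill_def)

lemma det_A: "det A = eps * a"
proof -
  have "det A * d = (A *v y1) $ 1 * (A *v y2) $ 2 - (A *v y1) $ 2 * (A *v y2) $ 1"
    by (simp add: det_2 sum_vec_2 algebra_simps flip: basis)
  also have "\<dots> = eps * a * d"
    by (simp add: A_y1 A_y2 algebra_simps flip: basis)
  finally have "det A * (d * d) = eps * a * (d * d)" by (simp only: mult.assoc[symmetric])
  then show ?thesis by (simp add: dd)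
qed

lemma q_pos: "q > 0"
  using l_nonzero by (auto simp: q_def vec_eq_iff forall_2)

lemma q_dvd_ill: "q dvd ill m"
  by (simp add: q_def ill_def)

lemma ill_multiple: "\<exists>m. ill m = q * k"
proof -
  obtain i j where ij: "i * l $ 1 + j * l $ 2 = q" using bezout_int[of "l $ 1" "l $ 2"] by (auto simp: q_def)
  then have "ill (\<chi> n. if n = 1 then i * k else j * k) = q * k"
    by (simp add: ill_def algebra_simps flip: ij)
  then show ?thesis by blast
qed

lemma translate_orb:
  assumes "i2 u = i2 w" "q dvd i1 u - i1 w"
  obtains m where "u = w + L *v m"
proof -
  obtain k where k: "i1 u - i1 w = q * k" using assms(2) by (auto elim: dvdE)
  obtain m where "ill m = q * k" using ill_multiple by blast
  then have "u = w + L *v m" using assms(1) k by (intro icoord_eqI) auto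
  then show ?thesis by (rule that)
qed

text \<open>The squared length of \<open>l\<close>. Dividing by it makes \<open>e\<close> (normal to
  ker L) and \<open>ker\<close> (spanning it) the basis dual to \<open>ell\<close> and
  \<open>rho\<close>: \<open>ell\<close> is the part of a vector that \<open>L\<close> sees,
  \<open>rho\<close> the position along ker L.\<close>

definition nl :: real where "nl = real_of_int (l $ 1) ^ 2 + real_of_int (l $ 2) ^ 2"
definition e :: "real ^ 2" where "e = (\<chi> i. l $ i / nl)"
definition ker :: "real ^ 2" where "ker = (\<chi> i. if i = 1 then - l $ 2 else l $ 1)"
definition rho :: "real ^ 2 \<Rightarrow> real" where "rho x = (- l $ 2 * x $ 1 + l $ 1 * x $ 2) / nl"

lemma nl_pos: "nl > 0"
  using l_nonzero by (auto simp: nl_def vec_eq_iff forall_2 sum_power2_gt_zero_iff)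

lemma dual_basis [simp]: "ell e = 1" "ell ker = 0" "rho e = 0" "rho ker = 1"
proof -
  have nl: "real_of_int (l $ 1) * l $ 1 + real_of_int (l $ 2) * l $ 2 = nl" by (simp add: nl_def power2_eq_square)
  have "ell e = (real_of_int (l $ 1) * l $ 1 + real_of_int (l $ 2) * l $ 2) / nl"
    by (simp add: ell_def e_def add_divide_distrib)
  moreover have "rho ker = (real_of_int (l $ 1) * l $ 1 + real_of_int (l $ 2) * l $ 2) / nl"
    by (simp add: rho_def ker_def add.commute)
  ultimately show "ell e = 1" "rho ker = 1" unfolding nl using nl_pos by simp_all
  show "ell ker = 0" "rho e = 0" by (simp_all add: ell_def ker_def rho_def e_def)
qed

lemma rho_linear [simp]:
  "rho (x + y) = rho x + rho y" "rho (x - y) = rho x - rho y" "rho (r *\<^sub>R x) = r * rho x"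
  by (simp_all add: rho_def algebra_simps flip: add_divide_distrib diff_divide_distrib)

lemma dual_expand: "x = ell x *\<^sub>R e + rho x *\<^sub>R ker"
proof -
  have "ell x * l $ 1 - (- l $ 2 * x $ 1 + l $ 1 * x $ 2) * l $ 2 = nl * x $ 1"
    "ell x * l $ 2 + (- l $ 2 * x $ 1 + l $ 1 * x $ 2) * l $ 1 = nl * x $ 2"
    by (simp_all add: ell_def nl_def algebra_simps power2_eq_square)
  then show ?thesis
    using nl_pos by (simp add: vec_eq_iff forall_2 e_def ker_def rho_def field_simps)
qed

text \<open>\<open>A\<close> multiplies \<open>ell\<close> by \<open>eps\<close>, hence preserves
  its kernel, and the remaining eigenvalue is \<open>det A\<close> divided by
  \<open>eps\<close>.\<close>

lemma A_ker: "rmat A *v ker = of_int a *\<^sub>R ker"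
proof -
  have e1: "l $ 1 * A $ 1 $ 1 + l $ 2 * A $ 2 $ 1 = eps * l $ 1" and e2: "l $ 1 * A $ 1 $ 2 + l $ 2 * A $ 2 $ 2 = eps * l $ 2"
    using l_A[of "axis 1 1"] l_A[of "axis 2 1"] by (simp_all add: sum_vec_2 axis_def)
  have dt: "A $ 1 $ 1 * A $ 2 $ 2 - A $ 1 $ 2 * A $ 2 $ 1 = eps * a" using det_A by (simp add: det_2)
  have "eps * (- l $ 2 * A $ 1 $ 1 + l $ 1 * A $ 1 $ 2) = - l $ 2 * (eps * a)"
    unfolding dt[symmetric] using e1 e2 by algebra
  moreover have "eps * (- l $ 2 * A $ 2 $ 1 + l $ 1 * A $ 2 $ 2) = l $ 1 * (eps * a)"
    unfolding dt[symmetric] using e1 e2 by algebra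
  ultimately have r: "- l $ 2 * A $ 1 $ 1 + l $ 1 * A $ 1 $ 2 = - l $ 2 * a" "- l $ 2 * A $ 2 $ 1 + l $ 1 * A $ 2 $ 2 = l $ 1 * a"
    using eps by algebra+
  have "(rmat A *v ker) $ 1 = of_int (- l $ 2 * A $ 1 $ 1 + l $ 1 * A $ 1 $ 2)"
    "(rmat A *v ker) $ 2 = of_int (- l $ 2 * A $ 2 $ 1 + l $ 1 * A $ 2 $ 2)"
    by (simp_all add: matrix_vector_mult_def sum_2 ker_def mult.commute)
  then show ?thesis unfolding r by (simp add: vec_eq_iff forall_2 ker_def mult.commute)
qed

lemma rho_A: "rho (rmat A *v x) = a * rho x + rho (rmat A *v e) * ell x"
proof -
  have "rmat A *v x = rmat A *v (ell x *\<^sub>R e + rho x *\<^sub>R ker)" using dual_expand by metis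
  also have "\<dots> = ell x *\<^sub>R (rmat A *v e) + rho x *\<^sub>R (of_int a *\<^sub>R ker)"
    by (simp only: matrix_vector_right_distrib matrix_vector_mult_scaleR A_ker)
  finally show ?thesis by simp
qed

text \<open>Powers stay triangular in both systems of coordinates. The shears \<open>cn\<close> and
  \<open>bn\<close> are left unspecified: one will be absorbed by a change of the target
  coordinates, the other by the shape of a surface.\<close>

lemma power_A:
  defines "pow n \<equiv> ((*v) (rmat A)) ^^ n"
  obtains cn bn where "\<And>x. c1 (pow n x) = of_int (eps ^ n) * c1 x + cn * c2 x" "\<And>x. c2 (pow n x) = of_int (a ^ n) * c2 x"
    "\<And>x. ell (pow n x) = of_int (eps ^ n) * ell x" "\<And>x. rho (pow n x) = of_int (a ^ n) * rho x + bn * ell x"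
proof -
  have "\<exists>cn bn. \<forall>x. c1 (pow n x) = of_int (eps ^ n) * c1 x + cn * c2 x \<and> c2 (pow n x) = of_int (a ^ n) * c2 x \<and>
    ell (pow n x) = of_int (eps ^ n) * ell x \<and> rho (pow n x) = of_int (a ^ n) * rho x + bn * ell x"
  proof (induction n)
    case 0
    show ?case by (intro exI[of _ 0]) (simp add: pow_def)
  next
    case (Suc n)
    then obtain cn bn where IH: "\<And>x. c1 (pow n x) = of_int (eps ^ n) * c1 x + cn * c2 x" "\<And>x. c2 (pow n x) = of_int (a ^ n) * c2 x"
      "\<And>x. ell (pow n x) = of_int (eps ^ n) * ell x" "\<And>x. rho (pow n x) = of_int (a ^ n) * rho x + bn * ell x" by blast
    have S: "pow (Suc n) x = rmat A *v pow n x" for x by (simp add: pow_def)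
    define b where "b = rho (rmat A *v e)"
    have r: "rho (pow (Suc n) x) = a * rho (pow n x) + b * ell (pow n x)" for x
      unfolding S b_def by (rule rho_A)
    have "c1 (pow (Suc n) x) = of_int (eps ^ Suc n) * c1 x + (eps * cn + c * of_int (a ^ n)) * c2 x"
      "c2 (pow (Suc n) x) = of_int (a ^ Suc n) * c2 x" "ell (pow (Suc n) x) = of_int (eps ^ Suc n) * ell x" for x
      by (simp_all add: S IH algebra_simps)
    moreover have "rho (pow (Suc n) x) = of_int (a ^ Suc n) * rho x + (a * bn + b * of_int (eps ^ n)) * ell x" for x
      by (simp add: r IH algebra_simps)
    ultimately show ?case by blast
  qed
  then show ?thesis using that by blast
qed

text \<open>The second coordinate is kept at a nonintegral constant compatible with the gluing. For
  \<open>a = 1\<close> and \<open>v2 = 0\<close> any constant is compatible; for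
  \<open>a = - 1\<close> it has to be half of \<open>v2\<close>, which is nonintegral for odd
  \<open>v2\<close>.\<close>

lemma empty_model:
  fixes h :: real
  assumes h: "h = a * (h - v2)" "h \<notin> \<int>"
  obtains D where "equivariant L v D" "zeros D = {}"
proof -
  \<comment> \<open>The speed for which the first coordinate matches at the seam: there
    \<open>eps * (mu - v1) + c * (h - v2)\<close> has to vanish.\<close>
  define mu where "mu = v1 - eps * c * (h - v2)"
  define D where "D p = (ell (fst p) + snd p * mu) *\<^sub>R ivec y1 + h *\<^sub>R ivec y2" for p
  have e2: "real_of_int eps * real_of_int eps = 1" using eps by (metis of_int_1 of_int_mult)
  have e3: "real_of_int eps * (real_of_int eps * z) = z" for z using e2 by (simp flip: mult.assoc)
  have "continuous_on strip D" unfolding D_def by (intro continuous_intros)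
  moreover have "D (x + ivec m, t) = D (x, t) + ivec (L *v m)" for x t m
    by (rule coord_eqI) (simp_all add: D_def del: ivec_simps)
  moreover have "D (rmat A *v x, 0) = rmat A *v (D (x, 1) - ivec v)" for x
  proof (rule coord_eqI)
    show "c1 (D (rmat A *v x, 0)) = c1 (rmat A *v (D (x, 1) - ivec v))"
      using e2 by (simp add: D_def mu_def algebra_simps e3)
    show "c2 (D (rmat A *v x, 0)) = c2 (rmat A *v (D (x, 1) - ivec v))"
      using h(1) by (simp add: D_def)
  qed
  ultimately have "equivariant L v D" by (simp add: equivariant_def)
  moreover have "c2 (D p) = h" for p by (simp add: D_def)
  then have "zeros D = {}" using h(2) by (auto simp: zeros_def mem_lattice_iff)
  ultimately show ?thesis by (rule that)
qed

text \<open>A translation by \<open>m\<close> adds \<open>ill m *s y1\<close> to the value, so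
  \<open>c2\<close> of \<open>E\<close> and the difference of \<open>c1\<close> of \<open>E\<close>
  and \<open>ell\<close> are periodic.\<close>

lemma coord_bounds:
  fixes E :: "(real ^ 2) \<times> real \<Rightarrow> real ^ 2"
  assumes E: "continuous_on (UNIV \<times> {0..b}) E"
    "\<And>x t m. t \<in> {0..b} \<Longrightarrow> E (x + ivec m, t) = E (x, t) + ivec (L *v m)"
  obtains K where "K > 0" "\<And>x t. t \<in> {0..b} \<Longrightarrow> \<bar>c1 (E (x, t)) - ell x\<bar> \<le> K"
    "\<And>x t. t \<in> {0..b} \<Longrightarrow> \<bar>c2 (E (x, t))\<bar> \<le> K"
proof -
  have "continuous_on (UNIV \<times> {0..b}) (\<lambda>p. c1 (E p) - ell (fst p))"
    by (intro continuous_intros E(1))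
  then obtain K1 where K1: "K1 > 0" "\<And>x t. t \<in> {0..b} \<Longrightarrow> norm (c1 (E (x, t)) - ell x) \<le> K1"
    using periodic_bounded[where h = "\<lambda>p. c1 (E p) - ell (fst p)" and a = 0 and b = b] E(2) by auto
  have "continuous_on (UNIV \<times> {0..b}) (\<lambda>p. c2 (E p))"
    by (intro continuous_intros E(1))
  then obtain K2 where K2: "K2 > 0" "\<And>x t. t \<in> {0..b} \<Longrightarrow> norm (c2 (E (x, t))) \<le> K2"
    using periodic_bounded[where h = "\<lambda>p. c2 (E p)" and a = 0 and b = b] E(2) by auto
  show ?thesis
    by (rule that[of "max K1 K2"]) (use K1 K2 in \<open>force simp: le_max_iff_disj\<close>)+
qed

end

lemma finite_quadratic_roots:
  fixes al be ga :: real
  assumes "al \<noteq> 0 \<or> be \<noteq> 0"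
  shows "finite {x. al * x\<^sup>2 + be * x + ga = 0}"
proof -
  have "finite {x. poly [:ga, be, al:] x = 0}" by (rule poly_roots_finite) (use assms in auto)
  moreover have "poly [:ga, be, al:] x = al * x\<^sup>2 + be * x + ga" for x
    by (simp add: algebra_simps power2_eq_square)
  ultimately show ?thesis by (simp only:)
qed

context rank_one
begin

section \<open>Classes that every map attains\<close>

lemma i2_twist_funpow: "a = 1 \<Longrightarrow> i2 ((twist v ^^ n) u) = i2 u - int n * v2"
  by (induction n) (simp_all add: algebra_simps)

text \<open>For each \<open>r\<close> consider the surface of the points
  \<open>s *\<^sub>R e + r *\<^sub>R ker\<close> over all times. The parameter \<open>s\<close>
  drives the first coordinate past any bound and time drives the second one, so a suitable member
  \<open>w\<close> of the orbit is hit; different \<open>r\<close> give different points. The factor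
  \<open>sg\<close> makes the drift point upwards.\<close>

lemma essential_preserving:
  assumes a1: "a = 1" and v2: "v2 \<noteq> 0" and D: "equivariant L v D"
  shows "\<exists>p\<in>strip. \<exists>w. D p = ivec w \<and> orb L v w u" "infinite (zeros D)"
proof -
  have Dc: "continuous_on strip D" using D by (simp add: equivariant_def)
  obtain b where b: "b > 0" "\<And>x t. t \<in> {0..1} \<Longrightarrow> \<bar>c2 (D (x, t))\<bar> \<le> b"
    using coord_bounds[OF Dc equivariant_translate[OF D]] by metis
  define sg where "sg = sgn v2"
  have sg: "sg * v2 = \<bar>v2\<bar>" "\<bar>v2\<bar> \<ge> 1" "\<bar>sg\<bar> = 1" using v2 by (auto simp: sg_def sgn_if)
  have sg_abs: "\<bar>real_of_int sg * z\<bar> = \<bar>z\<bar>" for z using sg(3) by (simp add: abs_mult flip: of_int_abs)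
  \<comment> \<open>Going back this many twists raises the target above the bound \<open>b\<close>
    of the second coordinate over the strip, so that at time 0 this coordinate is still below
    it.\<close>
  define j where "j = nat \<lceil>b\<rceil> + nat \<bar>i2 u\<bar> + 1"
  have "surj (twist v)" using twist_inverse by (metis surj_def)
  then have "surj (twist v ^^ j)" by (rule surj_fn)
  then obtain w where w: "(twist v ^^ j) w = u" by (metis surj_def)
  have "i2 w = i2 u + int j * v2" using i2_twist_funpow[OF a1, of j w] w by simp
  then have "sg * i2 w = sg * i2 u + int j * \<bar>v2\<bar>" by (simp add: distrib_left sg(1)[symmetric] mult.left_commute)
  moreover have "- \<bar>i2 u\<bar> \<le> sg * i2 u" using sg(3) by (auto simp: abs_if split: if_splits)
  moreover have "int j \<le> int j * \<bar>v2\<bar>" using sg(2) by (simp add: mult_le_cancel_left1)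
  ultimately have "\<lceil>b\<rceil> \<le> sg * i2 w" using b(1) by (simp add: j_def)
  then have wb: "b \<le> real_of_int (sg * i2 w)" by linarith
  \<comment> \<open>After this many turns the drift, which is at least 1 per turn, has carried the
    second coordinate above the target.\<close>
  define n where "n = nat \<lceil>b\<rceil> + nat \<bar>i2 w\<bar> + 1"
  obtain E where E: "continuous_on (UNIV \<times> {0..real n + 1}) E"
    "\<And>x t. t \<in> {0..1} \<Longrightarrow> E (x, t) = D (x, t)"
    "\<And>x t m. t \<in> {0..real n + 1} \<Longrightarrow> E (x + ivec m, t) = E (x, t) + ivec (L *v m)"
    "\<And>x t. t \<in> {0..real n} \<Longrightarrow> E (rmat A *v x, t) = rmat A *v (E (x, t + 1) - ivec v)"
    using equivariant_extension[OF D, of n] by metis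
  obtain K where K: "K > 0" "\<And>x t. t \<in> {0..real n + 1} \<Longrightarrow> \<bar>c1 (E (x, t)) - ell x\<bar> \<le> K"
    using coord_bounds[OF E(1,3)] by metis
  \<comment> \<open>A turn adds \<open>v2\<close> and replaces the base point by its image under
    \<open>A\<close>, which does no harm because \<open>b\<close> is a bound for the entire
    fibre.\<close>
  have rise: "\<bar>c2 (E (x, real m)) - m * v2\<bar> \<le> b" if "m \<le> n" for m x
    using that
  proof (induction m arbitrary: x)
    case 0 then show ?case using b(2)[of 0 x] E(2)[of 0 x] by simp
  next
    case (Suc m)
    have "c2 (E (rmat A *v x, real m)) = c2 (E (x, real m + 1)) - v2"
      using E(4)[of "real m" x] Suc.prems a1 by simp
    then show ?case using Suc.IH[of "rmat A *v x"] Suc.prems by (simp add: algebra_simps)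
  qed
  have hit: "\<exists>s t. t \<in> {0..real n + 1} \<and> E (s *\<^sub>R e + r *\<^sub>R ker, t) = ivec w" for r
  proof -
    define X where "X p = (fst p *\<^sub>R e + r *\<^sub>R ker, snd p)" for p :: "real \<times> real"
    define S where "S = K + \<bar>i1 w\<bar>"
    have Ec: "continuous_on ({- S..S} \<times> {0..real n}) (\<lambda>p. E (X p))"
      by (rule continuous_on_compose2[OF E(1)]) (auto simp: X_def intro!: continuous_intros)
    obtain s t where st: "s \<in> {- S..S}" "t \<in> {0..real n}"
      "c1 (E (X (s, t))) - i1 w = 0" "sg * (c2 (E (X (s, t))) - i2 w) = 0"
    proof (rule poincare_miranda[of "- S" S 0 "real n" "\<lambda>p. c1 (E (X p)) - i1 w" "\<lambda>p. sg * (c2 (E (X p)) - i2 w)"])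
      show "- S \<le> S" using K(1) by (simp add: S_def)
      show "c1 (E (X (- S, t))) - i1 w \<le> 0 \<and> 0 \<le> c1 (E (X (S, t))) - i1 w" if "t \<in> {0..real n}" for t
      proof -
        have "\<bar>c1 (E (X (- S, t))) + S\<bar> \<le> K" "\<bar>c1 (E (X (S, t))) - S\<bar> \<le> K"
          using K(2)[of t "- S *\<^sub>R e + r *\<^sub>R ker"] K(2)[of t "S *\<^sub>R e + r *\<^sub>R ker"] that
          by (simp_all add: X_def)
        then show ?thesis using S_def by linarith
      qed
      show "sg * (c2 (E (X (s, 0))) - i2 w) \<le> 0 \<and> 0 \<le> sg * (c2 (E (X (s, real n))) - i2 w)" for s
      proof
        have "sg * c2 (E (X (s, 0))) \<le> b"
          using rise[of 0 "s *\<^sub>R e + r *\<^sub>R ker"] sg_abs[of "c2 (E (X (s, 0)))"] by (simp add: X_def)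
        then show "sg * (c2 (E (X (s, 0))) - i2 w) \<le> 0" using wb by (simp add: algebra_simps)
        have "\<bar>c2 (E (X (s, real n))) - real n * real_of_int v2\<bar> \<le> b"
          using rise[of n "s *\<^sub>R e + r *\<^sub>R ker"] by (simp add: X_def)
        moreover have "real_of_int sg * v2 = \<bar>v2\<bar>" using sg(1) by (metis of_int_mult)
        then have "sg * (c2 (E (X (s, real n))) - real n * real_of_int v2) = sg * c2 (E (X (s, real n))) - real n * real_of_int \<bar>v2\<bar>"
          by (simp add: right_diff_distrib mult.left_commute)
        ultimately have "real n * \<bar>v2\<bar> - sg * c2 (E (X (s, real n))) \<le> b"
          using sg_abs[of "c2 (E (X (s, real n))) - real n * real_of_int v2"] by linarith
        moreover have "real n * 1 \<le> real n * real_of_int \<bar>v2\<bar>" using sg(2) by (intro mult_left_mono) linarith+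
        moreover have "b + \<bar>i2 w\<bar> \<le> real n" using b(1) by (simp add: n_def) linarith
        moreover have "sg * i2 w \<le> \<bar>i2 w\<bar>" using sg(3) by (auto simp: abs_if split: if_splits)
        then have "real_of_int (sg * i2 w) \<le> \<bar>i2 w\<bar>" by linarith
        ultimately show "0 \<le> sg * (c2 (E (X (s, real n))) - i2 w)" by (simp add: algebra_simps)
      qed
    qed (use Ec in \<open>auto intro!: continuous_intros\<close>)
    have "sg \<noteq> 0" using sg(3) by auto
    then have "E (X (s, t)) = ivec w" using st(3,4) by (intro coord_eqI) simp_all
    then show ?thesis using st(2) by (intro exI[of _ s] exI[of _ t]) (simp add: X_def)
  qed
  show "\<exists>p\<in>strip. \<exists>w. D p = ivec w \<and> orb L v w u"
  proof -
    obtain s t where "t \<in> {0..real n + 1}" "E (s *\<^sub>R e + 0 *\<^sub>R ker, t) = ivec w" using hit[of 0] by blast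
    then obtain p k where p: "p \<in> strip" "D p = ivec ((twist v ^^ k) w)"
      using extension_value[OF E(2,4)] by blast
    have "orb L v ((twist v ^^ k) w) w" "orb L v u w"
      using orb_twist_funpow w by metis+
    then have "orb L v ((twist v ^^ k) w) u" using orb_sym orb_trans[OF D] by metis
    then show ?thesis using p by blast
  qed
  show "infinite (zeros D)"
  proof
    assume "finite (zeros D)"
    from countable_extension_zeros[where E = E and D = D and n = n, OF E(2,4) this]
    have Z: "countable {p \<in> UNIV \<times> {0..real n + 1}. E p \<in> range ivec}" .
    have "r \<in> (\<lambda>p. rho (fst p)) ` {p \<in> UNIV \<times> {0..real n + 1}. E p \<in> range ivec}" for r
    proof -
      obtain s t where "t \<in> {0..real n + 1}" "E (s *\<^sub>R e + r *\<^sub>R ker, t) = ivec w" using hit[of r] by blast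
      then show ?thesis by (intro image_eqI[of _ _ "(s *\<^sub>R e + r *\<^sub>R ker, t)"]) auto
    qed
    then have "(UNIV :: real set) \<subseteq> (\<lambda>p. rho (fst p)) ` {p \<in> UNIV \<times> {0..real n + 1}. E p \<in> range ivec}" by blast
    from countable_subset[OF this countable_image[OF Z]] show False
      using uncountable_UNIV_real by contradiction
  qed
qed

text \<open>The surface \<open>X\<close> below is invariant under a deck transformation over the \<open>k\<close>-fold turn
  of the circle. Its shape depends on a parameter, so that it can be made to avoid any given
  countable set.\<close>

lemma essential_reversing:
  assumes a1: "a = - 1" and k: "odd k" and D: "equivariant L v D"
    and fixed: "(twist v ^^ k) u = u + L *v m0"
  shows "\<exists>p\<in>strip. \<exists>w. D p = ivec w \<and> orb L v w u" "infinite (zeros D)"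
proof -
  have k0: "real k > 0" using k by (simp add: odd_pos)
  obtain E where E: "continuous_on (UNIV \<times> {0..real k + 1}) E"
    "\<And>x t. t \<in> {0..1} \<Longrightarrow> E (x, t) = D (x, t)"
    "\<And>x t m. t \<in> {0..real k + 1} \<Longrightarrow> E (x + ivec m, t) = E (x, t) + ivec (L *v m)"
    "\<And>x t. t \<in> {0..real k} \<Longrightarrow> E (rmat A *v x, t) = rmat A *v (E (x, t + 1) - ivec v)"
    using equivariant_extension[OF D, of k] by metis
  obtain K where K: "K > 0" "\<And>x t. t \<in> {0..real k + 1} \<Longrightarrow> \<bar>c1 (E (x, t)) - ell x\<bar> \<le> K"
    "\<And>x t. t \<in> {0..real k + 1} \<Longrightarrow> \<bar>c2 (E (x, t))\<bar> \<le> K"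
    using coord_bounds[OF E(1,3)] by metis
  define pow where "pow = (\<lambda>n. ((*v) (rmat A)) ^^ n)"
  define ep where "ep = eps ^ k"
  have ak: "a ^ k = - 1" using a1 k by simp
  have ep: "ep = 1 \<or> ep = - 1"
  proof -
    have "eps = 1 \<or> eps = - 1" using eps by (metis power2_eq_1_iff power2_eq_square)
    then show ?thesis unfolding ep_def using k by (auto simp: power_minus_odd)
  qed
  obtain cn bn where pw0: "\<And>x. c1 ((((*v) (rmat A)) ^^ k) x) = of_int (eps ^ k) * c1 x + cn * c2 x"
    "\<And>x. c2 ((((*v) (rmat A)) ^^ k) x) = of_int (a ^ k) * c2 x"
    "\<And>x. ell ((((*v) (rmat A)) ^^ k) x) = of_int (eps ^ k) * ell x"
    "\<And>x. rho ((((*v) (rmat A)) ^^ k) x) = of_int (a ^ k) * rho x + bn * ell x"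
    using power_A[of k] by metis
  have pw: "c1 (pow k x) = of_int ep * c1 x + cn * c2 x" "c2 (pow k x) = - c2 x"
    "ell (pow k x) = of_int ep * ell x" "rho (pow k x) = - rho x + bn * ell x" for x
    unfolding pow_def pw0 ep_def ak by simp_all
  \<comment> \<open>Measured from the moving target, the iterate of \<open>u\<close>, the affine
    gluing becomes linear.\<close>
  have iter: "E (pow j x, real (k - j)) - ivec ((twist v ^^ j) u) = pow j (E (x, real k) - ivec u)" if "j \<le> k" for j x
    using that
  proof (induction j)
    case 0 then show ?case by (simp add: pow_def)
  next
    case (Suc j)
    have "real (k - j) = real (k - Suc j) + 1" using Suc.prems by (simp add: of_nat_diff)
    then have "E (rmat A *v pow j x, real (k - Suc j)) = rmat A *v (E (pow j x, real (k - j)) - ivec v)"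
      using E(4)[of "real (k - Suc j)" "pow j x"] by simp
    then have "E (pow (Suc j) x, real (k - Suc j)) - ivec ((twist v ^^ Suc j) u)
        = rmat A *v (E (pow j x, real (k - j)) - ivec ((twist v ^^ j) u))"
      by (simp add: pow_def ivec_twist matrix_vector_mult_diff_distrib)
    then show ?case using Suc by (simp add: pow_def)
  qed
  \<comment> \<open>After \<open>k\<close> turns the target has returned to \<open>u\<close> up to
    \<open>L *v m0\<close>, and the translation by \<open>m0\<close> in the source absorbs this
    difference.\<close>
  have seam: "E (pow k x - ivec m0, 0) - ivec u = pow k (E (x, real k) - ivec u)" for x
  proof -
    have "E (pow k x, 0) = E (pow k x - ivec m0, 0) + ivec (L *v m0)"
      using E(3)[of 0 "pow k x - ivec m0" m0] by simp
    then show ?thesis using iter[of k x] fixed by (simp add: algebra_simps)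
  qed
  define Z where "Z = {p \<in> UNIV \<times> {0..real k}. E p = ivec u}"
  \<comment> \<open>The height at time 0 that makes the surface close up: the height
    \<open>de\<close> at time \<open>k\<close>, transported by the \<open>k\<close>-th power of
    \<open>A\<close> and translated by minus \<open>m0\<close>, written in terms of the new value
    \<open>s\<close> of \<open>ell\<close>.\<close>
  define g0 where "g0 de s = - de + bn * ep * (s + ill m0) - rho (ivec m0)" for de s :: real
  \<comment> \<open>Interpolates between both ends. The added bump vanishes at the ends, so the seam
    is unaffected; it is quadratic in \<open>de\<close> because the linear coefficient 2 t / k - 1
    vanishes halfway, where the bump does not. Thus only finitely many parameters \<open>de\<close>
    make the surface pass through a given point.\<close>
  define g where "g de s t = (1 - t / k) * g0 de s + (t / k) * de + de\<^sup>2 * (t * (k - t))" for de s t :: real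
  have unc: "uncountable Z"
  proof
    assume cZ: "countable Z"
    define bad where "bad p = {de. rho (fst p) = g de (ell (fst p)) (snd p)}" for p :: "(real ^ 2) \<times> real"
    have "finite (bad p)" if "p \<in> Z" for p
    proof -
      define t where "t = snd p"
      have t: "0 \<le> t" "t \<le> k" using that by (auto simp: Z_def t_def)
      define ga where "ga = (1 - t / k) * g0 0 (ell (fst p)) - rho (fst p)"
      have "rho (fst p) = g de (ell (fst p)) t \<longleftrightarrow> (t * (k - t)) * de\<^sup>2 + (2 * t / k - 1) * de + ga = 0" for de
      proof -
        have "g de (ell (fst p)) t - rho (fst p) = (t * (k - t)) * de\<^sup>2 + (2 * t / k - 1) * de + ga"
          by (simp add: g_def g0_def ga_def algebra_simps)
        then show ?thesis by linarith
      qed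
      moreover have "t * (k - t) \<noteq> 0 \<or> 2 * t / k - 1 \<noteq> 0" using t k0 by (auto simp: field_simps)
      then have "finite {de. (t * (k - t)) * de\<^sup>2 + (2 * t / k - 1) * de + ga = 0}"
        by (rule finite_quadratic_roots)
      ultimately show ?thesis unfolding bad_def t_def[symmetric] by (simp only:)
    qed
    then have "countable (\<Union>p\<in>Z. bad p)" by (intro countable_UN cZ) (rule countable_finite)
    then have "(\<Union>p\<in>Z. bad p) \<noteq> UNIV" using uncountable_UNIV_real by metis
    then obtain de where de: "\<And>p. p \<in> Z \<Longrightarrow> rho (fst p) \<noteq> g de (ell (fst p)) (snd p)"
      unfolding bad_def by blast
    define X where "X p = fst p *\<^sub>R e + g de (fst p) (snd p) *\<^sub>R ker" for p
    have X: "ell (X p) = fst p" "rho (X p) = g de (fst p) (snd p)" for p by (simp_all add: X_def)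
    have nz: "E (X p, snd p) \<noteq> ivec u" if "p \<in> UNIV \<times> {0..real k}" for p
      using de[of "(X p, snd p)"] that X[of p] by (auto simp: Z_def)
    have Xseam: "X (ep * s - ill m0, 0) = pow k (X (s, real k)) - ivec m0" for s :: real
    proof -
      have "ell (X (ep * s - ill m0, 0)) = ell (pow k (X (s, real k)) - ivec m0)"
        by (simp add: X pw)
      moreover have "rho (X (ep * s - ill m0, 0)) = rho (pow k (X (s, real k)) - ivec m0)"
        using ep k0 by (auto simp: X pw g_def g0_def)
      ultimately show ?thesis using dual_expand by metis
    qed
    define W where "W p = E (X p, snd p) - ivec u" for p
    \<comment> \<open>A shear of the target that equals \<open>cn\<close> at time 0 and has faded
      out at time \<open>k\<close>. It cancels the off-diagonal entry, so that across the seam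
      \<open>z\<close> becomes its conjugate or its negative, according to the sign
      \<open>ep\<close>.\<close>
    define ka where "ka t = cn * (1 - t / k)" for t :: real
    define z where "z p = Complex (c1 (W p) + ka (snd p) * c2 (W p)) (c2 (W p))" for p
    have gc: "continuous_on (UNIV \<times> {0..real k}) (\<lambda>p. X p)"
      unfolding X_def g_def g0_def using k0 by (intro continuous_intros) auto
    have Wc: "continuous_on (UNIV \<times> {0..real k}) W"
      unfolding W_def by (intro continuous_intros continuous_on_compose2[OF E(1)] gc) auto
    have Wseam: "W (ep * s - ill m0, 0) = pow k (W (s, real k))" for s :: real
      using seam[of "X (s, real k)"] by (simp add: W_def Xseam)
    \<comment> \<open>Bounds the distance of the real part of \<open>z\<close> from
      \<open>s\<close>: the terms come from \<open>c1\<close>, from the target and from the shear,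
      and the 1 makes the bound strict.\<close>
    define S where "S = K + \<bar>i1 u\<bar> + \<bar>cn\<bar> * (K + \<bar>i2 u\<bar>) + 1"
    have Re_z: "\<bar>Re (z (s, t)) - s\<bar> < S" if t: "t \<in> {0..real k}" for s t
    proof -
      have "\<bar>c2 (W (s, t))\<bar> \<le> K + \<bar>i2 u\<bar>"
        using K(3)[of t "X (s, t)"] t by (simp add: W_def)
      moreover have "\<bar>ka t\<bar> \<le> \<bar>cn\<bar>"
      proof -
        have "0 \<le> t / k" "t / k \<le> 1" using t k0 by auto
        then have "\<bar>1 - t / k\<bar> \<le> 1" by linarith
        then show ?thesis by (simp add: ka_def abs_mult mult_left_le)
      qed
      ultimately have "\<bar>ka t * c2 (W (s, t))\<bar> \<le> \<bar>cn\<bar> * (K + \<bar>i2 u\<bar>)"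
        unfolding abs_mult by (intro mult_mono) auto
      moreover have "\<bar>c1 (W (s, t)) - s\<bar> \<le> K + \<bar>i1 u\<bar>"
        using K(2)[of t "X (s, t)"] t X(1)[of "(s, t)"] by (simp add: W_def)
      ultimately show ?thesis by (simp add: z_def S_def)
    qed
    show False
    proof (rule no_reversing_seam[of "real k" z S "- real_of_int (ill m0)"])
      show "continuous_on (UNIV \<times> {0..real k}) z"
        unfolding z_def Complex_eq ka_def using k0 by (intro continuous_intros Wc) auto
      show "z p \<noteq> 0" if "p \<in> UNIV \<times> {0..real k}" for p
      proof
        assume "z p = 0"
        then have "c1 (W p) = c1 0" "c2 (W p) = c2 0" by (auto simp: z_def complex_eq_iff c1_def c2_def)
        then have "W p = 0" by (rule coord_eqI)
        then show False using nz[OF that] by (simp add: W_def)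
      qed
      show "0 < Re (z (s, t))" if "t \<in> {0..real k}" "S \<le> s" for s t
        using Re_z[OF that(1), of s] that(2) by linarith
      show "Re (z (s, t)) < 0" if "t \<in> {0..real k}" "s \<le> - S" for s t
        using Re_z[OF that(1), of s] that(2) by linarith
      have ka: "ka 0 = cn" "ka k = 0" using k0 by (simp_all add: ka_def)
      have zs: "z (ep * s - ill m0, 0) = Complex (ep * Re (z (s, k))) (- Im (z (s, k)))" for s :: real
        by (simp add: z_def Wseam pw ka)
      show "(\<forall>s. z (s + - real_of_int (ill m0), 0) = cnj (z (s, real k))) \<or>
        (\<forall>s. z (- s + - real_of_int (ill m0), 0) = - z (s, real k))"
        using ep
      proof
        assume "ep = 1"
        then show ?thesis using zs by (intro disjI1) (simp add: complex_eq_iff)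
      next
        assume "ep = - 1"
        then show ?thesis using zs by (intro disjI2) (simp add: complex_eq_iff)
      qed
    qed (use k0 in simp)
  qed
  show "\<exists>p\<in>strip. \<exists>w. D p = ivec w \<and> orb L v w u"
  proof -
    have "Z \<noteq> {}" using unc by auto
    then obtain x t where "E (x, t) = ivec u" "t \<in> {0..real k + 1}" by (auto simp: Z_def)
    then obtain p j where "p \<in> strip" "D p = ivec ((twist v ^^ j) u)"
      using extension_value[OF E(2,4)] by blast
    then show ?thesis using orb_twist_funpow by blast
  qed
  show "infinite (zeros D)"
  proof
    assume "finite (zeros D)"
    from countable_extension_zeros[where E = E and D = D and n = k, OF E(2,4) this]
    have "countable {p \<in> UNIV \<times> {0..real k + 1}. E p \<in> range ivec}" .
    moreover have "Z \<subseteq> {p \<in> UNIV \<times> {0..real k + 1}. E p \<in> range ivec}" by (auto simp: Z_def)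
    ultimately show False using unc countable_subset by blast
  qed
qed

text \<open>Let the second coordinate be \<open>psi\<close> of the affine function
  \<open>la\<close>. A translation moves \<open>la\<close> by a multiple of \<open>q\<close>, and
  the seam applies r -> eps (r - v1) to it, which explains the two conditions on \<open>psi\<close>.
  As \<open>psi\<close> stays below 1 in absolute value, integral values occur only at its
  zeros.\<close>

lemma reversing_model:
  fixes psi :: "real \<Rightarrow> real"
  assumes a1: "a = - 1" and v2: "v2 = 0" and psi: "continuous_on UNIV psi" "\<And>r. \<bar>psi r\<bar> < 1"
    "\<And>r j. psi (r + of_int (q * j)) = psi r" "\<And>r. psi (of_int eps * (r - of_int v1)) = - psi r"
  obtains D where "equivariant L v D"
    "\<And>u. level D u = {p \<in> strip. i2 u = 0 \<and> psi (i1 u) = 0 \<and> ell (fst p) + snd p * v1 = i1 u}"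
proof -
  define la where "la p = ell (fst p) + snd p * v1" for p :: "(real ^ 2) \<times> real"
  \<comment> \<open>The correction of the first coordinate grows with time so as to cancel, at the
    seam, the shear \<open>c\<close> of \<open>A\<close>; it vanishes wherever \<open>psi\<close>
    does.\<close>
  define D where "D p = (la p - eps * c * snd p * psi (la p)) *\<^sub>R ivec y1 + psi (la p) *\<^sub>R ivec y2" for p :: "(real ^ 2) \<times> real"
  have e2: "real_of_int eps * real_of_int eps = 1" using eps by (metis of_int_1 of_int_mult)
  have e3: "real_of_int eps * (real_of_int eps * z) = z" for z using e2 by (simp flip: mult.assoc)
  have "continuous_on strip la" unfolding la_def by (intro continuous_intros)
  then have "continuous_on strip D"
    unfolding D_def by (intro continuous_intros continuous_on_compose2[OF psi(1)]) auto
  moreover have "D (x + ivec m, t) = D (x, t) + ivec (L *v m)" for x t m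
  proof -
    obtain j where "ill m = q * j" using q_dvd_ill by (auto elim: dvdE)
    then have "psi (la (x + ivec m, t)) = psi (la (x, t))"
      using psi(3)[of "la (x, t)" j] by (simp add: la_def algebra_simps)
    then show ?thesis by (intro coord_eqI) (simp_all add: D_def la_def)
  qed
  moreover have "D (rmat A *v x, 0) = rmat A *v (D (x, 1) - ivec v)" for x
  proof -
    have "psi (la (rmat A *v x, 0)) = - psi (la (x, 1))"
      using psi(4)[of "la (x, 1)"] by (simp add: la_def)
    then show ?thesis
      using e2 a1 v2 by (intro coord_eqI) (simp_all add: D_def la_def algebra_simps e3)
  qed
  ultimately have "equivariant L v D" by (simp add: equivariant_def)
  moreover have "D p = ivec u \<longleftrightarrow> i2 u = 0 \<and> psi (i1 u) = 0 \<and> la p = i1 u" for p u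
  proof
    assume Dp: "D p = ivec u"
    have c: "psi (la p) = i2 u" "la p - eps * c * snd p * psi (la p) = i1 u"
      using arg_cong[OF Dp, of c2] arg_cong[OF Dp, of c1] by (simp_all add: D_def)
    have "i2 u = 0" using psi(2)[of "la p"] c(1) by simp
    then show "i2 u = 0 \<and> psi (i1 u) = 0 \<and> la p = i1 u" using c by simp
  next
    assume "i2 u = 0 \<and> psi (i1 u) = 0 \<and> la p = i1 u"
    then show "D p = ivec u" by (intro coord_eqI) (simp_all add: D_def)
  qed
  ultimately show ?thesis by (intro that) (auto simp: level_def la_def)
qed

text \<open>Both minimum numbers in terms of \<open>L\<close> and \<open>v\<close> alone, so that
  they can be computed without reference to a map of the bundle.\<close>

definition comps :: enat where
  "comps = (INF D\<in>{D. equivariant L v D}. ecount (path_components_of (coincidence_space D)))"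

definition points :: enat where
  "points = (INF D\<in>{D. equivariant L v D}. ecount (zeros D))"

lemma comps_points_0:
  assumes "equivariant L v D" "zeros D = {}" shows "comps = 0" "points = 0"
proof -
  have e: "ecount {} = 0" by (simp add: ecount_def zero_enat_def)
  show "comps = 0"
    unfolding comps_def
    by (rule INF_enat_eq[of D]) (use assms e zeros_empty_components[OF assms(2)] in auto)
  show "points = 0"
    unfolding points_def
    by (rule INF_enat_eq[of D]) (use assms e in auto)
qed

text \<open>Reduces the reversing case to arithmetic. The model of \<open>psi\<close> attains the
  orbits represented by \<open>R\<close> and no others, each in one component, whereas their members
  return after an odd number of turns, so every map attains them.\<close>

lemma reversing_count:
  fixes psi :: "real \<Rightarrow> real"
  assumes a1: "a = - 1" and v2: "v2 = 0" and psi: "continuous_on UNIV psi" "\<And>r. \<bar>psi r\<bar> < 1"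
    "\<And>r j. psi (r + of_int (q * j)) = psi r" "\<And>r. psi (of_int eps * (r - of_int v1)) = - psi r"
    and R: "finite R" "\<And>u. u \<in> R \<Longrightarrow> i2 u = 0 \<and> psi (i1 u) = 0"
    and unique: "\<And>u w. u \<in> R \<Longrightarrow> w \<in> R \<Longrightarrow> orb L v u w \<Longrightarrow> u = w"
    and rep: "\<And>u. i2 u = 0 \<Longrightarrow> psi (i1 u) = 0 \<Longrightarrow> \<exists>r\<in>R. orb L v u r"
    and fixed: "\<And>u. u \<in> R \<Longrightarrow> \<exists>k m. odd k \<and> (twist v ^^ k) u = u + L *v m"
  shows "comps = enat (card R) \<and> points = (if R = {} then 0 else \<infinity>)"
proof -
  obtain D where D: "equivariant L v D"
    and lev: "\<And>u. level D u = {p \<in> strip. i2 u = 0 \<and> psi (i1 u) = 0 \<and> ell (fst p) + snd p * v1 = i1 u}"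
    using reversing_model[where psi = psi, OF a1 v2 psi] by blast
  \<comment> \<open>On the levels, \<open>la\<close> is the first coordinate; at time 1 it includes
    the drift \<open>v1\<close>, which the witness has to compensate.\<close>
  have full: "\<exists>x. (x, 1) \<in> level D u" if "i2 u = 0" "psi (i1 u) = 0" for u
    using that by (intro exI[of _ "(i1 u - v1) *\<^sub>R e"]) (simp add: lev)
  have pc: "path_connected (level D u)" for u
  proof (cases "i2 u = 0 \<and> psi (i1 u) = 0")
    case True
    have lin: "linear (\<lambda>p::(real ^ 2) \<times> real. ell (fst p) + snd p * v1)"
      by (rule linearI) (simp_all add: algebra_simps)
    have "level D u = strip \<inter> (\<lambda>p. ell (fst p) + snd p * v1) -` {of_int (i1 u)}"
      using True by (auto simp: lev)
    moreover have "convex \<dots>"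
      by (intro convex_Int convex_Times convex_linear_vimage lin) auto
    ultimately have "convex (level D u)" by simp
    then show ?thesis by (rule convex_imp_path_connected)
  next
    case False
    then have "level D u = {}" by (auto simp: lev)
    then show ?thesis by simp
  qed
  have nonempty: "i2 u = 0 \<and> psi (i1 u) = 0" if "level D u \<noteq> {}" for u
    using that by (auto simp: lev)
  have "comps = enat (card R)"
    unfolding comps_def
  proof (rule INF_enat_eq[of D])
    show "ecount (path_components_of (coincidence_space D)) \<le> enat (card R)"
    proof (rule components_le_orbits[OF D pc _ R(1)])
      show "\<exists>x. (x, 1) \<in> level D u" if "level D u \<noteq> {}" for u
        using nonempty[OF that] full by blast
      show "\<exists>r\<in>R. orb L v u r \<and> level D r \<noteq> {}" if "level D u \<noteq> {}" for u
        using nonempty[OF that] rep R(2) full by blast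
    qed
    fix D' assume "D' \<in> {D. equivariant L v D}"
    then have D': "equivariant L v D'" by simp
    show "enat (card R) \<le> ecount (path_components_of (coincidence_space D'))"
    proof (rule components_ge_orbits[OF D' R(1) unique])
      fix r assume "r \<in> R"
      then obtain k m where "odd k" "(twist v ^^ k) r = r + L *v m" using fixed by blast
      then show "\<exists>p\<in>strip. \<exists>u. D' p = ivec u \<and> orb L v u r"
        by (rule essential_reversing(1)[OF a1 _ D'])
    qed
  qed (use D in simp)
  moreover have "points = (if R = {} then 0 else \<infinity>)"
  proof (cases "R = {}")
    case True
    then have "level D u = {}" for u using rep nonempty by blast
    then have "zeros D = {}" by (auto simp: zeros_def level_def)
    then show ?thesis using comps_points_0(2)[OF D] True by simp
  next
    case False
    then obtain r where "r \<in> R" by blast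
    then obtain k m where km: "odd k" "(twist v ^^ k) r = r + L *v m" using fixed by blast
    have "ecount (zeros D') = \<infinity>" if "equivariant L v D'" for D'
      using essential_reversing(2)[OF a1 km(1) that km(2)] by (simp add: ecount_def)
    then show ?thesis using False unfolding points_def by (simp add: INF_enat_eq_infinity)
  qed
  ultimately show ?thesis by blast
qed

end

section \<open>Counting the classes in rank one\<close>

lemma sin_add_int_2pi: "sin (y + of_int n * (2 * pi)) = sin y"
  using sin_int_2pin[of n] cos_int_2pin[of n] by (simp add: sin_add mult.commute mult.left_commute)

context rank_one
begin

text \<open>Each twist lowers \<open>i2\<close> by \<open>v2\<close>, so an orbit meets a window of
  length \<open>\<bar>v2\<bar>\<close> in exactly one value of \<open>i2\<close>, where
  \<open>i1\<close> still matters modulo \<open>q\<close>. In the linear model the second coordinate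
  is t times \<open>v2\<close>: a level occupies a single fibre, and the attained values of
  \<open>i2\<close> fill one window together with its far end.\<close>

lemma preserving_formula:
  assumes a1: "a = 1"
  shows "comps = enat (nat q * nat \<bar>v2\<bar>) \<and> points = (if v2 = 0 then 0 else \<infinity>)"
proof (cases "v2 = 0")
  case True
  have "1 / 2 \<notin> (\<int> :: real set)" by (auto elim!: Ints_cases simp: field_simps)
  moreover have "1 / 2 = real_of_int a * (1 / 2 - v2)" using a1 True by simp
  ultimately obtain D where "equivariant L v D" "zeros D = {}" using empty_model by blast
  from comps_points_0[OF this] show ?thesis using True by (simp add: zero_enat_def)
next
  case False
  define sg where "sg = sgn v2"
  have sg: "sg * v2 = \<bar>v2\<bar>" "\<bar>v2\<bar> > 0" "sg * sg = 1" using False by (auto simp: sg_def sgn_if)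
  have sgsg: "sg * (sg * z) = z" for z using sg(3) by (simp flip: mult.assoc)
  define h where "h = (\<lambda>(i, j). i *s y1 + (sg * j) *s y2)"
  define R where "R = h ` ({0..<q} \<times> {0..<\<bar>v2\<bar>})"
  have hi: "i1 (h (i, j)) = i" "sg * i2 (h (i, j)) = j" for i j by (simp_all add: h_def sgsg)
  have Ri: "0 \<le> i1 r" "i1 r < q" "0 \<le> sg * i2 r" "sg * i2 r < \<bar>v2\<bar>" if "r \<in> R" for r
    using that by (auto simp: R_def hi)
  have inR: "\<exists>r\<in>R. i2 r = i2 u \<and> q dvd i1 r - i1 u" if "0 \<le> sg * i2 u" "sg * i2 u < \<bar>v2\<bar>" for u
  proof (rule bexI[of _ "h (i1 u mod q, sg * i2 u)"])
    show "h (i1 u mod q, sg * i2 u) \<in> R" using that q_pos by (auto simp: R_def)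
    have "q dvd i1 u mod q - i1 u" by (metis dvd_minus_mod dvd_diff_commute)
    then show "i2 (h (i1 u mod q, sg * i2 u)) = i2 u \<and> q dvd i1 (h (i1 u mod q, sg * i2 u)) - i1 u"
      by (simp add: hi) (simp add: h_def sgsg)
  qed
  have "inj_on h ({0..<q} \<times> {0..<\<bar>v2\<bar>})"
    by (rule inj_onI) (metis hi prod.collapse)
  then have R: "finite R" "card R = nat q * nat \<bar>v2\<bar>"
    by (simp_all add: R_def card_image card_cartesian_product)
  have unique1: "r = s" if rs: "r \<in> R" "s \<in> R" and eq: "(twist v ^^ n) r = s + L *v m" for r s n m
  proof -
    have "i2 r - int n * v2 = i2 s" using i2_twist_funpow[OF a1, of n r] eq by simp
    then have "sg * i2 s = sg * i2 r - int n * \<bar>v2\<bar>"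
      by (simp add: right_diff_distrib sg(1)[symmetric] mult.left_commute flip: \<open>i2 r - int n * v2 = i2 s\<close>)
    then have "int n * \<bar>v2\<bar> < 1 * \<bar>v2\<bar>" using Ri(4)[OF rs(1)] Ri(3)[OF rs(2)] by linarith
    then have n: "n = 0" using sg(2) by (simp add: mult_less_cancel_right)
    then have "r = s + L *v m" using eq by simp
    then have "i2 r = i2 s" "i1 r - i1 s = ill m" by simp_all
    then have "q dvd i1 r - i1 s" using q_dvd_ill by simp
    then have "i1 r mod q = i1 s mod q" by (simp add: mod_eq_dvd_iff)
    then show ?thesis using Ri(1,2)[OF rs(1)] Ri(1,2)[OF rs(2)] \<open>i2 r = i2 s\<close>
      by (intro icoord_eqI) simp_all
  qed
  have unique: "r = s" if "r \<in> R" "s \<in> R" "orb L v r s" for r s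
    using that unique1[OF that(1,2)] unique1[OF that(2,1)] unfolding orb_def by blast
  let ?D = "\<lambda>p. rmat L *v fst p + snd p *\<^sub>R ivec v"
  have D: "equivariant L v ?D" by (rule equivariant_linear[OF commute])
  note pc = path_connected_level_linear
  have "comps = enat (card R)"
    unfolding comps_def
  proof (rule INF_enat_eq[of ?D])
    show "ecount (path_components_of (coincidence_space ?D)) \<le> enat (card R)"
    proof (rule components_le[OF R(1)])
      have low: "\<exists>r\<in>R. joined ?D u r \<and> level ?D r \<noteq> {}"
        if u: "level ?D u \<noteq> {}" "0 \<le> sg * i2 u" "sg * i2 u < \<bar>v2\<bar>" for u
      proof -
        obtain r where r: "r \<in> R" "i2 r = i2 u" "q dvd i1 r - i1 u" using inR[OF u(2,3)] by blast
        obtain m where m: "r = u + L *v m" using translate_orb[OF r(2,3)] by blast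
        show ?thesis using joined_translate[OF D pc u(1), of m] r(1) m by blast
      qed
      fix u assume "level ?D u \<noteq> {}"
      then obtain p' where p': "p' \<in> level ?D u" by blast
      obtain x t where "p' = (x, t)" by (cases p')
      with p' have p: "(x, t) \<in> level ?D u" by simp
      then have t: "0 \<le> t" "t \<le> 1" "?D (x, t) = ivec u" by (auto simp: level_def)
      have "c2 (?D (x, t)) = t * v2" by (simp add: rmat_L)
      then have i2u: "real_of_int (i2 u) = t * v2" unfolding t(3) by simp
      have "real_of_int sg * v2 = \<bar>v2\<bar>" using sg(1) by (metis of_int_mult)
      then have "real_of_int (sg * i2 u) = t * \<bar>v2\<bar>"
        by (simp add: i2u mult.left_commute)
      then have "0 \<le> real_of_int (sg * i2 u)" "real_of_int (sg * i2 u) \<le> \<bar>v2\<bar>"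
        using t sg(2) by (simp_all add: mult_left_le_one_le)
      then have b: "0 \<le> sg * i2 u" "sg * i2 u \<le> \<bar>v2\<bar>" by linarith+
      show "\<exists>r\<in>R. joined ?D u r \<and> level ?D r \<noteq> {}"
      proof (cases "sg * i2 u < \<bar>v2\<bar>")
        case True
        then show ?thesis using low \<open>level ?D u \<noteq> {}\<close> b by blast
      next
        \<comment> \<open>The far end of the window is attained at time 1 and is carried by one
          twist to its near end.\<close>
        case nl: False
        then have "sg * i2 u = sg * v2" using b sg(1) by simp
        then have u2: "i2 u = v2" by (metis sgsg)
        then have "t = 1" using i2u False by simp
        then have "(x, 1) \<in> level ?D u" using p by simp
        note tw = joined_twist[OF D pc this]
        have z: "i2 (twist v u) = 0" using a1 u2 by simp
        have "0 \<le> sg * i2 (twist v u)" "sg * i2 (twist v u) < \<bar>v2\<bar>" using sg(2) unfolding z by simp_all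
        from low[OF tw(2) this] obtain r where r: "r \<in> R" "joined ?D (twist v u) r" "level ?D r \<noteq> {}"
          by blast
        then show ?thesis using joined_trans[OF tw(1) r(2) tw(2)] by blast
      qed
    qed
    fix D' assume "D' \<in> {D. equivariant L v D}"
    then have D': "equivariant L v D'" by simp
    show "enat (card R) \<le> ecount (path_components_of (coincidence_space D'))"
      by (rule components_ge_orbits[OF D' R(1) unique essential_preserving(1)[OF a1 False D']])
  qed (use D in simp)
  moreover have "ecount (zeros D') = \<infinity>" if "equivariant L v D'" for D'
    using essential_preserving(2)[OF a1 False that] by (simp add: ecount_def)
  then have "points = \<infinity>" unfolding points_def by (simp add: INF_enat_eq_infinity)
  ultimately show ?thesis using R(2) False by simp
qed

lemma reversing_odd:
  assumes a1: "a = - 1" and v2: "odd v2"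
  shows "comps = 0" "points = 0"
proof -
  have "v2 / 2 \<notin> (\<int> :: real set)"
  proof
    assume "v2 / 2 \<in> (\<int> :: real set)"
    then obtain k where "real_of_int v2 / 2 = of_int k" by (auto elim: Ints_cases)
    then have "real_of_int v2 = of_int (2 * k)" by simp
    then have "v2 = 2 * k" by (simp only: of_int_eq_iff)
    then show False using v2 by simp
  qed
  moreover have "v2 / 2 = real_of_int a * (v2 / 2 - v2)" using a1 by simp
  ultimately obtain D where "equivariant L v D" "zeros D = {}" using empty_model by blast
  from comps_points_0[OF this] show "comps = 0" "points = 0" .
qed

lemma inj_y1: "inj (\<lambda>j. j *s y1)"
  by (rule injI) (drule arg_cong[of _ _ i1], simp)

text \<open>On the values with \<open>i2 = 0\<close> the twist is the translation of
  \<open>i1\<close> by minus \<open>v1\<close> modulo \<open>q\<close>. Its orbits are the residue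
  classes modulo \<open>r\<close>, all of period q / r. If this is odd, none can be avoided and
  \<open>psi\<close> may be 0; if it is even, \<open>psi\<close> must not vanish at any
  integer.\<close>

lemma reversing_orientable:
  assumes a1: "a = - 1" and v2: "v2 = 0" and ep: "eps = 1"
  defines "r \<equiv> gcd q v1"
  shows "comps = (if odd (q div r) then enat (nat r) else 0) \<and> points = (if odd (q div r) then \<infinity> else 0)"
proof -
  have r: "r > 0" "r dvd q" "r dvd v1" using q_pos by (simp_all add: r_def)
  obtain qr where qr: "q = r * qr" using r(2) by (auto elim: dvdE)
  obtain vr where vr: "v1 = r * vr" using r(3) by (auto elim: dvdE)
  have qdiv: "q div r = qr" using qr r(1) by simp
  have "qr > 0" using q_pos qr r(1) by (simp add: zero_less_mult_iff)
  have iter: "i2 u = 0 \<Longrightarrow> i2 ((twist v ^^ n) u) = 0 \<and> i1 ((twist v ^^ n) u) = i1 u - int n * v1" for u n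
    by (induction n) (simp_all add: a1 v2 ep algebra_simps)
  show ?thesis
  proof (cases "odd qr")
    case True
    define R where "R = (\<lambda>j. j *s y1) ` {0..<r}"
    have R: "finite R" "card R = nat r" "R \<noteq> {}"
      using r(1) card_image[OF inj_on_subset[OF inj_y1], of "{0..<r}"] by (auto simp: R_def)
    have step: "r dvd i1 u - i1 w" if "i2 u = 0" "(twist v ^^ n) u = w + L *v m" for u w n m
    proof -
      have "i1 u - i1 w = ill m + int n * v1" using iter[OF that(1), of n] that(2) by simp
      then show ?thesis using r(2,3) q_dvd_ill[of m] by (simp add: dvd_trans)
    qed
    have count: "comps = enat (card R) \<and> points = (if R = {} then 0 else \<infinity>)"
    proof (rule reversing_count[OF a1 v2, of "\<lambda>_. 0"], goal_cases)
      fix u w assume uw: "u \<in> R" "w \<in> R" "orb L v u w"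
      then have z: "i2 u = 0" "i2 w = 0" "0 \<le> i1 u" "i1 u < r" "0 \<le> i1 w" "i1 w < r" by (auto simp: R_def)
      obtain n m where "(twist v ^^ n) u = w + L *v m \<or> (twist v ^^ n) w = u + L *v m"
        using uw(3) unfolding orb_def by blast
      then have "r dvd i1 u - i1 w" using step z(1,2) dvd_diff_commute by blast
      then have "i1 u mod r = i1 w mod r" by (simp add: mod_eq_dvd_iff)
      then show "u = w" using z by (intro icoord_eqI) simp_all
    next
      fix u assume u: "i2 u = 0"
      define w where "w = (i1 u mod r) *s y1"
      have w: "i1 w = i1 u mod r" "i2 w = 0" by (simp_all add: w_def)
      have "w \<in> R" using r(1) by (auto simp: R_def w_def)
      \<comment> \<open>Bezout expresses the difference of \<open>u\<close> and its residue by
        multiples of \<open>q\<close> and \<open>v1\<close>. The sign of the coefficient of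
        \<open>v1\<close> decides which of the two has to be iterated.\<close>
      obtain al be where ab: "al * q + be * v1 = r" using bezout_int[of q v1] by (auto simp: r_def)
      define k where "k = i1 u div r"
      have "i1 u - i1 w = r * k" by (simp add: w k_def minus_mod_eq_mult_div)
      then have diff: "i1 u - i1 w = al * k * q + be * k * v1" by (simp add: algebra_simps flip: ab)
      have "orb L v u w"
      proof (cases "be * k \<ge> 0")
        case True
        define n where "n = nat (be * k)"
        have "i2 ((twist v ^^ n) u) = i2 w" "q dvd i1 ((twist v ^^ n) u) - i1 w"
          using iter[OF u, of n] w(2) True diff by (simp_all add: n_def algebra_simps)
        from translate_orb[OF this] show ?thesis unfolding orb_def by metis
      next
        case False
        define n where "n = nat (- (be * k))"
        have "i2 ((twist v ^^ n) w) = i2 u" "q dvd i1 ((twist v ^^ n) w) - i1 u"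
        proof -
          have "i1 ((twist v ^^ n) w) - i1 u = q * (- (al * k))"
            using iter[OF w(2), of n] False diff by (simp add: n_def algebra_simps)
          then show "q dvd i1 ((twist v ^^ n) w) - i1 u" by simp
        qed (use iter[OF w(2), of n] u in simp)
        from translate_orb[OF this] show ?thesis unfolding orb_def by metis
      qed
      then show "\<exists>r\<in>R. orb L v u r" using \<open>w \<in> R\<close> by blast
    next
      fix u assume "u \<in> R"
      then have u: "i2 u = 0" by (auto simp: R_def)
      have "i1 ((twist v ^^ nat qr) u) - i1 u = q * (- vr)"
        using iter[OF u, of "nat qr"] \<open>qr > 0\<close> by (simp add: qr vr)
      then have "i2 ((twist v ^^ nat qr) u) = i2 u" "q dvd i1 ((twist v ^^ nat qr) u) - i1 u"
        using iter[OF u, of "nat qr"] u by simp_all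
      moreover have "odd (nat qr)" using True \<open>qr > 0\<close> by (simp add: even_nat_iff)
      ultimately show "\<exists>k m. odd k \<and> (twist v ^^ k) u = u + L *v m" using translate_orb by metis
    qed (use R(1) in \<open>auto simp: R_def\<close>)
    show ?thesis using count True unfolding if_not_P[OF R(3)] R(2) by (simp add: qdiv)
  next
    case False
    \<comment> \<open>Otherwise 2 r would divide both \<open>q\<close> and \<open>v1\<close>, hence
      their gcd.\<close>
    have "odd vr"
    proof
      assume "even vr"
      then have "2 * r dvd q" "2 * r dvd v1" using False by (auto simp: qr vr mult.commute intro!: mult_dvd_mono)
      then have "2 * r dvd r" unfolding r_def by (rule gcd_greatest)
      then show False using r(1) zdvd_imp_le by fastforce
    qed
    obtain h where h: "qr = 2 * h" using False by (auto elim: evenE)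
    obtain g where g: "vr = 2 * g + 1" using \<open>odd vr\<close> by (auto elim: oddE)
    \<comment> \<open>A shift by \<open>r\<close> changes the sign of this sine. Now
      \<open>q\<close> is an even and \<open>v1\<close> an odd multiple of \<open>r\<close>, which
      gives periodicity and antisymmetry; the offset 1/2 places the zeros off the integers.\<close>
    define psi where "psi x = sin (pi * (x - 1 / 2) / r) / 2" for x :: real
    have nz: "psi (of_int j) \<noteq> 0" for j
    proof
      assume "psi (of_int j) = 0"
      then obtain i where "pi * (of_int j - 1 / 2) / r = of_int i * pi" by (auto simp: psi_def sin_zero_iff_int2)
      then have "(of_int j - 1 / 2) / real_of_int r = of_int i"
        using mult_left_cancel[of pi "(of_int j - 1 / 2) / real_of_int r" "of_int i"] by (simp add: mult.commute)
      then have "of_int j - 1 / 2 = real_of_int i * r" using r(1) by (simp add: field_simps)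
      then have "real_of_int (2 * j - 1) = real_of_int (2 * (i * r))" by simp
      then have "2 * j - 1 = 2 * (i * r)" by (simp only: of_int_eq_iff)
      then show False by presburger
    qed
    have per: "psi (x + of_int (q * j)) = psi x" for x j
    proof -
      have "pi * (x + of_int (q * j) - 1 / 2) / r = pi * (x - 1 / 2) / r + of_int (h * j) * (2 * pi)"
        using r(1) by (simp add: qr h field_simps)
      then show ?thesis by (simp only: psi_def sin_add_int_2pi)
    qed
    have anti: "psi (of_int eps * (x - of_int v1)) = - psi x" for x
    proof -
      have "pi * (x - of_int v1 - 1 / 2) / r = pi * (x - 1 / 2) / r - pi + of_int (- g) * (2 * pi)"
        using r(1) by (simp add: vr g field_simps)
      then have "psi (x - of_int v1) = sin (pi * (x - 1 / 2) / r - pi) / 2"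
        by (simp only: psi_def sin_add_int_2pi)
      then show ?thesis by (simp add: psi_def ep sin_diff)
    qed
    have count: "comps = enat (card ({} :: (int ^ 2) set)) \<and> points = (if ({} :: (int ^ 2) set) = {} then 0 else \<infinity>)"
    proof (rule reversing_count[OF a1 v2, of psi], goal_cases)
      show "continuous_on UNIV psi" unfolding psi_def using r(1) by (intro continuous_intros) auto
      show "\<bar>psi x\<bar> < 1" for x
      proof -
        have "\<bar>sin (pi * (x - 1 / 2) / r)\<bar> < 2" using abs_sin_le_one[of "pi * (x - 1 / 2) / r"] by linarith
        then show ?thesis by (simp add: psi_def)
      qed
    qed (use nz per anti in auto)
    then show ?thesis using False by (simp add: qdiv zero_enat_def)
  qed
qed

text \<open>On the values with \<open>i2 = 0\<close> the twist is the reflection of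
  \<open>i1\<close> to v1 - i1 modulo \<open>q\<close>. Its fixed residues solve 2 j = v1 modulo
  \<open>q\<close>, all others have period 2. The sine is odd about v1 / 2 and its integral zeros
  are exactly these solutions.\<close>

lemma reversing_nonorientable:
  assumes a1: "a = - 1" and v2: "v2 = 0" and ep: "eps = - 1"
  shows "comps = (if odd q then 1 else if even v1 then 2 else 0) \<and> points = (if odd q \<or> even v1 then \<infinity> else 0)"
proof -
  define psi where "psi x = sin (pi * (2 * x - v1) / q) / 2" for x :: real
  have psi_iff: "psi (of_int j) = 0 \<longleftrightarrow> q dvd 2 * j - v1" for j
  proof -
    have "psi (of_int j) = 0 \<longleftrightarrow> (\<exists>i. pi * (2 * of_int j - v1) / q = of_int i * pi)"
      by (simp add: psi_def sin_zero_iff_int2)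
    also have "\<dots> \<longleftrightarrow> (\<exists>i. real_of_int (2 * j - v1) = real_of_int (q * i))"
    proof -
      have "pi * (2 * of_int j - v1) / q = of_int i * pi \<longleftrightarrow> (2 * of_int j - v1) / q = real_of_int i" for i
        using mult_left_cancel[of pi "(2 * of_int j - v1) / q" "of_int i"] by (simp add: mult.commute)
      then show ?thesis using q_pos by (simp add: field_simps)
    qed
    also have "\<dots> \<longleftrightarrow> q dvd 2 * j - v1" unfolding of_int_eq_iff dvd_def ..
    finally show ?thesis .
  qed
  have pc: "continuous_on UNIV psi" unfolding psi_def using q_pos by (intro continuous_intros) auto
  have small: "\<bar>psi x\<bar> < 1" for x
  proof -
    have "\<bar>sin (pi * (2 * x - v1) / q)\<bar> < 2" using abs_sin_le_one[of "pi * (2 * x - v1) / q"] by linarith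
    then show ?thesis by (simp add: psi_def)
  qed
  have per: "psi (x + of_int (q * j)) = psi x" for x j
  proof -
    have "pi * (2 * (x + of_int (q * j)) - v1) / q = pi * (2 * x - v1) / q + of_int j * (2 * pi)"
      using q_pos by (simp add: field_simps)
    then show ?thesis by (simp only: psi_def sin_add_int_2pi)
  qed
  have anti: "psi (of_int eps * (x - of_int v1)) = - psi x" for x
  proof -
    have "pi * (2 * (of_int eps * (x - of_int v1)) - v1) / q = - (pi * (2 * x - v1) / q)"
      using q_pos by (simp add: ep field_simps)
    then show ?thesis by (simp add: psi_def)
  qed
  have iter: "i2 ((twist v ^^ n) u) = 0 \<and> q dvd i1 ((twist v ^^ n) u) - i1 u"
    if "i2 u = 0" "q dvd 2 * i1 u - v1" for u n
  proof (induction n)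
    case (Suc n)
    let ?w = "(twist v ^^ n) u"
    have "i1 (twist v ?w) - i1 u = - (i1 ?w - i1 u) - (2 * i1 u - v1)" using Suc ep v2 by simp
    moreover have "q dvd - (i1 ?w - i1 u) - (2 * i1 u - v1)"
      using Suc that(2) by (intro dvd_diff[OF _ that(2)]) (simp only: dvd_minus_iff)
    ultimately show ?case using Suc a1 v2 by simp
  qed (use that in simp)
  have orb_imp: "q dvd i1 u - i1 w" if "i2 u = 0" "i2 w = 0" "q dvd 2 * i1 u - v1" "q dvd 2 * i1 w - v1" "orb L v u w" for u w
  proof -
    have one: "q dvd i1 u - i1 w" if "i2 u = 0" "q dvd 2 * i1 u - v1" "(twist v ^^ n) u = w + L *v m" for u w n m
    proof -
      have "i1 u - i1 w = ill m - (i1 ((twist v ^^ n) u) - i1 u)" using that(3) by simp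
      moreover have "q dvd ill m - (i1 ((twist v ^^ n) u) - i1 u)"
        using iter[OF that(1,2), of n] by (intro dvd_diff[OF q_dvd_ill]) simp
      ultimately show ?thesis by (simp only:)
    qed
    from that(5) show ?thesis
      unfolding orb_def using one[OF that(1,3)] one[OF that(2,4)] dvd_diff_commute by blast
  qed
  have count: "comps = enat (card J) \<and> points = (if J = {} then 0 else \<infinity>)"
    if J: "finite J" "\<And>j. j \<in> J \<Longrightarrow> q dvd 2 * j - v1"
      "\<And>i j. i \<in> J \<Longrightarrow> j \<in> J \<Longrightarrow> q dvd i - j \<Longrightarrow> i = j"
      "\<And>i. q dvd 2 * i - v1 \<Longrightarrow> \<exists>j\<in>J. q dvd i - j" for J
  proof -
    define R where "R = (\<lambda>j. j *s y1) ` J"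
    have Rc: "card R = card J" "R = {} \<longleftrightarrow> J = {}"
      using card_image[OF inj_on_subset[OF inj_y1], of J] by (auto simp: R_def)
    have "comps = enat (card R) \<and> points = (if R = {} then 0 else \<infinity>)"
    proof (rule reversing_count[OF a1 v2 pc small per anti], goal_cases)
      fix u w assume uw: "u \<in> R" "w \<in> R" "orb L v u w"
      then have "i1 u \<in> J" "i1 w \<in> J" "i2 u = 0" "i2 w = 0" by (auto simp: R_def)
      then show "u = w" using orb_imp[of u w] J(2,3) uw(3) by (intro icoord_eqI) auto
    next
      fix u assume u: "i2 u = 0" "psi (i1 u) = 0"
      then obtain j where j: "j \<in> J" "q dvd i1 u - j" using J(4) psi_iff by blast
      then obtain m where "u = j *s y1 + L *v m" using translate_orb[of u "j *s y1"] u(1) by auto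
      then have "orb L v u (j *s y1)" using orb_translate by metis
      then show "\<exists>r\<in>R. orb L v u r" using j(1) by (auto simp: R_def)
    next
      fix u assume "u \<in> R"
      then have u: "i2 u = 0" "q dvd 2 * i1 u - v1" using J(2) by (auto simp: R_def)
      have t: "i2 ((twist v ^^ 1) u) = i2 u" "q dvd i1 ((twist v ^^ 1) u) - i1 u"
        using iter[OF u, of 1] u(1) by simp_all
      from translate_orb[OF t] obtain m where "(twist v ^^ 1) u = u + L *v m" .
      then show "\<exists>k m. odd k \<and> (twist v ^^ k) u = u + L *v m" by (metis odd_one)
    qed (use J(1,2) psi_iff in \<open>auto simp: R_def\<close>)
    then show ?thesis unfolding Rc .
  qed
  show ?thesis
  proof (cases "odd q")
    case True
    then obtain g where g: "q = 2 * g + 1" by (auto elim: oddE)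
    \<comment> \<open>\<open>g + 1\<close> is the inverse of 2 modulo \<open>q\<close>.\<close>
    define j0 where "j0 = v1 * (g + 1)"
    have j0: "2 * j0 - v1 = q * v1" by (simp add: j0_def g algebra_simps)
    have "comps = enat (card {j0}) \<and> points = (if {j0} = {} then 0 else \<infinity>)"
    proof (rule count, goal_cases)
      fix i assume "q dvd 2 * i - v1"
      moreover have "q dvd 2 * j0 - v1" unfolding j0 by simp
      ultimately have "q dvd (2 * i - v1) - (2 * j0 - v1)" by (rule dvd_diff)
      then have "q dvd 2 * (i - j0)" by (simp add: algebra_simps)
      moreover have "coprime q 2" using True by (simp add: coprime_right_2_iff_odd)
      ultimately have "q dvd i - j0" using coprime_dvd_mult_right_iff[of q 2 "i - j0"] by blast
      then show "\<exists>j\<in>{j0}. q dvd i - j" by simp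
    qed (use j0 in auto)
    then show ?thesis using True by (simp add: one_enat_def)
  next
    case False
    then obtain p where p: "q = 2 * p" by (auto elim: evenE)
    have "p > 0" using q_pos p by simp
    show ?thesis
    proof (cases "even v1")
      case True
      then obtain h where h: "v1 = 2 * h" by (auto elim: evenE)
      have np: "\<not> q dvd p" "\<not> q dvd - p" using \<open>p > 0\<close> p zdvd_imp_le[of q p] by auto
      \<comment> \<open>Halving the congruence leaves j = h modulo \<open>p\<close>, which splits
        into two residues modulo \<open>q = 2 * p\<close>.\<close>
      have "comps = enat (card {h, h + p}) \<and> points = (if {h, h + p} = {} then 0 else \<infinity>)"
      proof (rule count, goal_cases)
        fix i assume "q dvd 2 * i - v1"
        then have "2 * p dvd 2 * (i - h)" by (simp add: p h algebra_simps)
        then have "p dvd i - h" by (simp only: dvd_times_left_cancel_iff)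
        then obtain k where k: "i - h = p * k" by (auto elim: dvdE)
        show "\<exists>j\<in>{h, h + p}. q dvd i - j"
        proof (cases "even k")
          case True
          then obtain k' where "k = 2 * k'" by (auto elim: evenE)
          then show ?thesis using k by (simp add: p)
        next
          case False
          then obtain k' where "k = 2 * k' + 1" by (auto elim: oddE)
          then have "i - (h + p) = q * k'" using k by (simp add: p algebra_simps)
          then show ?thesis by simp
        qed
      next
        fix i j assume "i \<in> {h, h + p}" "j \<in> {h, h + p}" "q dvd i - j"
        then show "i = j" using np by auto
      qed (auto simp: p h algebra_simps)
      moreover have "card {h, h + p} = 2" using \<open>p > 0\<close> by simp
      moreover have "enat 2 = 2" by (simp add: numeral_eq_enat)
      ultimately show ?thesis using True \<open>\<not> odd q\<close> by simp
    next
      case v: False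
      have "comps = enat (card ({} :: int set)) \<and> points = (if ({} :: int set) = {} then 0 else \<infinity>)"
      proof (rule count, goal_cases)
        fix i assume "q dvd 2 * i - v1"
        then have "2 dvd 2 * i - v1" using p by (metis dvd_mult_left)
        then have "even v1" by simp
        then show "\<exists>j\<in>{}. q dvd i - j" using v by simp
      qed auto
      then show ?thesis using v False by (simp add: zero_enat_def)
    qed
  qed
qed

end

section \<open>Rank-one data of a singular nonzero L\<close>

context gluing
begin

text \<open>As \<open>A\<close> commutes with \<open>L\<close>, it preserves the line of
  \<open>y1\<close>; its diagonal entries are units because their product is \<open>det A\<close>.
  The data do not depend on the gluing vector, so the representative can be changed
  afterwards.\<close>

lemma rank_one_exists:
  assumes D: "equivariant L v0 D" and basis: "y1 $ 1 * y2 $ 2 - y1 $ 2 * y2 $ 1 = d" "d * d = 1"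
    and im: "\<And>m. \<exists>k. L *v m = k *s y1" and L0: "L \<noteq> 0"
  obtains l eps a c where "\<And>v v1 v2. v = v1 *s y1 + v2 *s y2 \<Longrightarrow> rank_one A B L v y1 y2 l eps a c d v1 v2"
proof -
  obtain k1 k2 where k: "L *v axis 1 1 = k1 *s y1" "L *v axis 2 1 = k2 *s y1" using im by metis
  define l :: "int ^ 2" where "l = (\<chi> i. if i = 1 then k1 else k2)"
  have L_eq: "L *v m = (l $ 1 * m $ 1 + l $ 2 * m $ 2) *s y1" for m
    using k by (simp add: vec_eq_iff forall_2 sum_vec_2 axis_def l_def algebra_simps)
  have "l \<noteq> 0"
  proof
    assume "l = 0"
    then have "L *v m = 0" for m using L_eq[of m] by simp
    then have "L $ i $ j = 0" for i j using sum_vec_2[of L "axis j 1" i] exhaust_2[of j] by (auto simp: axis_def)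
    then show False using L0 by (simp add: vec_eq_iff)
  qed
  have coords: "\<exists>i j. u = i *s y1 + j *s y2" for u
  proof (intro exI)
    have "u $ 1 = (y1 $ 1 * y2 $ 2 - y1 $ 2 * y2 $ 1) * d * u $ 1" "u $ 2 = (y1 $ 1 * y2 $ 2 - y1 $ 2 * y2 $ 1) * d * u $ 2"
      unfolding basis(1) using basis(2) by simp_all
    then show "u = (d * (u $ 1 * y2 $ 2 - u $ 2 * y2 $ 1)) *s y1 + (d * (y1 $ 1 * u $ 2 - y1 $ 2 * u $ 1)) *s y2"
      by (simp add: vec_eq_iff forall_2 algebra_simps)
  qed
  have indep: "i = i' \<and> j = j'" if "i *s y1 + j *s y2 = i' *s y1 + j' *s y2" for i j i' j'
  proof -
    have e: "i * y1 $ 1 + j * y2 $ 1 = i' * y1 $ 1 + j' * y2 $ 1" "i * y1 $ 2 + j * y2 $ 2 = i' * y1 $ 2 + j' * y2 $ 2"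
      using that by (simp_all add: vec_eq_iff forall_2)
    have "i * d = i' * d" "j * d = j' * d" unfolding basis(1)[symmetric] using e by algebra+
    moreover have "d \<noteq> 0" using basis(2) by auto
    ultimately show ?thesis by simp
  qed
  obtain eps b where y1: "A *v y1 = eps *s y1 + b *s y2" using coords by blast
  obtain c a where y2: "A *v y2 = c *s y1 + a *s y2" using coords by blast
  have Al: "(l $ 1 * m $ 1 + l $ 2 * m $ 2) *s (A *v y1) = (l $ 1 * (A *v m) $ 1 + l $ 2 * (A *v m) $ 2) *s y1" for m
    using equivariant_commute[OF D, of m] unfolding L_eq by (simp add: vec_eq_iff sum_vec_2 algebra_simps)
  have eqs: "(l $ 1 * m $ 1 + l $ 2 * m $ 2) * eps = l $ 1 * (A *v m) $ 1 + l $ 2 * (A *v m) $ 2"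
    "(l $ 1 * m $ 1 + l $ 2 * m $ 2) * b = 0" for m
    using indep[of "(l $ 1 * m $ 1 + l $ 2 * m $ 2) * eps" "(l $ 1 * m $ 1 + l $ 2 * m $ 2) * b"
        "l $ 1 * (A *v m) $ 1 + l $ 2 * (A *v m) $ 2" 0] Al[of m]
    unfolding y1 by (simp_all add: vec_eq_iff algebra_simps)
  have n0: "l $ 1 * l $ 1 + l $ 2 * l $ 2 \<noteq> 0"
    using \<open>l \<noteq> 0\<close> by (auto simp: vec_eq_iff forall_2 sum_squares_eq_zero_iff)
  \<comment> \<open>At \<open>m = l\<close> the form takes its own squared length, which is not
    zero.\<close>
  have b0: "b = 0" using eqs(2)[of l] n0 unfolding mult_eq_0_iff by blast
  have "det A * d = (A *v y1) $ 1 * (A *v y2) $ 2 - (A *v y1) $ 2 * (A *v y2) $ 1"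
    by (simp add: det_2 sum_vec_2 algebra_simps flip: basis(1))
  also have "\<dots> = eps * a * d"
    unfolding y1 y2 b0 by (simp add: algebra_simps flip: basis(1))
  finally have "det A * d * d = eps * a * d * d" by simp
  then have detA: "det A = eps * a" using basis(2) by (simp add: mult.assoc)
  have "det A * det B = 1" using AB by (metis det_I det_mul)
  then have unit: "eps * (a * det B) = 1" "a * (eps * det B) = 1" unfolding detA by (simp_all add: algebra_simps)
  have sq: "x * x = 1" if "x * y = 1" for x y :: int
    using that by (auto simp: zmult_eq_1_iff)
  show ?thesis
  proof (rule that[of l eps a c])
    fix v v1 v2 assume v: "v = v1 *s y1 + v2 *s y2"
    show "rank_one A B L v y1 y2 l eps a c d v1 v2"
    proof unfold_locales
      show "L *v m = (l $ 1 * m $ 1 + l $ 2 * m $ 2) *s y1" for m by (rule L_eq)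
      show "A *v y1 = eps *s y1" using y1 b0 by simp
      show "A *v y2 = a *s y2 + c *s y1" using y2 by (simp add: add.commute)
      show "l $ 1 * (A *v m) $ 1 + l $ 2 * (A *v m) $ 2 = eps * (l $ 1 * m $ 1 + l $ 2 * m $ 2)" for m
        using eqs(1)[of m] by (simp add: mult.commute)
      show "eps * eps = 1" "a * a = 1" using sq unit by blast+
    qed (use basis \<open>l \<noteq> 0\<close> v in auto)
  qed
qed

text \<open>A nonzero column divided by the gcd of its entries is primitive, and Bezout coefficients
  complete it to a basis. The vanishing determinant makes the other column proportional to
  it.\<close>

lemma basis_exists:
  fixes L :: "int ^ 2 ^ 2"
  assumes L0: "L \<noteq> 0" and det: "det L = 0"
  obtains y1 y2 :: "int ^ 2" and d :: int where "y1 $ 1 * y2 $ 2 - y1 $ 2 * y2 $ 1 = d" "d * d = 1" "\<And>m. \<exists>k. L *v m = k *s y1"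
proof -
  obtain j where j: "L $ 1 $ j \<noteq> 0 \<or> L $ 2 $ j \<noteq> 0"
    using L0 by (auto simp: vec_eq_iff forall_2)
  define g where "g = gcd (L $ 1 $ j) (L $ 2 $ j)"
  have g: "g \<noteq> 0" using j by (simp add: g_def)
  obtain p r where pr: "L $ 1 $ j = g * p" "L $ 2 $ j = g * r" by (metis dvdE g_def gcd_dvd1 gcd_dvd2)
  obtain s t where "s * L $ 1 $ j + t * L $ 2 $ j = g" using bezout_int g_def by metis
  then have "g * (s * p + t * r) = g * 1" by (simp add: pr algebra_simps)
  then have st: "s * p + t * r = 1" using g by simp
  define y1 :: "int ^ 2" where "y1 = (\<chi> i. if i = 1 then p else r)"
  define y2 :: "int ^ 2" where "y2 = (\<chi> i. if i = 1 then - t else s)"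
  have "\<exists>k. L *v m = k *s y1" for m
  proof
    have "L $ 1 $ i * L $ 2 $ j = L $ 2 $ i * L $ 1 $ j" for i
      using det exhaust_2[of i] exhaust_2[of j] by (auto simp: det_2 algebra_simps)
    then have "g * (L $ 1 $ i * r) = g * (L $ 2 $ i * p)" for i
      by (simp add: pr algebra_simps)
    then have col: "L $ 1 $ i * r = L $ 2 $ i * p" for i using g by simp
    have "L $ 1 $ i = (s * L $ 1 $ i + t * L $ 2 $ i) * p" "L $ 2 $ i = (s * L $ 1 $ i + t * L $ 2 $ i) * r" for i
      using col[of i] st by algebra+
    from this(1)[of 1] this(1)[of 2] this(2)[of 1] this(2)[of 2]
    show "L *v m = ((s * L $ 1 $ 1 + t * L $ 2 $ 1) * m $ 1 + (s * L $ 1 $ 2 + t * L $ 2 $ 2) * m $ 2) *s y1"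
      by (simp add: vec_eq_iff forall_2 sum_vec_2 y1_def) algebra
  qed
  moreover have "y1 $ 1 * y2 $ 2 - y1 $ 2 * y2 $ 1 = 1" using st by (simp add: y1_def y2_def algebra_simps)
  ultimately show ?thesis using that[of y1 y2 1] by simp
qed

end

lemma unimodular_if_bij:
  assumes "bij (\<lambda>(a, b). a *s y1 + b *s (y2 :: int ^ 2))"
  defines "d \<equiv> y1 $ 1 * y2 $ 2 - y1 $ 2 * y2 $ 1"
  shows "d * d = 1"
proof -
  obtain a1 b1 where e1: "a1 *s y1 + b1 *s y2 = axis 1 1"
    using bij_is_surj[OF assms(1)] by (metis (no_types, lifting) case_prod_conv surjD surj_pair)
  obtain a2 b2 where e2: "a2 *s y1 + b2 *s y2 = axis 2 1"
    using bij_is_surj[OF assms(1)] by (metis (no_types, lifting) case_prod_conv surjD surj_pair)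
  have "a1 * y1 $ 1 + b1 * y2 $ 1 = 1" "a1 * y1 $ 2 + b1 * y2 $ 2 = 0"
    "a2 * y1 $ 1 + b2 * y2 $ 1 = 0" "a2 * y1 $ 2 + b2 * y2 $ 2 = 1"
    using e1 e2 by (simp_all add: vec_eq_iff forall_2 axis_def)
  then have "d * (a1 * b2 - a2 * b1) = 1" unfolding d_def by algebra
  then show ?thesis by (auto simp: zmult_eq_1_iff)
qed

lemma card_quotient_multiples:
  fixes y :: "int ^ 2"
  assumes y: "y \<noteq> 0" and q: "q > 0" and H: "H = range (\<lambda>k. (q * k) *s y)"
  shows "card (range (\<lambda>a. a *s y) // coset_rel H) = nat q"
proof -
  define cl where "cl a = coset_rel H `` {a *s y}" for a
  have inj: "a = b" if "a *s y = b *s y" for a b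
    using that y by (auto simp: vec_eq_iff)
  have mem: "w \<in> cl a \<longleftrightarrow> (\<exists>k. w = (a - q * k) *s y)" for w a
  proof -
    have "a *s y - w = (q * k) *s y \<longleftrightarrow> w = (a - q * k) *s y" for k
      by (auto simp: vec_eq_iff algebra_simps)
    then show ?thesis by (auto simp: cl_def coset_rel_def H)
  qed
  have "cl a = cl (a mod q)" for a
  proof -
    have "(\<exists>k. w = (a - q * k) *s y) \<longleftrightarrow> (\<exists>k. w = (a mod q - q * k) *s y)" for w
    proof
      assume "\<exists>k. w = (a - q * k) *s y"
      then obtain k where "w = (a - q * k) *s y" by blast
      then show "\<exists>k. w = (a mod q - q * k) *s y"
        by (intro exI[of _ "k - a div q"]) (simp add: algebra_simps minus_div_mult_eq_mod[symmetric])
    next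
      assume "\<exists>k. w = (a mod q - q * k) *s y"
      then obtain k where "w = (a mod q - q * k) *s y" by blast
      then show "\<exists>k. w = (a - q * k) *s y"
        by (intro exI[of _ "k + a div q"]) (simp add: algebra_simps minus_div_mult_eq_mod[symmetric])
    qed
    then show ?thesis using mem by (simp add: set_eq_iff)
  qed
  then have "range cl = cl ` {0..<q}"
    using q by (auto simp: image_iff) (metis atLeastLessThan_iff pos_mod_bound pos_mod_sign)
  moreover have "range (\<lambda>a. a *s y) // coset_rel H = range cl"
    by (auto simp: quotient_def cl_def)
  moreover have "inj_on cl {0..<q}"
  proof (rule inj_onI)
    fix a b assume ab: "a \<in> {0..<q}" "b \<in> {0..<q}" "cl a = cl b"
    have "a *s y \<in> cl a" unfolding mem by (rule exI[of _ 0]) simp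
    then obtain k where "a *s y = (b - q * k) *s y" using ab(3) mem by blast
    then have "a = b - q * k" by (rule inj)
    then have "a - b = q * (- k)" by simp
    then have "q dvd a - b" by (rule dvdI)
    then have "a mod q = b mod q" by (simp add: mod_eq_dvd_iff)
    then show "a = b" using ab(1,2) by simp
  qed
  ultimately show ?thesis by (simp add: card_image)
qed

section \<open>Comparison with the data of the bundle map\<close>

context rank_one
begin

lemma MC_eq_points:
  assumes "is_lift f G" "equivariant Phi v G" "L = Phi - mat 1"
  shows "MC A f id = points" "MCC A f id = comps"
  using MC_eq_INF[OF assms(1,2)] MCC_eq_INF[OF assms(1,2)]
  unfolding points_def comps_def assms(3)[symmetric] by simp_all

lemma eigenvalue:
  assumes "\<And>w. rmat L *v w = 0 \<Longrightarrow> rmat A *v w = of_int b *\<^sub>R w"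
  shows "a = b"
proof -
  have "rmat L *v ker = 0" by (simp add: rmat_L)
  then have e: "of_int a *\<^sub>R ker = of_int b *\<^sub>R ker" using assms A_ker by metis
  have "real_of_int a * rho ker = real_of_int b * rho ker"
    unfolding rho_linear(3)[symmetric] e by (rule refl)
  then show ?thesis by simp
qed

lemma q_lattice: "range ((*v) L) = range (\<lambda>k. (q * k) *s y1)"
proof -
  have "L *v m = ill m *s y1" for m by (simp add: L_eq ill_def)
  then show ?thesis
    using ill_multiple q_dvd_ill by (auto simp: image_iff dvd_def) metis+
qed

lemma y1_nonzero: "y1 \<noteq> 0"
  using coord_basis(1) by (auto simp: i1_def)

lemma reversing_formula:
  assumes a1: "a = - 1" and v2: "v2 = 0" and qn: "int qn = q"
  shows "comps = (let r = nat (gcd (int qn) v1) in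
       if det A = -1 \<and> odd (qn div r) then enat r
       else if det A = 1 \<and> even qn \<and> even v1 then 2
       else if det A = 1 \<and> odd qn then 1
       else 0) \<and>
     points = (if comps = 0 then 0 else \<infinity>)"
proof -
  have par: "odd q \<longleftrightarrow> odd qn" by (simp flip: qn)
  have "eps = 1 \<or> eps = - 1" using eps by (metis power2_eq_1_iff power2_eq_square)
  then show ?thesis
  proof
    assume ep: "eps = 1"
    define r where "r = nat (gcd (int qn) v1)"
    have r: "int r = gcd q v1" by (simp add: r_def qn)
    have "int (qn div r) = q div gcd q v1" by (simp add: zdiv_int qn r)
    then have odd: "odd (q div gcd q v1) \<longleftrightarrow> odd (qn div r)" by (metis even_of_nat)
    have "r > 0" using r q_pos by (metis gcd_pos_int less_irrefl of_nat_0_less_iff)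
    then have "enat r \<noteq> 0" by (simp add: zero_enat_def)
    moreover have "nat (gcd q v1) = r" by (simp flip: r)
    moreover have "det A = - 1" by (simp add: det_A ep a1)
    ultimately show ?thesis
      using reversing_orientable[OF a1 v2 ep] unfolding odd r_def[symmetric] Let_def by simp
  next
    assume ep: "eps = - 1"
    have "det A = 1" by (simp add: det_A ep a1)
    then show ?thesis
      using reversing_nonorientable[OF a1 v2 ep] unfolding par by (simp add: Let_def)
  qed
qed

text \<open>The hypothesis leaves out \<open>a = - 1\<close> with even nonzero \<open>v2\<close>;
  such a gluing vector has to be shifted to \<open>v2 = 0\<close> beforehand.\<close>

lemma points_dichotomy:
  assumes "a = 1 \<or> odd v2 \<or> v2 = 0"
  shows "points = (if comps = 0 then 0 else \<infinity>)"
proof -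
  have "a = 1 \<or> a = - 1" using aa by (metis power2_eq_1_iff power2_eq_square)
  then show ?thesis
  proof
    assume a1: "a = 1"
    have "comps = 0 \<longleftrightarrow> v2 = 0" using q_pos by (simp add: preserving_formula[OF a1] zero_enat_def)
    then show ?thesis by (simp add: preserving_formula[OF a1])
  next
    assume a1: "a = - 1"
    show ?thesis
    proof (cases "v2 = 0")
      case True
      show ?thesis by (rule reversing_formula[OF a1 True, of "nat q", THEN conjunct2]) (use q_pos in simp)
    next
      case False
      then have "odd v2" using assms a1 by auto
      then show ?thesis using reversing_odd[OF a1] by simp
    qed
  qed
qed

end

theorem theorem1p34:
  fixes A :: "int ^ 2 ^ 2" and f :: "bundle_point \<Rightarrow> bundle_point"
  assumes "invertible A" and "fiberwise A f"
  shows
    "(dim (W1 A f) = 0 \<longrightarrow>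
        MC A f id = \<infinity> \<and>
        (\<forall>v. represents_section_class A f v \<longrightarrow>
           finite (beta_orbits A f v) \<and>
           MCC A f id = enat (card (beta_orbits A f v)))) \<and>
     (dim (W1 A f) = 1 \<longrightarrow>
        MC A f id = (if MCC A f id = 0 then 0 else \<infinity>) \<and>
        (\<forall>y1 y2 v v1 v2 q.
           adapted_basis A f y1 y2 \<longrightarrow>
           represents_section_class A f v \<longrightarrow>
           v = v1 *s y1 + v2 *s y2 \<longrightarrow>
           q = torsion_order A f \<longrightarrow>
             ((\<forall>w \<in> W1 A f. map_matrix of_int A *v w = w) \<longrightarrow>
                MCC A f id = enat (q * nat \<bar>v2\<bar>)) \<and>
             ((\<forall>w \<in> W1 A f. map_matrix of_int A *v w = - w) \<and> odd v2 \<longrightarrow>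
                MC A f id = 0 \<and> MCC A f id = 0) \<and>
             ((\<forall>w \<in> W1 A f. map_matrix of_int A *v w = - w) \<and> v2 = 0 \<longrightarrow>
                MCC A f id =
                  (let r = nat (gcd (int q) v1) in
                   if det A = -1 \<and> odd (q div r) then enat r
                   else if det A = 1 \<and> even q \<and> even v1 then 2
                   else if det A = 1 \<and> odd q then 1
                   else 0)))) \<and>
     (dim (W1 A f) = 2 \<longrightarrow> MC A f id = 0 \<and> MCC A f id = 0)"
proof -
  obtain B where B: "A ** B = mat 1" "B ** A = mat 1" using assms(1) unfolding invertible_def by blast
  interpret gluing A B by unfold_locales (rule B)+
  obtain F Phi v0 where F: "is_lift f F" "equivariant Phi v0 F" using fiberwise_lift_exists[OF assms(2)] by blast
  define L where "L = Phi - mat 1"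
  have E: "equivariant L v0 (\<lambda>p. F p - fst p)" by (rule equivariant_L[OF F L_def])
  have hom: "fibre_hom A f = (*v) Phi" using fibre_hom_eq[OF F] by blast
  have "matrix ((*v) Phi) = Phi"
    by (simp add: matrix_def vec_eq_iff sum_vec_2 axis_def forall_2)
  then have real: "fibre_hom_real A f x = rmat Phi *v x" for x
    by (simp add: fibre_hom_real_def hom)
  have Lx: "rmat L *v x = rmat Phi *v x - x" for x
    by (simp add: L_def rmat_diff rmat_1 matrix_vector_mult_diff_rdistrib)
  have W1: "W1 A f = {x. rmat L *v x = 0}"
    by (simp add: W1_def real Lx)
  have plane: "ivec (L *v m) \<in> L_plane A f" for m
    using Lx[of "ivec m"] by (auto simp: L_plane_def real intro!: image_eqI[of _ _ "ivec m"])
  have det: "det L = 0 \<longleftrightarrow> (\<exists>x. x \<noteq> 0 \<and> rmat L *v x = 0)"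
  proof -
    have "det L = 0 \<longleftrightarrow> \<not> invertible (rmat L)" by (simp add: invertible_det_nz det_rmat)
    then show ?thesis unfolding invertible_left_inverse matrix_left_invertible_ker by blast
  qed
  have L0: "L = 0" if "W1 A f = UNIV"
  proof -
    have "ivec (L *v axis j 1) = 0" for j
      using that by (auto simp: W1 simp flip: rmat_ivec)
    then have "L *v axis j 1 = 0" for j by simp
    then have "(L *v axis j 1) $ i = 0" for i j by simp
    moreover have "(L *v axis j 1) $ i = L $ i $ j" for i j
      using exhaust_2[of j] by (auto simp: sum_vec_2 axis_def)
    ultimately have "L $ i $ j = 0" for i j by metis
    then show ?thesis by (simp add: vec_eq_iff)
  qed
  have nonsingular: "det L \<noteq> 0" if "dim (W1 A f) = 0"
    using that det unfolding dim_eq_0 W1 by blast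
  have case0: "MC A f id = \<infinity> \<and> (\<forall>v. represents_section_class A f v \<longrightarrow>
      finite (beta_orbits A f v) \<and> MCC A f id = enat (card (beta_orbits A f v)))"
    if d: "dim (W1 A f) = 0"
  proof (intro conjI allI impI)
    show "MC A f id = \<infinity>" by (rule MC_nonsingular[OF F L_def nonsingular[OF d]])
    fix v assume "represents_section_class A f v"
    from represents_section_class_lift[OF this F] obtain G where G: "is_lift f G" "equivariant Phi v G" .
    show "finite (beta_orbits A f v)" "MCC A f id = enat (card (beta_orbits A f v))"
      by (rule MCC_nonsingular[OF G L_def nonsingular[OF d]])+
  qed
  have case2: "MC A f id = 0 \<and> MCC A f id = 0" if "dim (W1 A f) = 2"
  proof -
    have "subspace (W1 A f)"
      unfolding W1 subspace_def by (simp add: matrix_vector_right_distrib matrix_vector_mult_scaleR)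
    moreover have "span (W1 A f) = UNIV" using that dim_eq_full[of "W1 A f"] by simp
    ultimately have "W1 A f = UNIV" by (metis span_eq_iff)
    then show ?thesis using MC_MCC_identity[OF F L_def L0] by blast
  qed
  have case1: "L \<noteq> 0" "det L = 0" if d: "dim (W1 A f) = 1"
  proof -
    show "L \<noteq> 0"
    proof
      assume "L = 0"
      then have "rmat L = 0" by (simp add: vec_eq_iff)
      then have "W1 A f = UNIV" by (simp add: W1)
      then show False using d by simp
    qed
    show "det L = 0"
    proof (rule ccontr)
      assume "det L \<noteq> 0"
      then have "W1 A f \<subseteq> {0}" using det unfolding W1 by blast
      then show False using d by (simp flip: dim_eq_0)
    qed
  qed
  \<comment> \<open>This dichotomy is asserted without a given basis or representative, so both are
    constructed here.\<close>
  have MC1: "MC A f id = (if MCC A f id = 0 then 0 else \<infinity>)" if d: "dim (W1 A f) = 1"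
  proof -
    obtain y1 y2 :: "int ^ 2" and dd :: int
      where y: "y1 $ 1 * y2 $ 2 - y1 $ 2 * y2 $ 1 = dd" "dd * dd = 1" "\<And>m. \<exists>k. L *v m = k *s y1"
      by (rule basis_exists[OF case1[OF d]]) blast
    obtain l eps a c
      where R: "\<And>v v1 v2. v = v1 *s y1 + v2 *s y2 \<Longrightarrow> rank_one A B L v y1 y2 l eps a c dd v1 v2"
      by (rule rank_one_exists[OF E y case1(1)[OF d]]) blast
    define h where "h = (\<lambda>v :: int ^ 2. dd * (y1 $ 1 * v $ 2 - y1 $ 2 * v $ 1))"
    have ex: "v = (dd * (v $ 1 * y2 $ 2 - v $ 2 * y2 $ 1)) *s y1 + h v *s y2" for v
    proof -
      have "v $ 1 = (y1 $ 1 * y2 $ 2 - y1 $ 2 * y2 $ 1) * dd * v $ 1" "v $ 2 = (y1 $ 1 * y2 $ 2 - y1 $ 2 * y2 $ 1) * dd * v $ 2"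
        unfolding y(1) using y(2) by simp_all
      then show ?thesis by (simp add: h_def vec_eq_iff forall_2 algebra_simps)
    qed
    have by_lift: ?thesis if "is_lift f G" "equivariant Phi v G" "a = 1 \<or> odd (h v) \<or> h v = 0" for G v
    proof -
      interpret rank_one A B L v y1 y2 l eps a c dd "dd * (v $ 1 * y2 $ 2 - v $ 2 * y2 $ 1)" "h v"
        by (rule R[OF ex])
      show ?thesis using points_dichotomy[OF that(3)] MC_eq_points[OF that(1,2) L_def] by simp
    qed
    interpret R0: rank_one A B L v0 y1 y2 l eps a c dd "dd * (v0 $ 1 * y2 $ 2 - v0 $ 2 * y2 $ 1)" "h v0"
      by (rule R[OF ex])
    show ?thesis
    proof (cases "a = 1 \<or> odd (h v0)")
      case True
      then show ?thesis using by_lift[OF F] by blast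
    next
      case False
      then obtain k where k: "h v0 = 2 * k" by (auto elim: evenE)
      have "a = - 1" using R0.aa False by (metis power2_eq_1_iff power2_eq_square)
      \<comment> \<open>As \<open>a = - 1\<close>, passing from \<open>n\<close> to
        \<open>B *v n\<close> changes the sign of the second coordinate, so the shift by
        \<open>n\<close> lowers that of the gluing vector by 2 k.\<close>
      define n where "n = (- k) *s y2"
      have "R0.i2 (A *v (B *v n)) = a * R0.i2 (B *v n)" by (rule R0.icoord_A)
      then have "R0.i2 (B *v n) = k" using \<open>a = - 1\<close> by (simp add: n_def)
      then have "R0.i2 (v0 + n - B *v n) = 0" using k by (simp add: n_def)
      then have "h (v0 + n - B *v n) = 0" by (simp add: h_def R0.i2_def)
      then show ?thesis using by_lift[OF shift_lift[OF F]] by blast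
    qed
  qed
  have formulas: "((\<forall>w \<in> W1 A f. map_matrix of_int A *v w = w) \<longrightarrow>
                MCC A f id = enat (q * nat \<bar>v2\<bar>)) \<and>
             ((\<forall>w \<in> W1 A f. map_matrix of_int A *v w = - w) \<and> odd v2 \<longrightarrow>
                MC A f id = 0 \<and> MCC A f id = 0) \<and>
             ((\<forall>w \<in> W1 A f. map_matrix of_int A *v w = - w) \<and> v2 = 0 \<longrightarrow>
                MCC A f id =
                  (let r = nat (gcd (int q) v1) in
                   if det A = -1 \<and> odd (q div r) then enat r
                   else if det A = 1 \<and> even q \<and> even v1 then 2
                   else if det A = 1 \<and> odd q then 1
                   else 0))"
    if d: "dim (W1 A f) = 1" and ad: "adapted_basis A f y1 y2" and rep: "represents_section_class A f v"
      and v: "v = v1 *s y1 + v2 *s y2" and q: "q = torsion_order A f" for y1 y2 v v1 v2 q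
  proof -
    have line: "{m. ivec m \<in> L_plane A f} = range (\<lambda>a. a *s y1)" and bij: "bij (\<lambda>(a, b). a *s y1 + b *s y2)"
      using ad by (auto simp: adapted_basis_def)
    have im: "\<exists>k. L *v m = k *s y1" for m using plane[of m] line by blast
    obtain l eps a c
      where R: "\<And>v v1 v2. v = v1 *s y1 + v2 *s y2 \<Longrightarrow>
        rank_one A B L v y1 y2 l eps a c (y1 $ 1 * y2 $ 2 - y1 $ 2 * y2 $ 1) v1 v2"
      by (rule rank_one_exists[OF E refl unimodular_if_bij[OF bij] im case1(1)[OF d]]) blast
    interpret R: rank_one A B L v y1 y2 l eps a c "y1 $ 1 * y2 $ 2 - y1 $ 2 * y2 $ 1" v1 v2
      by (rule R[OF v])
    \<comment> \<open>The lift is replaced by one whose gluing vector is the given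
      representative.\<close>
    from represents_section_class_lift[OF rep F] obtain G where G: "is_lift f G" "equivariant Phi v G" .
    note MC = R.MC_eq_points[OF G L_def]
    have "torsion_order A f = nat R.q"
      unfolding torsion_order_def line
      by (rule card_quotient_multiples[OF R.y1_nonzero R.q_pos]) (simp only: L_lattice_eq[OF F L_def] R.q_lattice)
    then have qn: "q = nat R.q" "int q = R.q" using q R.q_pos by simp_all
    have id: "a = 1" if "\<forall>w \<in> W1 A f. map_matrix of_int A *v w = w"
      by (rule R.eigenvalue) (use that in \<open>simp add: W1\<close>)
    have neg: "a = - 1" if "\<forall>w \<in> W1 A f. map_matrix of_int A *v w = - w"
      by (rule R.eigenvalue) (use that in \<open>simp add: W1\<close>)
    show ?thesis
      unfolding MC
      using R.preserving_formula[OF id] R.reversing_odd[OF neg] R.reversing_formula[OF neg _ qn(2)] qn(1)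
      by blast
  qed
  show ?thesis using case0 case2 MC1 formulas by blast
qed

end
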